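(* Let $a,b\in\mathbb{R}^*$, let $\Lambda_4=ayz\,\partial_{23}+axz\,\partial_{31}+(bxy+z^2)\,\partial_{12}$ on $\mathbb{R}^3$, and let $(E_r,d_r)$ be the spectral sequence of the vertically positive double complex $(\mathcal{P},d=d'+d'')$ associated with $\Lambda_4$ (see context). For any $n\in\mathbb{N}$, the even terms $$E_{2(n-1)\alpha+4}=E_{2(n-1)\alpha+6}=\ldots=E_{2n\alpha+2}$$ (for $n=0$, this package contains only the term $E_2$) are canonically isomorphic (i.e. $d_{2(n-1)\alpha+4}=d_{2(n-1)\alpha+6}=\ldots=d_{2n\alpha}=0$) and admit the following system of representatives: 1. All representatives of type 2 of $E_2$, except $\mathbb{R}z^{i(2\alpha+\beta)+2}\partial_{12}$ and $\mathbb{R}z^{i(2\alpha+\beta)+3}\partial_{123}$ for all admissible $i\in\{0,1,\ldots,n-1\}$. 2. All representatives of type 1 of $E_2$, altered as follows: - For all admissible $i\in\{n,n+1,\ldots\}$, $Z^{q_{ic},p_i}$ is replaced by $\sum_{k=0}^{\alpha n}Z^{q_{ic}-2k,p_i+2k}$, where the coefficients $A_{ik},B_{ik},C_{ik},D_{ik},E_{ik},F_{ik}$ incorporated in the terms of this sum verify the conditions $(C_0)$–$(C_2)$ of the context for $k=0,1,\ldots,\alpha n-1$. - For all admissible $i\in\{0,1,\ldots,n-1\}$, $Z^{q_{ic},p_i}$ is replaced by $$\begin{cases}\left(D'+\frac{z^2}{2a+b}\right)^{\alpha i}z^{\beta i}A_{i0},&\text{if }c=0,\\ \left(D'+\frac{z^2}{2a+b}\right)^{\alpha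 i}z^{\beta i}\left(B_{i0}(Y_1+\tfrac12Y_3)+C_{i0}(Y_2+\tfrac12Y_3)\right),&\text{if }c=1,\\ D'^{\alpha i}z^{\beta i}E_{i0}(Y_{23}+Y_{31}),&\text{if }c=2.\end{cases}$$
   Context: Coordinates $(x,y,z)=(x_1,x_2,x_3)$ on $\mathbb{R}^3$; $\partial_{ij}=\partial_i\wedge\partial_j$, $\partial_{123}=\partial_1\wedge\partial_2\wedge\partial_3$; $Y_1=x\partial_1$, $Y_2=y\partial_2$, $Y_3=z\partial_3$, $Y_{ij}=Y_i\wedge Y_j$, $Y_{123}=Y_1\wedge Y_2\wedge Y_3$; $D=xyz$, $D'=xy$. Write $\Lambda_4=\Lambda_{4,I}+\Lambda_{4,II}$ with $\Lambda_{4,I}=aY_{23}+aY_{31}+bY_{12}$ and $\Lambda_{4,II}=z^2\partial_{12}=\frac{z^3}{D}Y_{12}$. Complex: $\mathcal{P}$ is the space of polyvector fields on $\mathbb{R}^3$ with coefficients in $\mathbb{R}[[x,y,z]]$. With $[\cdot,\cdot]$ the Schouten bracket, $d'=[\Lambda_{4,I},\cdot]$, $d''=[\Lambda_{4,II},\cdot]$, $d=[\Lambda_4,\cdot]=d'+d''$. Any cochain of degree $c\in\{0,1,2,3\}$ is written as $\sum\frac{\sigma}{D}\mathbf{Y}$, with $\sigma$ a formal power series and $\mathbf{Y}$ a wedge product of $c$ fields $Y_i$. $\mathcal{P}^{rs}$ is spanned by the cochains for which all monomials $x^{j_1}y^{j_2}z^{j_3}$ in the numerators $\sigma$ satisfy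 $r=j_1+j_2+c$, $s=j_3$. Then $d':\mathcal{P}^{rs}\to\mathcal{P}^{r+1,s}$ and $d'':\mathcal{P}^{rs}\to\mathcal{P}^{r-1,s+2}$, and $\mathcal{P}=\bigoplus_{r,s}\mathcal{P}^{rs}$, $\mathcal{P}^n=\bigoplus_{r+s=n}\mathcal{P}^{rs}$. Direct sums over infinitely many degrees are understood in the formal sense (infinite formal sums allowed). Spectral sequence: with $K=\mathcal{P}$, $K^n=\mathcal{P}^n$, $K_p=\bigoplus_{r\in\mathbb{N},s\ge p}\mathcal{P}^{rs}$, one sets $E_r^{pq}=Z_r^{pq}/(Z_{r-1}^{p+1,q-1}+B_{r-1}^{pq})$, $Z_r^{pq}=K_p\cap d^{-1}K_{p+r}\cap K^{p+q}$, $B_r^{pq}=K_p\cap dK_{p-r}\cap K^{p+q}$, $d_r:E_r^{pq}\to E_r^{p+r,q+1-r}$ induced by $d$. A system of representatives of a space of classes consists of representatives in one-to-one correspondence with the classes. Conventions on $\alpha,\beta$ and admissible $i$: if $\frac ba\in\mathbb{Q}^*_+$, $(\beta,\alpha)\sim(b,a)$ is the irreducible representative of $\frac ba$, $\alpha,\beta\in\mathbb{N}^*$, and every $i\in\mathbb{N}$ is admissible. If $\frac ba\in\mathbb{R}^*\setminus\mathbb{Q}^*_+$, then $i=0$ is admissible; if moreover $\frac ba=\frac{-1}{\alpha}$ with $\alpha\in\mathbb{N}^*$ (written $(b,a)\sim(\beta,\alpha)=(-1,\alpha)$), then $i=1$ is admissible too, with the additional conditions $A_{10}=B_{10}=C_{10}=0$;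 if $\frac ba\in\mathbb{R}^*\setminus\mathbb{Q}^*_+$ is not of the form $-1/\alpha$, one sets $\alpha=1$ ($\beta$ then only occurs multiplied by $i=0$). For $c\in\{0,1,2\}$ and admissible $i$, set $(q_{ic},p_i)=(2\alpha i+2+c,\beta i+1)$ and, for $k\in\{0,1,\ldots,\alpha i\}$, $$Z^{q_{ic}-2k,p_i+2k}=\frac{\binom{\alpha i}{k}}{(2a+b)^k}D'^{\alpha i-k}z^{\beta i+2k}\cdot\begin{cases} A_{ik}&(c=0)\\ B_{ik}Y_1+C_{ik}Y_2+D_{ik}Y_3&(c=1)\\ E_{ik}Y_{23}+F_{ik}Y_{31}&(c=2)\end{cases}$$ with real coefficients. Conditions (at index $k$): $(C_0)$, for $c=0$: $A_{i,k+1}=A_{ik}$; $(C_1)$, for $c=1$: $B_{i,k+1}+C_{i,k+1}=\frac{(\alpha i-k+1)(B_{ik}+C_{ik})-2D_{ik}}{\alpha i-k}$ and $D_{i,k+1}=D_{ik}$; $(C_2)$, for $c=2$: $E_{i,k+1}-F_{i,k+1}=\frac{\alpha i-k+1}{\alpha i-k}(E_{ik}-F_{ik})$. Representatives of $E_2$ (which is isomorphic with the cohomology of $(\mathcal{P},d')$). Let $\mathrm{Cas}(\Lambda_{4,I})=\bigoplus_{i\in\mathbb{N}}\mathbb{R}D'^{\alpha i}z^{\beta i}$ if $\frac ba\in\mathbb{Q}^*_+$, and $\mathrm{Cas}(\Lambda_{4,I})=\mathbb{R}$ otherwise. Let $\mathcal{A}_\alpha=D'^{\alpha}z^{-1}$.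 Type 1: the cochains $Z^{q_{ic},p_i}$ ($i$ admissible, $c\in\{0,1,2\}$, all values of the coefficients at $k=0$, subject to the additional conditions above when $i=1$, $(b,a)\sim(-1,\alpha)$). Type 2: $\mathrm{Cas}(\Lambda_{4,I})Y_{12}$, $\mathrm{Cas}(\Lambda_{4,I})Y_{123}$, $\mathbb{R}[[z]]\partial_{12}$, $\mathbb{R}[[z]]\partial_{123}$; in addition, if $a=b$: $\mathbb{R}[[x]]\partial_{23}$, $\mathbb{R}[[y]]\partial_{31}$, $(\mathbb{R}[[x]]\oplus\mathbb{R}[[y]])\partial_{123}$ (in the coefficients of $\partial_{123}$ the constant term $\mathbb{R}$ is counted only once); in addition, if $(b,a)\sim(-1,\alpha)$: $\mathbb{R}\mathcal{A}_\alpha Y_{123}$. *)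

theory Defs
  imports
    "HOL-Computational_Algebra.Formal_Power_Series"
    "HOL-Library.Function_Algebras"
begin

unbundle fps_syntax

section \<open>Formal power series in three variables\<close>

text \<open>
  The ring \<open>\<real>[[x,y,z]]\<close> is represented as \<open>\<real>[[z]][[y]][[x]]\<close>, so that
  \<open>f $ i $ j $ k\<close> is the coefficient of \<open>x^i y^j z^k\<close>.
\<close>

type_synonym ps3 = "real fps fps fps"

definition cst :: "real \<Rightarrow> ps3"
  where "cst c = fps_const (fps_const (fps_const c))"

definition vx :: ps3 where "vx = fps_X"
definition vy :: ps3 where "vy = fps_const fps_X"
definition vz :: ps3 where "vz = fps_const (fps_const fps_X)"

definition Dp :: ps3 where "Dp = vx * vy"

datatype coord = X1 | X2 | X3

lemma UNIV_coord: "(UNIV :: coord set) = {X1, X2, X3}"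
  using coord.exhaust by auto

instance coord :: finite
  by standard (simp add: UNIV_coord)

fun pos :: "coord \<Rightarrow> nat" where
  "pos X1 = 1"
| "pos X2 = 2"
| "pos X3 = 3"

fun pd :: "coord \<Rightarrow> ps3 \<Rightarrow> ps3" where
  "pd X1 f = fps_deriv f"
| "pd X2 f = Abs_fps (\<lambda>i. fps_deriv (f $ i))"
| "pd X3 f = Abs_fps (\<lambda>i. Abs_fps (\<lambda>j. fps_deriv (f $ i $ j)))"


section \<open>Polyvector fields and the Schouten bracket\<close>

text \<open>
  \<open>P I\<close> is the coefficient of \<open>P\<close> at \<open>\<partial>\<^sub>I\<close>, the wedge product of the \<open>\<partial>\<^sub>l\<close>, \<open>l \<in> I\<close>,
  taken in increasing order. Hence \<open>\<partial>\<^sub>3 \<and> \<partial>\<^sub>1\<close> has coefficient \<open>-1\<close> at \<open>{X1, X3}\<close>.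
  Addition of polyvector fields is pointwise.
\<close>

type_synonym pvf = "coord set \<Rightarrow> ps3"

definition smul :: "ps3 \<Rightarrow> pvf \<Rightarrow> pvf"  (infixr "\<odot>" 75)
  where "g \<odot> P = (\<lambda>I. g * P I)"

text \<open>The sign \<open>\<epsilon>\<close> in \<open>\<partial>\<^sub>I \<and> \<partial>\<^sub>J = \<epsilon> \<partial>\<^sub>I\<^sub>\<union>\<^sub>J\<close> for disjoint \<open>I\<close>, \<open>J\<close>.\<close>

definition wsign :: "coord set \<Rightarrow> coord set \<Rightarrow> ps3"
  where "wsign I J = (-1) ^ card {(i, j). i \<in> I \<and> j \<in> J \<and> pos j < pos i}"

definition wedge :: "pvf \<Rightarrow> pvf \<Rightarrow> pvf"  (infixl "\<^bold>\<and>" 77)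
  where "P \<^bold>\<and> Q = (\<lambda>L. \<Sum>I\<in>Pow L. wsign I (L - I) * P I * Q (L - I))"

definition pv_one :: pvf where "pv_one = (\<lambda>I. if I = {} then 1 else 0)"

definition del :: "coord \<Rightarrow> pvf" where "del l = (\<lambda>I. if I = {l} then 1 else 0)"

definition pv_pd :: "coord \<Rightarrow> pvf \<Rightarrow> pvf"
  where "pv_pd l P = (\<lambda>I. pd l (P I))"

text \<open>
  Left and right derivatives with respect to the odd variable \<open>\<xi>\<^sub>l = \<partial>\<^sub>l\<close>; in these terms
  \<open>[P,Q] = \<Sum>\<^sub>l (P \<leftarrow>\<partial>/\<partial>\<xi>\<^sub>l) \<and> \<partial>Q/\<partial>x\<^sub>l - \<partial>P/\<partial>x\<^sub>l \<and> (\<partial>/\<partial>\<xi>\<^sub>l\<rightarrow> Q)\<close>. On vector fields this is the Lie bracket,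
  and \<open>[X,f] = X(f)\<close>. Other sign conventions change \<open>[\<Lambda>,\<cdot>]\<close> only by a sign depending on the
  degree of the argument.
\<close>

definition left_der :: "coord \<Rightarrow> pvf \<Rightarrow> pvf"
  where "left_der l Q = (\<lambda>I. if l \<in> I then 0 else wsign {l} I * Q (insert l I))"

definition right_der :: "coord \<Rightarrow> pvf \<Rightarrow> pvf"
  where "right_der l P = (\<lambda>I. if l \<in> I then 0 else wsign I {l} * P (insert l I))"

definition schouten :: "pvf \<Rightarrow> pvf \<Rightarrow> pvf"
  where "schouten P Q =
    (\<Sum>l\<in>UNIV. right_der l P \<^bold>\<and> pv_pd l Q - pv_pd l P \<^bold>\<and> left_der l Q)"

definition Y1 :: pvf where "Y1 = vx \<odot> del X1"
definition Y2 :: pvf where "Y2 = vy \<odot> del X2"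
definition Y3 :: pvf where "Y3 = vz \<odot> del X3"

definition del12 :: pvf where "del12 = del X1 \<^bold>\<and> del X2"
definition del23 :: pvf where "del23 = del X2 \<^bold>\<and> del X3"
definition del31 :: pvf where "del31 = del X3 \<^bold>\<and> del X1"
definition del123 :: pvf where "del123 = del X1 \<^bold>\<and> del X2 \<^bold>\<and> del X3"

definition Y12 :: pvf where "Y12 = Y1 \<^bold>\<and> Y2"
definition Y23 :: pvf where "Y23 = Y2 \<^bold>\<and> Y3"
definition Y31 :: pvf where "Y31 = Y3 \<^bold>\<and> Y1"
definition Y123 :: pvf where "Y123 = Y1 \<^bold>\<and> Y2 \<^bold>\<and> Y3"

text \<open>
  Multiplication by \<open>z^m\<close> for an integer \<open>m\<close>. For \<open>m < 0\<close> this is division by \<open>z^(-m)\<close>; it is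
  only relevant for polyvector fields all of whose coefficients are divisible by \<open>z^(-m)\<close>
  (e.g. \<open>z^(-1) Y\<^sub>3 = \<partial>\<^sub>3\<close>).
\<close>

definition zmul :: "int \<Rightarrow> pvf \<Rightarrow> pvf"
  where "zmul m P = (\<lambda>I. Abs_fps (\<lambda>i. Abs_fps (\<lambda>j. Abs_fps (\<lambda>k.
           if m \<le> int k then P I $ i $ j $ nat (int k - m) else 0))))"

definition Lambda4 :: "real \<Rightarrow> real \<Rightarrow> pvf"
  where "Lambda4 a b =
    (cst a * vy * vz) \<odot> del23 + (cst a * vx * vz) \<odot> del31 + (cst b * vx * vy + vz ^ 2) \<odot> del12"

lemma smul_wedge_smul: "(f \<odot> P) \<^bold>\<and> (g \<odot> Q) = (f * g) \<odot> (P \<^bold>\<and> Q)"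
  by (simp add: smul_def wedge_def sum_distrib_left mult_ac)

text \<open>The splitting \<open>\<Lambda>\<^sub>4 = \<Lambda>\<^sub>4\<^sub>,\<^sub>I + \<Lambda>\<^sub>4\<^sub>,\<^sub>I\<^sub>I\<close>.\<close>

lemma Lambda4_split:
  "Lambda4 a b = (cst a \<odot> Y23 + cst a \<odot> Y31 + cst b \<odot> Y12) + vz ^ 2 \<odot> del12"
  by (simp add: Lambda4_def Y23_def Y31_def Y12_def Y1_def Y2_def Y3_def smul_wedge_smul
      del12_def del23_def del31_def) (simp add: smul_def fun_eq_iff algebra_simps)

definition dif :: "real \<Rightarrow> real \<Rightarrow> pvf \<Rightarrow> pvf"
  where "dif a b P = schouten (Lambda4 a b) P"


section \<open>Bigrading and spectral sequence\<close>

text \<open>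
  The monomial term \<open>x^i y^j z^k \<partial>\<^sub>I\<close> equals \<open>(x^j1 y^j2 z^j3 / xyz) Y\<^sub>I\<close>, where each of
  \<open>j1, j2, j3\<close> is \<open>i, j, k\<close>, raised by one if the corresponding index is not in \<open>I\<close>.
  Its bidegree is \<open>(r, s) = (j1 + j2 + c, j3)\<close> with \<open>c = card I\<close>.
\<close>

definition bideg :: "coord set \<Rightarrow> nat \<Rightarrow> nat \<Rightarrow> nat \<Rightarrow> int \<times> int"
  where "bideg I i j k =
    (int i + of_bool (X1 \<notin> I) + (int j + of_bool (X2 \<notin> I)) + int (card I),
     int k + of_bool (X3 \<notin> I))"

text \<open>The formal direct sum of the \<open>\<P>^(r,s)\<close> with \<open>(r,s) \<in> S\<close>.\<close>

definition bigraded :: "(int \<times> int) set \<Rightarrow> pvf set"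
  where "bigraded S = {P. \<forall>I i j k. P I $ i $ j $ k \<noteq> 0 \<longrightarrow> bideg I i j k \<in> S}"

definition PP :: "int \<Rightarrow> int \<Rightarrow> pvf set" where "PP r s = bigraded {(r, s)}"
definition Ktot :: "int \<Rightarrow> pvf set" where "Ktot n = bigraded {(r, s). r + s = n}"
definition Kfil :: "int \<Rightarrow> pvf set" where "Kfil p = bigraded {(r, s). s \<ge> p}"

definition ssZ :: "(pvf \<Rightarrow> pvf) \<Rightarrow> int \<Rightarrow> int \<Rightarrow> int \<Rightarrow> pvf set"
  where "ssZ d r p q = Kfil p \<inter> d -` Kfil (p + r) \<inter> Ktot (p + q)"

definition ssB :: "(pvf \<Rightarrow> pvf) \<Rightarrow> int \<Rightarrow> int \<Rightarrow> int \<Rightarrow> pvf set"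
  where "ssB d r p q = Kfil p \<inter> d ` Kfil (p - r) \<inter> Ktot (p + q)"

definition ssN :: "(pvf \<Rightarrow> pvf) \<Rightarrow> int \<Rightarrow> int \<Rightarrow> int \<Rightarrow> pvf set"
  where "ssN d r p q = {U + V | U V. U \<in> ssZ d (r - 1) (p + 1) (q - 1) \<and> V \<in> ssB d (r - 1) p q}"

definition ssrel :: "(pvf \<Rightarrow> pvf) \<Rightarrow> int \<Rightarrow> int \<Rightarrow> int \<Rightarrow> (pvf \<times> pvf) set"
  where "ssrel d r p q = {(U, V). U \<in> ssZ d r p q \<and> V \<in> ssZ d r p q \<and> U - V \<in> ssN d r p q}"

definition ssE :: "(pvf \<Rightarrow> pvf) \<Rightarrow> int \<Rightarrow> int \<Rightarrow> int \<Rightarrow> pvf set set"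
  where "ssE d r p q = ssZ d r p q // ssrel d r p q"

definition ssclass :: "(pvf \<Rightarrow> pvf) \<Rightarrow> int \<Rightarrow> int \<Rightarrow> int \<Rightarrow> pvf \<Rightarrow> pvf set"
  where "ssclass d r p q U = ssrel d r p q `` {U}"

definition ssd :: "(pvf \<Rightarrow> pvf) \<Rightarrow> int \<Rightarrow> int \<Rightarrow> int \<Rightarrow> pvf set \<Rightarrow> pvf set"
  where "ssd d r p q C = (\<Union>U\<in>C. ssclass d r (p + r) (q + 1 - r) (d U))"

definition ssd_zero :: "(pvf \<Rightarrow> pvf) \<Rightarrow> int \<Rightarrow> bool"
  where "ssd_zero d r \<longleftrightarrow>
    (\<forall>p q. \<forall>C\<in>ssE d r p q. ssd d r p q C = ssclass d r (p + r) (q + 1 - r) 0)"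

text \<open>
  For \<open>r \<le> r'\<close>: the inclusions \<open>ssZ d r' p q \<subseteq> ssZ d r p q\<close> induce bijections (automatically
  linear) of \<open>E\<^sub>r\<^sub>'\<close> onto \<open>E\<^sub>r\<close>.
\<close>

definition ss_canon_iso :: "(pvf \<Rightarrow> pvf) \<Rightarrow> int \<Rightarrow> int \<Rightarrow> bool"
  where "ss_canon_iso d r r' \<longleftrightarrow>
    (\<forall>p q. \<exists>f. bij_betw f (ssE d r' p q) (ssE d r p q) \<and>
       (\<forall>U\<in>ssZ d r' p q. f (ssclass d r' p q U) = ssclass d r p q U))"

definition system_of_reps :: "(pvf \<Rightarrow> pvf) \<Rightarrow> int \<Rightarrow> int \<Rightarrow> int \<Rightarrow> pvf set \<Rightarrow> bool"
  where "system_of_reps d r p q S \<longleftrightarrow>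
    S \<subseteq> ssZ d r p q \<and> bij_betw (ssclass d r p q) S (ssE d r p q)"


section \<open>Conventions on the exponents\<close>

definition ratio_pos :: "real \<Rightarrow> real \<Rightarrow> bool"
  where "ratio_pos a b \<longleftrightarrow> b / a \<in> \<rat> \<and> b / a > 0"

definition ratio_special :: "real \<Rightarrow> real \<Rightarrow> bool"
  where "ratio_special a b \<longleftrightarrow> (\<exists>m::nat. m > 0 \<and> b / a = - 1 / real m)"

text \<open>In the last case \<open>\<beta>\<close> is left arbitrary: it is only ever multiplied by \<open>i = 0\<close>.\<close>

definition exponents :: "real \<Rightarrow> real \<Rightarrow> nat \<Rightarrow> int \<Rightarrow> bool"
  where "exponents a b \<alpha> \<beta> \<longleftrightarrow>
    (if ratio_pos a b then \<alpha> > 0 \<and> \<beta> > 0 \<and> coprime (int \<alpha>) \<beta> \<and> b / a = of_int \<beta> / real \<alpha>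
     else if ratio_special a b then \<alpha> > 0 \<and> \<beta> = -1 \<and> b / a = - 1 / real \<alpha>
     else \<alpha> = 1)"

definition admissible :: "real \<Rightarrow> real \<Rightarrow> nat \<Rightarrow> bool"
  where "admissible a b i \<longleftrightarrow> ratio_pos a b \<or> i = 0 \<or> (i = 1 \<and> ratio_special a b)"


section \<open>Representatives of type 1\<close>

text \<open>The coefficients \<open>A\<^sub>i\<^sub>k\<close>, resp. \<open>B\<^sub>i\<^sub>k, C\<^sub>i\<^sub>k, D\<^sub>i\<^sub>k\<close>, resp. \<open>E\<^sub>i\<^sub>k, F\<^sub>i\<^sub>k\<close> for \<open>c = 0, 1, 2\<close>.\<close>

datatype coef = Co0 real | Co1 real real real | Co2 real real

fun cdeg :: "coef \<Rightarrow> nat" where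
  "cdeg (Co0 A) = 0"
| "cdeg (Co1 B C D) = 1"
| "cdeg (Co2 E F) = 2"

fun core :: "coef \<Rightarrow> pvf" where
  "core (Co0 A) = cst A \<odot> pv_one"
| "core (Co1 B C D) = cst B \<odot> Y1 + cst C \<odot> Y2 + cst D \<odot> Y3"
| "core (Co2 E F) = cst E \<odot> Y23 + cst F \<odot> Y31"

definition permitted :: "real \<Rightarrow> real \<Rightarrow> nat \<Rightarrow> coef \<Rightarrow> bool"
  where "permitted a b i w \<longleftrightarrow> (i = 1 \<and> ratio_special a b \<longrightarrow>
    (case w of Co0 A \<Rightarrow> A = 0 | Co1 B C D \<Rightarrow> B = 0 \<and> C = 0 | Co2 E F \<Rightarrow> True))"

definition Zterm :: "real \<Rightarrow> real \<Rightarrow> nat \<Rightarrow> int \<Rightarrow> nat \<Rightarrow> nat \<Rightarrow> coef \<Rightarrow> pvf"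
  where "Zterm a b \<alpha> \<beta> i k w =
    zmul (\<beta> * int i + 2 * int k)
      ((cst (real ((\<alpha> * i) choose k) / (2 * a + b) ^ k) * Dp ^ (\<alpha> * i - k)) \<odot> core w)"

text \<open>The conditions linking the coefficients at \<open>k\<close> and at \<open>k + 1\<close>, with \<open>m = \<alpha> i\<close>.\<close>

fun coef_cond :: "nat \<Rightarrow> nat \<Rightarrow> coef \<Rightarrow> coef \<Rightarrow> bool" where
  "coef_cond m k (Co0 A) (Co0 A') \<longleftrightarrow> A' = A"
| "coef_cond m k (Co1 B C D) (Co1 B' C' D') \<longleftrightarrow>
     B' + C' = ((real m - real k + 1) * (B + C) - 2 * D) / (real m - real k) \<and> D' = D"
| "coef_cond m k (Co2 E F) (Co2 E' F') \<longleftrightarrow>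
     E' - F' = (real m - real k + 1) / (real m - real k) * (E - F)"
| "coef_cond m k _ _ \<longleftrightarrow> False"

text \<open>
  For \<open>c = 1, 2\<close> these conditions do not determine the coefficients for \<open>k > 0\<close> from those for \<open>k = 0\<close>.
  A selection picks, for each \<open>i\<close> and each datum \<open>w\<close> at \<open>k = 0\<close>, one sequence of coefficients
  \<open>sel i w 0, sel i w 1, \<dots>\<close> that starts with \<open>w\<close> and satisfies the conditions.
\<close>

definition coef_selection ::
    "real \<Rightarrow> real \<Rightarrow> nat \<Rightarrow> nat \<Rightarrow> (nat \<Rightarrow> coef \<Rightarrow> nat \<Rightarrow> coef) \<Rightarrow> bool"
  where "coef_selection a b \<alpha> n sel \<longleftrightarrow>
    (\<forall>i w. n \<le> i \<and> admissible a b i \<and> permitted a b i w \<longrightarrow>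
       sel i w 0 = w \<and> (\<forall>k<\<alpha> * n. coef_cond (\<alpha> * i) k (sel i w k) (sel i w (k + 1))))"

lemma coef_selection_exists: "\<exists>sel. coef_selection a b \<alpha> n sel"
proof -
  define step where "step m k w =
    (case w of Co0 A \<Rightarrow> Co0 A
     | Co1 B C D \<Rightarrow> Co1 (((real m - real k + 1) * (B + C) - 2 * D) / (real m - real k) - C) C D
     | Co2 E F \<Rightarrow> Co2 ((real m - real k + 1) / (real m - real k) * (E - F) + F) F)"
    for m k :: nat and w
  have step: "coef_cond m k w (step m k w)" for m k w
    by (cases w) (simp_all add: step_def)
  have "coef_selection a b \<alpha> n (\<lambda>i w k. rec_nat w (step (\<alpha> * i)) k)"
    by (simp add: coef_selection_def step)
  then show ?thesis by blast
qed

definition DD :: "real \<Rightarrow> real \<Rightarrow> ps3"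
  where "DD a b = Dp + cst (1 / (2 * a + b)) * vz ^ 2"

fun closed_form :: "real \<Rightarrow> real \<Rightarrow> nat \<Rightarrow> int \<Rightarrow> nat \<Rightarrow> coef \<Rightarrow> pvf" where
  "closed_form a b \<alpha> \<beta> i (Co0 A) =
     zmul (\<beta> * int i) ((DD a b ^ (\<alpha> * i) * cst A) \<odot> pv_one)"
| "closed_form a b \<alpha> \<beta> i (Co1 B C D) =
     zmul (\<beta> * int i) (DD a b ^ (\<alpha> * i) \<odot>
       (cst B \<odot> (Y1 + cst (1/2) \<odot> Y3) + cst C \<odot> (Y2 + cst (1/2) \<odot> Y3)))"
| "closed_form a b \<alpha> \<beta> i (Co2 E F) =
     zmul (\<beta> * int i) ((Dp ^ (\<alpha> * i) * cst E) \<odot> (Y23 + Y31))"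

definition rep1 ::
    "real \<Rightarrow> real \<Rightarrow> nat \<Rightarrow> int \<Rightarrow> nat \<Rightarrow> (nat \<Rightarrow> coef \<Rightarrow> nat \<Rightarrow> coef) \<Rightarrow> nat \<Rightarrow> coef \<Rightarrow> pvf"
  where "rep1 a b \<alpha> \<beta> n sel i w =
    (if n \<le> i then (\<Sum>k\<le>\<alpha> * n. Zterm a b \<alpha> \<beta> i k (sel i w k))
     else closed_form a b \<alpha> \<beta> i w)"

text \<open>The \<open>(i,c)\<close> with \<open>(q\<^sub>i\<^sub>c, p\<^sub>i) = (q, p)\<close>; there is at most one.\<close>

definition type1_index :: "real \<Rightarrow> real \<Rightarrow> nat \<Rightarrow> int \<Rightarrow> int \<Rightarrow> int \<Rightarrow> (nat \<times> nat) set"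
  where "type1_index a b \<alpha> \<beta> p q =
    {(i, c). admissible a b i \<and> c \<le> 2 \<and> q = int (2 * \<alpha> * i + 2 + c) \<and> p = \<beta> * int i + 1}"

definition type1 ::
    "real \<Rightarrow> real \<Rightarrow> nat \<Rightarrow> int \<Rightarrow> nat \<Rightarrow> (nat \<Rightarrow> coef \<Rightarrow> nat \<Rightarrow> coef) \<Rightarrow> int \<Rightarrow> int \<Rightarrow> pvf set"
  where "type1 a b \<alpha> \<beta> n sel p q =
    {(\<Sum>(i, c)\<in>type1_index a b \<alpha> \<beta> p q. rep1 a b \<alpha> \<beta> n sel i (w i c)) | w.
       \<forall>(i, c)\<in>type1_index a b \<alpha> \<beta> p q. cdeg (w i c) = c \<and> permitted a b i (w i c)}"


section \<open>Representatives of type 2\<close>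

definition Cas :: "real \<Rightarrow> real \<Rightarrow> nat \<Rightarrow> int \<Rightarrow> ps3 set"
  where "Cas a b \<alpha> \<beta> =
    (if ratio_pos a b
     then {f. \<forall>l m k. f $ l $ m $ k \<noteq> 0 \<longrightarrow>
             (\<exists>i::nat. l = \<alpha> * i \<and> m = \<alpha> * i \<and> int k = \<beta> * int i)}
     else range cst)"

definition Rx :: "ps3 set"
  where "Rx = {f. \<forall>i j k. f $ i $ j $ k \<noteq> 0 \<longrightarrow> j = 0 \<and> k = 0}"

definition Ry :: "ps3 set"
  where "Ry = {f. \<forall>i j k. f $ i $ j $ k \<noteq> 0 \<longrightarrow> i = 0 \<and> k = 0}"

definition Rz :: "ps3 set"
  where "Rz = {f. \<forall>i j k. f $ i $ j $ k \<noteq> 0 \<longrightarrow> i = 0 \<and> j = 0}"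

text \<open>The power series in \<open>z\<close> not involving \<open>z^(i (2 \<alpha> + \<beta>) + e)\<close> for admissible \<open>i < n\<close>.\<close>

definition Rz_except :: "real \<Rightarrow> real \<Rightarrow> nat \<Rightarrow> int \<Rightarrow> nat \<Rightarrow> nat \<Rightarrow> ps3 set"
  where "Rz_except a b \<alpha> \<beta> n e =
    {f\<in>Rz. \<forall>i<n. \<forall>k. admissible a b i \<and> int k = int i * (2 * int \<alpha> + \<beta>) + int e
              \<longrightarrow> f $ 0 $ 0 $ k = 0}"

definition type2 :: "real \<Rightarrow> real \<Rightarrow> nat \<Rightarrow> int \<Rightarrow> nat \<Rightarrow> pvf set"
  where "type2 a b \<alpha> \<beta> n =
    {u \<odot> Y12 + v \<odot> Y123 + g \<odot> del12 + h \<odot> del123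
       + f1 \<odot> del23 + f2 \<odot> del31 + (g1 + g2) \<odot> del123
       + zmul (-1) ((cst t * Dp ^ \<alpha>) \<odot> Y123)
     | u v g h f1 f2 g1 g2 t.
       u \<in> Cas a b \<alpha> \<beta> \<and> v \<in> Cas a b \<alpha> \<beta> \<and>
       g \<in> Rz_except a b \<alpha> \<beta> n 2 \<and> h \<in> Rz_except a b \<alpha> \<beta> n 3 \<and>
       f1 \<in> Rx \<and> f2 \<in> Ry \<and> g1 \<in> Rx \<and> g2 \<in> Ry \<and>
       (a \<noteq> b \<longrightarrow> f1 = 0 \<and> f2 = 0 \<and> g1 = 0 \<and> g2 = 0) \<and>
       (\<not> ratio_special a b \<longrightarrow> t = 0)}"


section \<open>The packages of even terms\<close>

text \<open>
  The listed representatives in \<open>E\<^sub>r^(p,q)\<close>: a type 2 representative of bidegree \<open>(q, p)\<close> plus a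
  type 1 representative with leading term in \<open>\<P>^(q,p)\<close>.
\<close>

definition reps ::
    "real \<Rightarrow> real \<Rightarrow> nat \<Rightarrow> int \<Rightarrow> nat \<Rightarrow> (nat \<Rightarrow> coef \<Rightarrow> nat \<Rightarrow> coef) \<Rightarrow> int \<Rightarrow> int \<Rightarrow> pvf set"
  where "reps a b \<alpha> \<beta> n sel p q =
    {T + U | T U. T \<in> type2 a b \<alpha> \<beta> n \<inter> PP q p \<and> U \<in> type1 a b \<alpha> \<beta> n sel p q}"

definition package :: "nat \<Rightarrow> nat \<Rightarrow> int set"
  where "package \<alpha> n =
    (if n = 0 then {2}
     else {r. even r \<and> 2 * (int n - 1) * int \<alpha> + 4 \<le> r \<and> r \<le> 2 * int n * int \<alpha> + 2})"

end

theory Submission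
  imports Defs
begin

text \<open>
  In terms of the \<open>Y\<^sub>i\<close>, \<open>d'\<close> preserves the exponent \<open>(l, m, n)\<close> of a monomial \<open>x^l y^m z^n Y\<^sub>I\<close> and acts
  as the wedge product with a constant vector depending on \<open>(l, m, n)\<close>, whereas \<open>d''\<close> moves the
  exponent to \<open>(l - 1, m - 1, n + 2)\<close>. If the constant vector is nonzero (modulo the \<open>Y\<^sub>i\<close> whose
  exponent is \<open>-1\<close>), contraction with a dual covector is a homotopy, so that only the resonant
  exponents contribute to the \<open>E\<^sub>r\<close>. The complex splits into chains of exponents along
  \<open>(-1, -1, 2)\<close>. On the chain that starts at the resonant exponent \<open>(\<alpha> i, \<alpha> i, \<beta> i)\<close> the combinations
  \<open>B + C - 2 D\<close> and \<open>E - F\<close> satisfy two-term recursions whose coefficients do not vanish. Hence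
  they are nonzero at the end \<open>(-1, -1, \<beta> i + 2 \<alpha> i + 2)\<close> of the chain as soon as they are nonzero at its
  start: this is the only source of nonzero differentials, and it cancels a cochain of type 1 against
  \<open>z^(i (2 \<alpha> + \<beta>) + 2) \<partial>\<^sub>1\<^sub>2\<close> or \<open>z^(i (2 \<alpha> + \<beta>) + 3) \<partial>\<^sub>1\<^sub>2\<^sub>3\<close>. Consequently two cycles define the same class
  of \<open>E\<^sub>r\<close> if and only if their leading terms have the same coefficients at the resonant exponents that
  are not cancelled for some \<open>i < n\<close>.
\<close>

section \<open>Coefficients\<close>

text \<open>Dividing by the cycles in \<open>K_(p+1)\<close> leaves only the layer
  \<open>n = p - 1\<close> of a cochain, and on that layer a cochain of \<open>K_p\<close> feels
  only \<open>d'\<close>. This is why classes can be compared through leading terms, and why the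
  free choices in the later coefficients of a type 1 representative do not affect its class. The
  number \<open>2 \<alpha> i + 2\<close> is the height of a chain: each step raises the exponent of
  z by 2, and \<open>\<alpha> i + 1\<close> steps lead from the resonant start to the corner
  \<open>(-1, -1)\<close>. For larger r a cycle with leading term at the start of the chain has a
  differential that vanishes up to the corner, which forces \<open>B + C = 2 D\<close> and
  \<open>E = F\<close>. One step lowers \<open>b l - a n\<close> by \<open>2 a + b\<close>. This
  number is 0 at the resonant start, hence equals \<open>-k (2 a + b)\<close> after k steps; the
  factors \<open>k\<close> and \<open>2 a + b\<close> produce the binomial coefficients and the
  powers of \<open>1/(2 a + b)\<close>. Summed to the end of the chain, they form the Casimir
  functions \<open>(D' + z^2/(2 a + b))^(\<alpha> i) z^(\<beta> i)\<close> of
  \<open>\<Lambda>\<^sub>4\<close>.\<close>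

definition ce :: "ps3 \<Rightarrow> int \<Rightarrow> int \<Rightarrow> int \<Rightarrow> real"
  where "ce f i j k = (if 0 \<le> i \<and> 0 \<le> j \<and> 0 \<le> k then f $ nat i $ nat j $ nat k else 0)"

lemma ce_nth: "f $ i $ j $ k = ce f (int i) (int j) (int k)"
  by (simp add: ce_def)

lemma ce_eqI: "(\<And>i j k. 0 \<le> i \<Longrightarrow> 0 \<le> j \<Longrightarrow> 0 \<le> k \<Longrightarrow> ce f i j k = ce g i j k) \<Longrightarrow> f = g"
  by (simp add: fps_eq_iff ce_nth)

text \<open>Integer indices with value 0 outside the octant make the shifts caused by multiplication
  and derivation total, so that no side conditions appear below.\<close>

lemma ce_neg [simp]: "i < 0 \<or> j < 0 \<or> k < 0 \<Longrightarrow> ce f i j k = 0"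
  by (auto simp: ce_def)

lemma ce_0 [simp]: "ce 0 i j k = 0"
  by (simp add: ce_def)

lemma ce_add [simp]: "ce (f + g) i j k = ce f i j k + ce g i j k"
  by (simp add: ce_def)

lemma ce_diff [simp]: "ce (f - g) i j k = ce f i j k - ce g i j k"
  by (simp add: ce_def)

lemma ce_uminus [simp]: "ce (- f) i j k = - ce f i j k"
  by (simp add: ce_def)

lemma ce_sum: "ce (\<Sum>x\<in>A. f x) i j k = (\<Sum>x\<in>A. ce (f x) i j k)"
  by (induction A rule: infinite_finite_induct) simp_all

lemma ce_cst_mult [simp]: "ce (cst c * f) i j k = c * ce f i j k"
  by (simp add: ce_def cst_def)

lemma ce_vx_mult [simp]: "ce (vx * f) i j k = ce f (i - 1) j k"
  by (auto simp: ce_def vx_def nat_diff_distrib)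

lemma ce_vy_mult [simp]: "ce (vy * f) i j k = ce f i (j - 1) k"
  by (auto simp: ce_def vy_def nat_diff_distrib)

lemma ce_vz_mult [simp]: "ce (vz * f) i j k = ce f i j (k - 1)"
  by (auto simp: ce_def vz_def nat_diff_distrib)

lemma ce_pd1 [simp]: "ce (pd X1 f) i j k = of_int (i + 1) * ce f (i + 1) j k"
proof (cases "0 \<le> i")
  case True
  then have "nat (i + 1) = Suc (nat i)" by simp
  moreover have "(of_nat (Suc (nat i)) * (f $ Suc (nat i))) $ nat j $ nat k
      = of_int (i + 1) * (f $ Suc (nat i) $ nat j $ nat k)"
  proof -
    have *: "(of_nat N * g) $ n = of_nat N * g $ n" for N n and g :: "'a::comm_ring_1 fps"
      by (metis fps_mult_left_const_nth fps_of_nat)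
    show ?thesis unfolding * using True by simp
  qed
  ultimately show ?thesis using True by (simp add: ce_def)
qed (cases "i = -1"; simp)

lemma ce_pd2 [simp]: "ce (pd X2 f) i j k = of_int (j + 1) * ce f i (j + 1) k"
proof (cases "0 \<le> j")
  case True
  then have "nat (j + 1) = Suc (nat j)" by simp
  moreover have "(of_nat (Suc (nat j)) * (f $ nat i $ Suc (nat j))) $ nat k
      = of_int (j + 1) * (f $ nat i $ Suc (nat j) $ nat k)"
  proof -
    have *: "(of_nat N * g) $ n = of_nat N * g $ n" for N n and g :: "'a::comm_ring_1 fps"
      by (metis fps_mult_left_const_nth fps_of_nat)
    show ?thesis unfolding * using True by simp
  qed
  ultimately show ?thesis using True by (simp add: ce_def)
qed (cases "j = -1"; simp)

lemma ce_pd3 [simp]: "ce (pd X3 f) i j k = of_int (k + 1) * ce f i j (k + 1)"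
proof (cases "0 \<le> k")
  case True
  then have "nat (k + 1) = Suc (nat k)" by simp
  then show ?thesis using True by (simp add: ce_def)
qed (cases "k = -1"; simp)

lemma ce_1: "ce 1 i j k = of_bool (i = 0 \<and> j = 0 \<and> k = 0)"
  by (auto simp: ce_def fps_one_nth)

lemma ce_cst: "ce (cst c) i j k = c * of_bool (i = 0 \<and> j = 0 \<and> k = 0)"
  using ce_cst_mult[of c 1 i j k] by (simp add: ce_1)

lemma ce_Dp_power_mult [simp]: "ce (Dp ^ N * f) i j k = ce f (i - int N) (j - int N) k"
  by (induction N arbitrary: i j) (simp_all add: Dp_def mult.assoc algebra_simps)

lemma ce_Dp_power: "ce (Dp ^ N) i j k = of_bool (i = int N \<and> j = int N \<and> k = 0)"
  using ce_Dp_power_mult[of N 1 i j k] by (simp add: ce_1)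

definition mkps :: "(int \<Rightarrow> int \<Rightarrow> int \<Rightarrow> real) \<Rightarrow> ps3"
  where "mkps F = Abs_fps (\<lambda>i. Abs_fps (\<lambda>j. Abs_fps (\<lambda>k. F (int i) (int j) (int k))))"

lemma ce_mkps: "ce (mkps F) i j k = (if 0 \<le> i \<and> 0 \<le> j \<and> 0 \<le> k then F i j k else 0)"
  by (simp add: ce_def mkps_def)

lemma coord_set_cases:
  obtains "I = {}" | "I = {X1}" | "I = {X2}" | "I = {X3}" | "I = {X1, X2}" | "I = {X1, X3}"
  | "I = {X2, X3}" | "I = {X1, X2, X3}"
proof -
  have "I \<in> Pow {X1, X2, X3}" using UNIV_coord by blast
  then show ?thesis using that by (auto simp: Pow_insert)
qed

text \<open>\<open>cf P I l m n\<close> is the coefficient of \<open>x^l y^m z^n Y\<^sub>I\<close>, so exponents start at \<open>-1\<close>.\<close>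

definition cf :: "pvf \<Rightarrow> coord set \<Rightarrow> int \<Rightarrow> int \<Rightarrow> int \<Rightarrow> real"
  where "cf P I l m n =
    ce (P I) (l + of_bool (X1 \<in> I)) (m + of_bool (X2 \<in> I)) (n + of_bool (X3 \<in> I))"

text \<open>The exponent -1 of a coordinate is possible exactly if its index lies in I, because
  \<open>x^(-1) Y1\<close> is \<open>\<partial>\<^sub>1\<close>.\<close>

definition allowed :: "coord set \<Rightarrow> int \<Rightarrow> int \<Rightarrow> int \<Rightarrow> bool"
  where "allowed I l m n \<longleftrightarrow> - of_bool (X1 \<in> I) \<le> l \<and> - of_bool (X2 \<in> I) \<le> m \<and> - of_bool (X3 \<in> I) \<le> n"


section \<open>The bracket with \<open>\<Lambda>\<^sub>4\<close> on coefficients\<close>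

lemma wsign_prod:
  "wsign I J = (\<Prod>i\<in>I. \<Prod>j\<in>J. if pos j < pos i then - 1 else 1)"
proof -
  have "{(i, j). i \<in> I \<and> j \<in> J \<and> pos j < pos i} = (SIGMA i:I. {j\<in>J. pos j < pos i})" by auto
  moreover have "(\<Prod>j\<in>J. if pos j < pos i then - 1 else 1 :: ps3) = (- 1) ^ card {j\<in>J. pos j < pos i}" for i
    by (simp add: prod.If_cases Collect_conj_eq[symmetric] Int_def)
  ultimately show ?thesis by (simp add: wsign_def power_sum)
qed

lemma sum_Pow_insert:
  assumes "x \<notin> A" and "finite A"
  shows "(\<Sum>I\<in>Pow (insert x A). f I) = (\<Sum>I\<in>Pow A. f I) + (\<Sum>I\<in>Pow A. f (insert x I))"
proof -
  have "inj_on (insert x) (Pow A)" using assms(1) by (auto simp: inj_on_def)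
  moreover have "Pow A \<inter> insert x ` Pow A = {}" using assms(1) by auto
  ultimately show ?thesis using assms(2)
    by (simp add: Pow_insert sum.union_disjoint sum.reindex)
qed

text \<open>These rules let simp evaluate wedge products at explicit index sets: sums over power
  sets split one element at a time, and the inversion count becomes a product whose factors are
  decided one by one.\<close>

lemmas wedge_eval = wedge_def sum_Pow_insert wsign_prod insert_Diff_if

lemma Lambda4_parts:
  "Lambda4 a b {} = 0" "Lambda4 a b {X1} = 0" "Lambda4 a b {X2} = 0" "Lambda4 a b {X3} = 0"
  "Lambda4 a b {X1, X2} = cst b * (vx * vy) + vz * vz"
  "Lambda4 a b {X1, X3} = - (cst a * (vx * vz))"
  "Lambda4 a b {X2, X3} = cst a * (vy * vz)"
  "Lambda4 a b {X1, X2, X3} = 0"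
  by (simp_all add: Lambda4_def smul_def del12_def del23_def del31_def del_def wedge_eval
      doubleton_eq_iff power2_eq_square mult.assoc)

lemma ce_vx: "ce vx i j k = of_bool (i = 1 \<and> j = 0 \<and> k = 0)"
  and ce_vy: "ce vy i j k = of_bool (i = 0 \<and> j = 1 \<and> k = 0)"
  and ce_vz: "ce vz i j k = of_bool (i = 0 \<and> j = 0 \<and> k = 1)"
  using ce_vx_mult[of 1 i j k] ce_vy_mult[of 1 i j k] ce_vz_mult[of 1 i j k] by (auto simp: ce_1)

lemma pd_coeffs:
  "pd X1 0 = 0" "pd X2 0 = 0" "pd X3 0 = 0"
  "pd X1 (cst b * (vx * vy) + vz * vz) = cst b * vy" "pd X2 (cst b * (vx * vy) + vz * vz) = cst b * vx"
  "pd X3 (cst b * (vx * vy) + vz * vz) = cst 2 * vz"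
  "pd X1 (- (cst a * (vx * vz))) = - (cst a * vz)" "pd X2 (- (cst a * (vx * vz))) = 0"
  "pd X3 (- (cst a * (vx * vz))) = - (cst a * vx)"
  "pd X1 (cst a * (vy * vz)) = 0" "pd X2 (cst a * (vy * vz)) = cst a * vz"
  "pd X3 (cst a * (vy * vz)) = cst a * vy"
  by (rule ce_eqI; auto simp: ce_vx ce_vy ce_vz simp del: pd.simps)+


text \<open>The coefficients of \<open>[\<Lambda>\<^sub>4, x^l y^m z^n \<cdot>]\<close> are those of the wedge product with
  \<open>(b m - a n) Y\<^sub>1 + (a n - b l) Y\<^sub>2 + a (l - m) Y\<^sub>3\<close>, plus the contribution of \<open>z^2 \<partial>\<^sub>1\<^sub>2\<close>, which moves
  the exponent by \<open>(-1, -1, 2)\<close>.\<close>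

lemma cf_dif:
  fixes a b :: real and l m n :: int
  shows
  "cf (dif a b P) {} l m n = 0" (is ?A)
  "cf (dif a b P) {X1} l m n =
     (b * m - a * n) * cf P {} l m n + (m + 1) * cf P {} (l + 1) (m + 1) (n - 2)" (is ?B)
  "cf (dif a b P) {X2} l m n =
     (a * n - b * l) * cf P {} l m n - (l + 1) * cf P {} (l + 1) (m + 1) (n - 2)" (is ?C)
  "cf (dif a b P) {X3} l m n = a * (l - m) * cf P {} l m n" (is ?D)
  "cf (dif a b P) {X1, X2} l m n =
     (b * m - a * n) * cf P {X2} l m n - (a * n - b * l) * cf P {X1} l m n
     + (m + 2) * cf P {X2} (l + 1) (m + 1) (n - 2) + (l + 2) * cf P {X1} (l + 1) (m + 1) (n - 2)
     - 2 * cf P {X3} (l + 1) (m + 1) (n - 2)" (is ?E)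
  "cf (dif a b P) {X1, X3} l m n =
     (b * m - a * n) * cf P {X3} l m n - a * (l - m) * cf P {X1} l m n
     + (m + 1) * cf P {X3} (l + 1) (m + 1) (n - 2)" (is ?F)
  "cf (dif a b P) {X2, X3} l m n =
     (a * n - b * l) * cf P {X3} l m n - a * (l - m) * cf P {X2} l m n
     - (l + 1) * cf P {X3} (l + 1) (m + 1) (n - 2)" (is ?G)
  "cf (dif a b P) {X1, X2, X3} l m n =
     (b * m - a * n) * cf P {X2, X3} l m n - (a * n - b * l) * cf P {X1, X3} l m n
     + a * (l - m) * cf P {X1, X2} l m n
     + (m + 2) * cf P {X2, X3} (l + 1) (m + 1) (n - 2)
     + (l + 2) * cf P {X1, X3} (l + 1) (m + 1) (n - 2)" (is ?H)
proof -
  note defs = dif_def schouten_def UNIV_coord wedge_eval right_der_def left_der_def pv_pd_def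
    Lambda4_parts pd_coeffs insert_commute
  show ?A
    unfolding cf_def by (simp add: defs del: pd.simps)
  show ?B ?C ?D ?E ?F ?G ?H
    unfolding cf_def
    by (simp_all add: defs del: pd.simps) (simp_all add: algebra_simps del: pd.simps)
qed

section \<open>Filtration and degree in terms of exponents\<close>

lemma pvf_eqI:
  assumes "\<And>I l m n. cf P I l m n = cf Q I l m n"
  shows "P = Q"
proof
  fix I
  show "P I = Q I"
  proof (rule ce_eqI)
    fix i j k
    show "ce (P I) i j k = ce (Q I) i j k"
      using assms[of I "i - of_bool (X1 \<in> I)" "j - of_bool (X2 \<in> I)" "k - of_bool (X3 \<in> I)"]
      by (simp add: cf_def)
  qed
qed

lemma cf_not_allowed: "\<not> allowed I l m n \<Longrightarrow> cf P I l m n = 0"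
  unfolding cf_def allowed_def by (rule ce_neg) linarith

lemma cf_0 [simp]: "cf 0 I l m n = 0"
  by (simp add: cf_def)

lemma cf_add [simp]: "cf (P + Q) I l m n = cf P I l m n + cf Q I l m n"
  by (simp add: cf_def)

lemma cf_diff [simp]: "cf (P - Q) I l m n = cf P I l m n - cf Q I l m n"
  by (simp add: cf_def)

lemma cf_cst [simp]: "cf (cst c \<odot> P) I l m n = c * cf P I l m n"
  by (simp add: cf_def smul_def)

lemma cf_sum: "cf (\<Sum>x\<in>A. P x) I l m n = (\<Sum>x\<in>A. cf (P x) I l m n)"
  by (induction A rule: infinite_finite_induct) (simp_all only: sum.infinite sum.empty sum.insert cf_0 cf_add not_False_eq_True)

definition mkpv :: "(coord set \<Rightarrow> int \<Rightarrow> int \<Rightarrow> int \<Rightarrow> real) \<Rightarrow> pvf"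
  where "mkpv F = (\<lambda>I. mkps (\<lambda>i j k.
    F I (i - of_bool (X1 \<in> I)) (j - of_bool (X2 \<in> I)) (k - of_bool (X3 \<in> I))))"

lemma cf_mkpv: "cf (mkpv F) I l m n = (if allowed I l m n then F I l m n else 0)"
proof -
  have "(- of_bool (X1 \<in> I) \<le> l) = (0 \<le> l + of_bool (X1 \<in> I))"
    "(- of_bool (X2 \<in> I) \<le> m) = (0 \<le> m + of_bool (X2 \<in> I))"
    "(- of_bool (X3 \<in> I) \<le> n) = (0 \<le> n + of_bool (X3 \<in> I))" by linarith+
  then show ?thesis by (simp add: cf_def mkpv_def ce_mkps allowed_def)
qed

text \<open>Since \<open>x^l y^m z^n Y_I = (x^(l+1) y^(m+1) z^(n+1) / D) Y_I\<close>, the index set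
  enters the bidegree only through its size, and filtration degree p corresponds to the exponent
  \<open>n = p - 1\<close>.\<close>

lemma bigraded_iff:
  "P \<in> bigraded S \<longleftrightarrow>
     (\<forall>I l m n. cf P I l m n \<noteq> 0 \<longrightarrow> (l + m + 2 + int (card I), n + 1) \<in> S)"
proof
  assume P: "P \<in> bigraded S"
  show "\<forall>I l m n. cf P I l m n \<noteq> 0 \<longrightarrow> (l + m + 2 + int (card I), n + 1) \<in> S"
  proof (intro allI impI)
    fix I and l m n :: int
    let ?i = "l + of_bool (X1 \<in> I)" and ?j = "m + of_bool (X2 \<in> I)" and ?k = "n + of_bool (X3 \<in> I)"
    assume nz: "cf P I l m n \<noteq> 0"
    then have ge: "0 \<le> ?i" "0 \<le> ?j" "0 \<le> ?k" by (auto simp: cf_def ce_def split: if_splits)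
    then have "P I $ nat ?i $ nat ?j $ nat ?k \<noteq> 0" using nz by (simp add: cf_def ce_def)
    then have "bideg I (nat ?i) (nat ?j) (nat ?k) \<in> S" using P by (auto simp: bigraded_def)
    moreover have "bideg I (nat ?i) (nat ?j) (nat ?k) = (l + m + 2 + int (card I), n + 1)"
      using ge by (simp add: bideg_def)
    ultimately show "(l + m + 2 + int (card I), n + 1) \<in> S" by simp
  qed
next
  assume P: "\<forall>I l m n. cf P I l m n \<noteq> 0 \<longrightarrow> (l + m + 2 + int (card I), n + 1) \<in> S"
  show "P \<in> bigraded S"
    unfolding bigraded_def
  proof (intro CollectI allI impI)
    fix I i j k
    let ?l = "int i - of_bool (X1 \<in> I)" and ?m = "int j - of_bool (X2 \<in> I)"
      and ?n = "int k - of_bool (X3 \<in> I)"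
    assume "P I $ i $ j $ k \<noteq> 0"
    then have "cf P I ?l ?m ?n \<noteq> 0" by (simp add: cf_def ce_nth)
    then have "(?l + ?m + 2 + int (card I), ?n + 1) \<in> S" using P by blast
    then show "bideg I i j k \<in> S" by (simp add: bideg_def of_bool_not_iff algebra_simps)
  qed
qed

lemma Kfil_iff: "P \<in> Kfil p \<longleftrightarrow> (\<forall>I l m n. cf P I l m n \<noteq> 0 \<longrightarrow> p \<le> n + 1)"
  by (simp add: Kfil_def bigraded_iff)

lemma Kfil_iff_zero: "P \<in> Kfil p \<longleftrightarrow> (\<forall>I l m n. n + 1 < p \<longrightarrow> cf P I l m n = 0)"
  unfolding Kfil_iff by (meson not_less)

lemma Kfil_cf: "P \<in> Kfil p \<Longrightarrow> n + 1 < p \<Longrightarrow> cf P I l m n = 0"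
  by (force simp: Kfil_iff)

lemma Ktot_iff:
  "P \<in> Ktot N \<longleftrightarrow> (\<forall>I l m n. cf P I l m n \<noteq> 0 \<longrightarrow> l + m + n + 3 + int (card I) = N)"
  unfolding Ktot_def bigraded_iff by (simp add: algebra_simps)

lemma Ktot_iff_zero:
  "P \<in> Ktot N \<longleftrightarrow> (\<forall>I l m n. l + m + n + 3 + int (card I) \<noteq> N \<longrightarrow> cf P I l m n = 0)"
  unfolding Ktot_iff by blast

lemma PP_iff:
  "P \<in> PP q p \<longleftrightarrow> (\<forall>I l m n. cf P I l m n \<noteq> 0 \<longrightarrow> l + m + 2 + int (card I) = q \<and> n + 1 = p)"
  unfolding PP_def bigraded_iff by simp

lemma Kfil_mono: "P \<in> Kfil p \<Longrightarrow> p' \<le> p \<Longrightarrow> P \<in> Kfil p'"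
  by (force simp: Kfil_iff)

lemma Kfil_add: "P \<in> Kfil p \<Longrightarrow> Q \<in> Kfil p \<Longrightarrow> P + Q \<in> Kfil p"
  by (simp add: Kfil_iff_zero)

lemma Kfil_diff: "P \<in> Kfil p \<Longrightarrow> Q \<in> Kfil p \<Longrightarrow> P - Q \<in> Kfil p"
  by (simp add: Kfil_iff_zero)

lemma Kfil_cst: "P \<in> Kfil p \<Longrightarrow> cst c \<odot> P \<in> Kfil p"
  by (simp add: Kfil_iff_zero)

lemma Kfil_0: "0 \<in> Kfil p"
  by (simp add: Kfil_iff)

lemma Ktot_add: "P \<in> Ktot p \<Longrightarrow> Q \<in> Ktot p \<Longrightarrow> P + Q \<in> Ktot p"
  by (simp add: Ktot_iff_zero)

lemma Ktot_diff: "P \<in> Ktot p \<Longrightarrow> Q \<in> Ktot p \<Longrightarrow> P - Q \<in> Ktot p"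
  by (simp add: Ktot_iff_zero)

lemma Ktot_0: "0 \<in> Ktot p"
  by (simp add: Ktot_iff)

lemma PP_subset_Kfil: "P \<in> PP q p \<Longrightarrow> P \<in> Kfil p"
  by (simp add: PP_iff Kfil_iff)

lemma PP_subset_Ktot: "P \<in> PP q p \<Longrightarrow> P \<in> Ktot (p + q)"
  unfolding PP_iff Ktot_iff by smt


section \<open>The differential\<close>

lemma dif_add: "dif a b (P + Q) = dif a b P + dif a b Q"
proof (rule pvf_eqI)
  show "cf (dif a b (P + Q)) I l m n = cf (dif a b P + dif a b Q) I l m n" for I l m n
    by (cases I rule: coord_set_cases) (simp_all add: cf_dif algebra_simps)
qed

lemma dif_cst: "dif a b (cst c \<odot> P) = cst c \<odot> dif a b P"
proof (rule pvf_eqI)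
  show "cf (dif a b (cst c \<odot> P)) I l m n = cf (cst c \<odot> dif a b P) I l m n" for I l m n
    by (cases I rule: coord_set_cases) (simp_all add: cf_dif algebra_simps)
qed

lemma dif_diff: "dif a b (P - Q) = dif a b P - dif a b Q"
proof (rule pvf_eqI)
  show "cf (dif a b (P - Q)) I l m n = cf (dif a b P - dif a b Q) I l m n" for I l m n
    by (cases I rule: coord_set_cases) (simp_all add: cf_dif algebra_simps)
qed

lemma dif_0: "dif a b 0 = 0"
  using dif_diff[of a b 0 0] by simp

text \<open>This expresses that \<open>\<Lambda>\<^sub>4\<close> is a Poisson structure; it is
  checked on coefficients rather than derived from a graded Jacobi identity.\<close>

lemma dif_dif: "dif a b (dif a b P) = 0"
proof (rule pvf_eqI)
  show "cf (dif a b (dif a b P)) I l m n = cf 0 I l m n" for I l m n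
    by (cases I rule: coord_set_cases) (simp_all add: cf_dif algebra_simps)
qed

lemma dif_Kfil: "P \<in> Kfil p \<Longrightarrow> dif a b P \<in> Kfil p"
proof -
  assume P: "P \<in> Kfil p"
  have "cf (dif a b P) I l m n = 0" if "n + 1 < p" for I l m n
    using that by (cases I rule: coord_set_cases) (simp_all add: cf_dif Kfil_cf[OF P])
  then show ?thesis unfolding Kfil_iff by force
qed

lemma dif_Ktot: "P \<in> Ktot N \<Longrightarrow> dif a b P \<in> Ktot (N + 1)"
proof -
  assume P: "P \<in> Ktot N"
  have 0: "cf P I l m n = 0" if "l + m + n + 3 + int (card I) \<noteq> N" for I l m n
    using P that by (force simp: Ktot_iff)
  have "cf (dif a b P) I l m n = 0" if "l + m + n + 3 + int (card I) \<noteq> N + 1" for I l m n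
    using that by (cases I rule: coord_set_cases) (simp_all add: cf_dif 0)
  then show ?thesis unfolding Ktot_iff by force
qed


section \<open>Recursions along chains of exponents\<close>

text \<open>Along the exponents \<open>(j, j, n - 2 j)\<close> the differential yields two-term recursions for the
  combinations \<open>B + C - 2 D\<close> and \<open>E - F\<close> of coefficients; all obstructions are read off from these.
  Since \<open>\<partial>\<^sub>3\<^sub>1\<close> has coefficient \<open>-1\<close> at \<open>{X1, X3}\<close>, the difference \<open>E - F\<close> appears as a sum.\<close>

definition tc :: "pvf \<Rightarrow> int \<Rightarrow> int \<Rightarrow> real"
  where "tc P j n = cf P {X1} j j n + cf P {X2} j j n - 2 * cf P {X3} j j n"

definition gc :: "pvf \<Rightarrow> int \<Rightarrow> int \<Rightarrow> real"
  where "gc P j n = cf P {X2, X3} j j n + cf P {X1, X3} j j n"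

text \<open>On the diagonal the terms with \<open>a (l - m)\<close> drop out. Adding twice the
  component at \<open>{X2, X3}\<close> turns \<open>-2 D\<close> into \<open>-2 (j + 2) D\<close> in
  the shifted terms, which closes the recursion for \<open>B + C - 2 D\<close>.\<close>

lemma tc_dif:
  "cf (dif a b P) {X1, X2} j j n + 2 * cf (dif a b P) {X2, X3} j j n =
     (b * of_int j - a * of_int n) * tc P j n + of_int (j + 2) * tc P (j + 1) (n - 2)"
  by (simp add: cf_dif tc_def algebra_simps)

lemma gc_dif:
  "cf (dif a b P) {X1, X2, X3} j j n =
     (b * of_int j - a * of_int n) * gc P j n + of_int (j + 2) * gc P (j + 1) (n - 2)"
  by (simp add: cf_dif gc_def algebra_simps)

lemma tc_edge: "tc P (-1) n = 0"
  by (simp add: tc_def cf_not_allowed allowed_def)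

lemma gc_edge: "gc P (-1) n = 0"
  by (simp add: gc_def cf_not_allowed allowed_def)

text \<open>At \<open>j = -1\<close> every allowed index set contains \<open>X1\<close> and
  \<open>X2\<close>, so both combinations start at 0; each equation then determines the value at
  \<open>j + 1\<close>, whose factor \<open>j + 2\<close> is positive.\<close>

lemma chain_down:
  fixes M N :: int
  assumes "-1 \<le> M"
    and "\<And>j I. -1 \<le> j \<Longrightarrow> j < M \<Longrightarrow> cf (dif a b P) I j j (N - 2 * j) = 0"
  shows "tc P M (N - 2 * M) = 0" "gc P M (N - 2 * M) = 0"
proof -
  have "j \<le> M \<longrightarrow> tc P j (N - 2 * j) = 0 \<and> gc P j (N - 2 * j) = 0" if "-1 \<le> j" for j
    using that
  proof (induction j rule: int_ge_induct)
    case base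
    then show ?case by (simp add: tc_edge gc_edge)
  next
    case (step j)
    have eq: "N - 2 * j - 2 = N - 2 * (j + 1)" by simp
    show ?case
    proof
      assume "j + 1 \<le> M"
      then show "tc P (j + 1) (N - 2 * (j + 1)) = 0 \<and> gc P (j + 1) (N - 2 * (j + 1)) = 0"
        using tc_dif[of a b P j "N - 2 * j"] gc_dif[of a b P j "N - 2 * j"] assms(2)[of j] step
        unfolding eq by auto
    qed
  qed
  then show "tc P M (N - 2 * M) = 0" "gc P M (N - 2 * M) = 0" using assms(1) by auto
qed

text \<open>Applied to coefficients along a chain: the exponent of z falls as j grows, so they
  vanish for large j, and the vanishing is carried back down to M.\<close>

lemma chain_up:
  fixes f :: "int \<Rightarrow> real"
  assumes "\<And>j. M < j \<Longrightarrow> f (j + 1) = 0 \<Longrightarrow> f j = 0"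
    and "\<And>j. J < j \<Longrightarrow> f j = 0" and "M < j"
  shows "f j = 0"
proof (cases "j \<le> J + 1")
  case True
  then have "M < j \<longrightarrow> f j = 0"
  proof (induction j rule: int_le_induct)
    case base
    then show ?case using assms(2) by simp
  next
    case (step j)
    then show ?case using assms(1)[of "j - 1"] assms(2)
      by (metis diff_add_cancel less_diff_eq linorder_not_le zless_add1_eq)
  qed
  then show ?thesis using assms(3) by simp
qed (use assms(2) in simp)

section \<open>Coefficients of the representatives\<close>

lemma coord_set_eq_iff:
  fixes I J :: "coord set"
  shows "I = J \<longleftrightarrow> (X1 \<in> I \<longleftrightarrow> X1 \<in> J) \<and> (X2 \<in> I \<longleftrightarrow> X2 \<in> J) \<and> (X3 \<in> I \<longleftrightarrow> X3 \<in> J)"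
proof
  assume *: "(X1 \<in> I \<longleftrightarrow> X1 \<in> J) \<and> (X2 \<in> I \<longleftrightarrow> X2 \<in> J) \<and> (X3 \<in> I \<longleftrightarrow> X3 \<in> J)"
  show "I = J"
  proof (rule set_eqI)
    show "x \<in> I \<longleftrightarrow> x \<in> J" for x using * by (cases x) auto
  qed
qed simp

lemma Y_component:
  "Y1 I = of_bool (I = {X1}) * vx" "Y2 I = of_bool (I = {X2}) * vy" "Y3 I = of_bool (I = {X3}) * vz"
  "Y12 I = of_bool (I = {X1, X2}) * (vx * vy)" "Y23 I = of_bool (I = {X2, X3}) * (vy * vz)"
  "Y31 I = - (of_bool (I = {X1, X3}) * (vx * vz))"
  "Y123 I = of_bool (I = {X1, X2, X3}) * (vx * (vy * vz))"
  "del12 I = of_bool (I = {X1, X2})" "del23 I = of_bool (I = {X2, X3})"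
  "del31 I = - of_bool (I = {X1, X3})" "del123 I = of_bool (I = {X1, X2, X3})"
  by (rule coord_set_cases[of I]; erule ssubst;
      simp add: Y1_def Y2_def Y3_def Y12_def Y23_def Y31_def Y123_def del12_def del23_def del31_def
        del123_def smul_def del_def wedge_eval coord_set_eq_iff)+

lemma ce_mult_vs:
  "ce (f * vx) i j k = ce f (i - 1) j k"
  "ce (f * vy) i j k = ce f i (j - 1) k"
  "ce (f * vz) i j k = ce f i j (k - 1)"
  "ce (f * (vx * g)) i j k = ce (f * g) (i - 1) j k"
  "ce (f * (vy * g)) i j k = ce (f * g) i (j - 1) k"
  by (subst mult.commute[of f] mult.left_commute[of f], simp)+

lemma cf_smul_fields:
  "cf (g \<odot> pv_one) I l m n = (if I = {} then ce g l m n else 0)"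
  "cf (g \<odot> Y1) I l m n = (if I = {X1} then ce g l m n else 0)"
  "cf (g \<odot> Y2) I l m n = (if I = {X2} then ce g l m n else 0)"
  "cf (g \<odot> Y3) I l m n = (if I = {X3} then ce g l m n else 0)"
  "cf (g \<odot> Y12) I l m n = (if I = {X1, X2} then ce g l m n else 0)"
  "cf (g \<odot> Y23) I l m n = (if I = {X2, X3} then ce g l m n else 0)"
  "cf (g \<odot> Y31) I l m n = (if I = {X1, X3} then - ce g l m n else 0)"
  "cf (g \<odot> Y123) I l m n = (if I = {X1, X2, X3} then ce g l m n else 0)"
  "cf (g \<odot> del12) I l m n = (if I = {X1, X2} then ce g (l + 1) (m + 1) n else 0)"
  "cf (g \<odot> del23) I l m n = (if I = {X2, X3} then ce g l (m + 1) (n + 1) else 0)"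
  "cf (g \<odot> del31) I l m n = (if I = {X1, X3} then - ce g (l + 1) m (n + 1) else 0)"
  "cf (g \<odot> del123) I l m n = (if I = {X1, X2, X3} then ce g (l + 1) (m + 1) (n + 1) else 0)"
  by (auto simp: cf_def smul_def Y_component ce_mult_vs pv_one_def)

lemma cf_Dp_power [simp]: "cf (Dp ^ N \<odot> P) I l m n = cf P I (l - int N) (m - int N) n"
  by (simp add: cf_def smul_def diff_add_eq)

lemma cf_zmul:
  "cf (zmul e P) I l m n = (if 0 \<le> n + of_bool (X3 \<in> I) then cf P I l m (n - e) else 0)"
  by (simp add: cf_def ce_def zmul_def of_nat_diff algebra_simps)

lemma smul_smul: "f \<odot> (g \<odot> P) = (f * g) \<odot> P"
  by (simp add: smul_def mult.assoc)

lemma smul_1: "1 \<odot> P = P"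
  by (simp add: smul_def)

lemmas cf_fields = cf_smul_fields[where g = 1, unfolded smul_1 ce_1]

section \<open>Partial chains and their differential\<close>

definition wcoef :: "coef \<Rightarrow> coord set \<Rightarrow> real"
  where "wcoef w I = cf (core w) I 0 0 0"

lemma wcoef_eval:
  "wcoef (Co0 A) I = (if I = {} then A else 0)"
  "wcoef (Co1 B C D) I = (if I = {X1} then B else if I = {X2} then C else if I = {X3} then D else 0)"
  "wcoef (Co2 E F) I = (if I = {X2, X3} then E else if I = {X1, X3} then - F else 0)"
  by (auto simp: wcoef_def cf_fields coord_set_eq_iff)

lemma cf_core: "cf (core w) I l m n = (if l = 0 \<and> m = 0 \<and> n = 0 then wcoef w I else 0)"
  by (cases w) (simp_all add: wcoef_eval cf_fields coord_set_eq_iff)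

lemma wcoef_cases:
  "wcoef w {X1, X2} = 0" "wcoef w {X1, X2, X3} = 0"
  by (cases w; simp add: wcoef_eval coord_set_eq_iff)+

text \<open>The conditions for c = 0, 1, 2 in one shape valid for all degrees: combinations that
  belong to another degree are 0. Later computations thus need no distinction by c.\<close>

lemma coef_cond_wcoef:
  assumes "coef_cond M k w w'" and "k < M"
  shows "wcoef w' {} = wcoef w {}" "wcoef w' {X3} = wcoef w {X3}"
    "(real M - real k) * (wcoef w' {X1} + wcoef w' {X2}) =
       (real M - real k + 1) * (wcoef w {X1} + wcoef w {X2}) - 2 * wcoef w {X3}"
    "(real M - real k) * (wcoef w' {X2, X3} + wcoef w' {X1, X3}) =
       (real M - real k + 1) * (wcoef w {X2, X3} + wcoef w {X1, X3})"
    "cdeg w' = cdeg w"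
proof -
  have nz: "real M - real k \<noteq> 0" using assms(2) by simp
  show "wcoef w' {} = wcoef w {}" "wcoef w' {X3} = wcoef w {X3}" "cdeg w' = cdeg w"
    "(real M - real k) * (wcoef w' {X1} + wcoef w' {X2}) =
       (real M - real k + 1) * (wcoef w {X1} + wcoef w {X2}) - 2 * wcoef w {X3}"
    "(real M - real k) * (wcoef w' {X2, X3} + wcoef w' {X1, X3}) =
       (real M - real k + 1) * (wcoef w {X2, X3} + wcoef w {X1, X3})"
    using assms nz
    by (cases w; cases w'; simp add: wcoef_eval coord_set_eq_iff add_divide_distrib[symmetric])+
qed

definition zn :: "real \<Rightarrow> real \<Rightarrow> nat \<Rightarrow> nat \<Rightarrow> real"
  where "zn a b M k = real (M choose k) / (2 * a + b) ^ k"

text \<open>Up to sign, \<open>(k + 1) (2 a + b)\<close> is the value of \<open>b l - a n\<close>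
  that is reached \<open>k + 1\<close> steps after a resonant exponent. The identity, an absorption
  rule for binomial coefficients, lets \<open>d'\<close> of term \<open>k + 1\<close> cancel
  \<open>d''\<close> of term k.\<close>

lemma zn_Suc:
  assumes "2 * a + b \<noteq> 0"
  shows "real (Suc k) * (2 * a + b) * zn a b M (Suc k) = (real M - real k) * zn a b M k"
proof -
  have "real (Suc k) * real (M choose Suc k) = (real M - real k) * real (M choose k)"
  proof (cases "k \<le> M")
    case True
    have "Suc k * (M choose Suc k) = (M - k) * (M choose k)"
      using binomial_absorb_comp[of M k] binomial_absorption[of k M]
      by (metis Suc_diff_Suc binomial_absorption binomial_eq_0 diff_is_0_eq diff_self_eq_0 linorder_not_le mult.commute mult_0_right)
    then show ?thesis using True by (metis of_nat_diff of_nat_mult)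
  qed (simp add: binomial_eq_0)
  moreover have "(2 * a + b) * zn a b M (Suc k) = real (M choose Suc k) / (2 * a + b) ^ k"
    using assms by (simp add: zn_def)
  ultimately show ?thesis by (simp only: mult.assoc) (simp only: zn_def times_divide_eq_right)
qed

lemma cf_Zterm:
  "cf (Zterm a b \<alpha> \<beta> i k w) I l m n =
    (if l = int (\<alpha> * i - k) \<and> m = int (\<alpha> * i - k) \<and> n = \<beta> * int i + 2 * int k
        \<and> 0 \<le> n + of_bool (X3 \<in> I)
     then zn a b (\<alpha> * i) k * wcoef w I else 0)"
  unfolding Zterm_def zn_def smul_smul[symmetric] cf_zmul
  by (auto simp: cf_core)

text \<open>Covers both kinds of type 1 representatives, the truncated sums with
  \<open>K = \<alpha> N\<close> and the closed forms with \<open>K = \<alpha> i\<close>, so that the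
  differential is computed only once.\<close>

definition chain :: "real \<Rightarrow> real \<Rightarrow> nat \<Rightarrow> int \<Rightarrow> nat \<Rightarrow> nat \<Rightarrow> (nat \<Rightarrow> coef) \<Rightarrow> pvf"
  where "chain a b \<alpha> \<beta> i K \<sigma> = (\<Sum>k\<le>K. Zterm a b \<alpha> \<beta> i k (\<sigma> k))"

text \<open>The last assumption concerns \<open>\<beta> i = -1\<close>: a leading term with
  \<open>z^(-1)\<close> makes sense only together with \<open>Y3\<close>, and \<open>zmul\<close>
  would cut off anything else.\<close>

lemma cf_chain:
  assumes "K \<le> \<alpha> * i" and "-1 \<le> \<beta> * int i"
    and "\<And>I. \<beta> * int i = -1 \<Longrightarrow> X3 \<notin> I \<Longrightarrow> wcoef (\<sigma> 0) I = 0"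
  shows "cf (chain a b \<alpha> \<beta> i K \<sigma>) I l m n =
    (if m = l \<and> n = \<beta> * int i + 2 * (int (\<alpha> * i) - l) \<and> l \<le> int (\<alpha> * i) \<and> int (\<alpha> * i) - int K \<le> l
     then zn a b (\<alpha> * i) (nat (int (\<alpha> * i) - l)) * wcoef (\<sigma> (nat (int (\<alpha> * i) - l))) I else 0)"
proof -
  have Z: "cf (Zterm a b \<alpha> \<beta> i k (\<sigma> k)) I l m n =
     (if k = nat (int (\<alpha> * i) - l) \<and> m = l \<and> n = \<beta> * int i + 2 * (int (\<alpha> * i) - l) \<and> l \<le> int (\<alpha> * i)
      then zn a b (\<alpha> * i) k * wcoef (\<sigma> k) I else 0)" if "k \<le> K" for k
  proof (cases "k = 0 \<and> \<beta> * int i = -1")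
    case True
    then show ?thesis using assms(3)[of I] by (auto simp: cf_Zterm)
  next
    case False
    then have "0 \<le> \<beta> * int i + 2 * int k + of_bool (X3 \<in> I)" using assms(2) by (auto simp: of_bool_def)
    moreover have "k \<le> \<alpha> * i" using that assms(1) by simp
    ultimately show ?thesis by (auto simp: cf_Zterm simp del: of_nat_mult)
  qed
  show ?thesis
    unfolding chain_def cf_sum using assms(1)
    by (subst sum.cong[OF refl Z]) (auto simp: sum.delta if_distrib cong: if_cong simp del: of_nat_mult)
qed

text \<open>Up to the factor \<open>zn\<close>, these are the coefficients of \<open>d''\<close> of
  the last term of a chain; j is the exponent of \<open>D'\<close> in that term.\<close>

fun end_coef :: "real \<Rightarrow> coef \<Rightarrow> coord set \<Rightarrow> real" where
  "end_coef j w I =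
    (if I = {X1} then j * wcoef w {}
     else if I = {X2} then - j * wcoef w {}
     else if I = {X1, X2} then (j + 1) * (wcoef w {X1} + wcoef w {X2}) - 2 * wcoef w {X3}
     else if I = {X1, X3} then j * wcoef w {X3}
     else if I = {X2, X3} then - j * wcoef w {X3}
     else if I = {X1, X2, X3} then (j + 1) * (wcoef w {X2, X3} + wcoef w {X1, X3})
     else 0)"

lemma cf_dif_chain:
  assumes K: "K \<le> \<alpha> * i" and L: "-1 \<le> \<beta> * int i"
    and perm: "\<And>I. \<beta> * int i = -1 \<Longrightarrow> X3 \<notin> I \<Longrightarrow> wcoef (\<sigma> 0) I = 0"
    and rel: "b * real (\<alpha> * i) = a * of_int (\<beta> * int i)"
    and ab: "0 < K \<Longrightarrow> 2 * a + b \<noteq> 0"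
    and cond: "\<And>k. k < K \<Longrightarrow> coef_cond (\<alpha> * i) k (\<sigma> k) (\<sigma> (k + 1))"
  shows "cf (dif a b (chain a b \<alpha> \<beta> i K \<sigma>)) I l m n =
    (if m = l \<and> l = int (\<alpha> * i) - int K - 1 \<and> n = \<beta> * int i + 2 * int K + 2
     then zn a b (\<alpha> * i) K * end_coef (real (\<alpha> * i) - real K) (\<sigma> K) I else 0)"
proof -
  define M where "M = \<alpha> * i"
  define L where "L = \<beta> * int i"
  define U where "U = chain a b \<alpha> \<beta> i K \<sigma>"
  note cfU = cf_chain[where \<sigma> = \<sigma> and a = a and b = b, OF K L perm, folded M_def L_def U_def]
  have rel: "b * real M = a * of_int L" using rel by (simp add: M_def L_def)
  have K: "K \<le> M" using K by (simp add: M_def)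
  have "cf (dif a b U) I l m n =
    (if m = l \<and> l = int M - int K - 1 \<and> n = L + 2 * int K + 2
     then zn a b M K * end_coef (real M - real K) (\<sigma> K) I else 0)"
  proof (cases "m = l \<and> n = L + 2 * (int M - l)")
    case False
    then have "cf U I l m n = 0" "cf U I (l + 1) (m + 1) (n - 2) = 0" for I by (auto simp: cfU)
    then show ?thesis using False by (cases I rule: coord_set_cases) (auto simp: cf_dif)
  next
    case line: True
    \<comment> \<open>Position relative to the chain: before its start, at its start, at a later
      term, one step past its last term, and farther on.\<close>
    consider "int M < l" | "l = int M" | "int M - int K \<le> l" "l < int M"
      | "l = int M - int K - 1" | "l < int M - int K - 1" by linarith
    then show ?thesis
    proof cases
      case 1
      then have "cf U I l m n = 0" "cf U I (l + 1) (m + 1) (n - 2) = 0" for I by (auto simp: cfU)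
      then show ?thesis using 1 by (cases I rule: coord_set_cases) (auto simp: cf_dif)
    next
      case 2
      then have "cf U I (l + 1) (m + 1) (n - 2) = 0" for I by (auto simp: cfU)
      then show ?thesis using 2 rel line by (cases I rule: coord_set_cases) (auto simp: cf_dif)
    next
      case 3
      define k where "k = nat (int M - l) - 1"
      have k: "k < K" "l = int M - int k - 1" using 3 by (auto simp: k_def)
      then have n: "n = L + 2 * int k + 2" "m = l" using line by auto
      have zk: "nat (int M - l) = Suc k" "nat (int M - (l + 1)) = k" using k 3 by auto
      have U1: "cf U I l l n = zn a b M (Suc k) * wcoef (\<sigma> (Suc k)) I" for I
        using 3 k n zk by (auto simp: cfU)
      have U0: "cf U I (l + 1) (l + 1) (n - 2) = zn a b M k * wcoef (\<sigma> k) I" for I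
        using 3 k n zk by (auto simp: cfU)
      have ab: "2 * a + b \<noteq> 0" using ab k by auto
      have kM: "k < M" using k K by simp
      note cc = coef_cond_wcoef[OF cond[OF k(1), folded M_def] kM, simplified]
      have lr: "real_of_int l = real M - real k - 1" using k by simp
      have nr: "real_of_int n = of_int L + 2 * real k + 2" using n by simp
      define e where "e = real (Suc k) * (2 * a + b)"
      have x: "b * of_int l - a * of_int n = - e"
        using rel unfolding lr nr e_def by (simp add: algebra_simps)
      then have x': "a * of_int n - b * of_int l = e" by linarith
      have "e * zn a b M (Suc k) = (real M - real k) * zn a b M k"
        unfolding e_def by (rule zn_Suc[OF ab])
      then have z: "e * (zn a b M (Suc k) * v) = zn a b M k * ((real M - real k) * v)" for v
        by (metis mult.assoc mult.commute)
      have "cf (dif a b U) I l m n = 0"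
      proof (cases I rule: coord_set_cases)
        case 5
        have "cf (dif a b U) I l m n =
           - (e * (zn a b M (Suc k) * (wcoef (\<sigma> (Suc k)) {X1} + wcoef (\<sigma> (Suc k)) {X2})))
           + zn a b M k * ((real M - real k + 1) * (wcoef (\<sigma> k) {X1} + wcoef (\<sigma> k) {X2}) - 2 * wcoef (\<sigma> k) {X3})"
          unfolding 5 cf_dif U1 U0 n(2) x x' by (simp add: lr algebra_simps)
        then show ?thesis by (simp only: z cc)
      next
        case 8
        have "cf (dif a b U) I l m n =
           - (e * (zn a b M (Suc k) * (wcoef (\<sigma> (Suc k)) {X2, X3} + wcoef (\<sigma> (Suc k)) {X1, X3})))
           + zn a b M k * ((real M - real k + 1) * (wcoef (\<sigma> k) {X2, X3} + wcoef (\<sigma> k) {X1, X3}))"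
          unfolding 8 cf_dif U1 U0 n(2) x x' by (simp add: lr algebra_simps)
        then show ?thesis by (simp only: z cc)
      qed (simp_all only: cf_dif U1 U0 n(2) x x' cc, simp_all add: lr z)
      then show ?thesis using k by simp
    next
      case 4
      then have U1: "cf U I l l n = 0" for I by (auto simp: cfU)
      have m: "m = l" using line by simp
      have lr: "real_of_int l = real M - real K - 1" using 4 by simp
      have "nat (int M - (l + 1)) = K" using 4 by simp
      then have U0: "cf U I (l + 1) (l + 1) (n - 2) = zn a b M K * wcoef (\<sigma> K) I" for I
        using line 4 by (auto simp: cfU)
      have "cf (dif a b U) I l m n = zn a b M K * end_coef (real M - real K) (\<sigma> K) I"
        unfolding m by (rule coord_set_cases[of I]; erule ssubst; simp add: coord_set_eq_iff;
            simp only: cf_dif U1 U0; simp add: lr algebra_simps)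
      then show ?thesis using line 4 by simp
    next
      case 5
      then have "cf U I l m n = 0" "cf U I (l + 1) (m + 1) (n - 2) = 0" for I by (auto simp: cfU)
      then show ?thesis using 5 by (cases I rule: coord_set_cases) (auto simp: cf_dif)
    qed
  qed
  then show ?thesis by (simp add: M_def L_def U_def)
qed

section \<open>Closed forms as chains of full length\<close>

fun closed_seq :: "coef \<Rightarrow> nat \<Rightarrow> coef" where
  "closed_seq (Co0 A) k = Co0 A"
| "closed_seq (Co1 B C D) k = Co1 B C ((B + C) / 2)"
| "closed_seq (Co2 E F) k = (if k = 0 then Co2 E E else Co2 0 0)"

text \<open>The solution with \<open>B + C = 2 D\<close>, resp. \<open>E = F\<close>. For c = 2 the
  condition involves only differences, so all terms after the first can be 0.\<close>

lemma coef_cond_closed_seq: "k < M \<Longrightarrow> coef_cond M k (closed_seq w k) (closed_seq w (k + 1))"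
  by (cases w) (simp_all add: field_simps)

text \<open>At the end of a full chain the exponent of \<open>D'\<close> is 0, so only
  \<open>B + C - 2 D\<close> and \<open>E - F\<close> are left. Hence closed forms are
  cocycles.\<close>

lemma end_coef_closed_seq: "end_coef 0 (closed_seq w k) I = 0"
  by (cases w) (simp_all add: wcoef_eval coord_set_eq_iff)

lemma cst_power: "cst c ^ k = cst (c ^ k)"
  by (simp add: cst_def fps_const_power)

lemma of_nat_eq_cst: "of_nat k = cst (real k)"
  by (simp add: cst_def fps_of_nat)

lemma ce_vz_power_mult [simp]: "ce (vz ^ N * f) i j k = ce f i j (k - int N)"
  by (induction N arbitrary: k) (simp_all add: mult.assoc algebra_simps)

lemma ce_DD_power_mult:
  "ce (DD a b ^ M * f) i j k =
     (\<Sum>e\<le>M. zn a b M e * ce f (i - int (M - e)) (j - int (M - e)) (k - 2 * int e))"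
proof -
  have "DD a b ^ M * f = (\<Sum>e\<le>M. of_nat (M choose e) * (cst (1 / (2 * a + b)) * vz ^ 2) ^ e * Dp ^ (M - e) * f)"
    unfolding DD_def by (subst add.commute) (simp add: binomial_ring sum_distrib_right)
  also have "\<dots> = (\<Sum>e\<le>M. cst (real (M choose e)) * (cst ((1 / (2 * a + b)) ^ e) * (vz ^ (2 * e) * (Dp ^ (M - e) * f))))"
    by (simp add: power_mult_distrib cst_power of_nat_eq_cst power_mult mult.assoc)
  finally show ?thesis
    by (simp add: ce_sum zn_def power_one_over)
qed

lemma cf_DD_power:
  "cf (DD a b ^ M \<odot> P) I l m n =
     (\<Sum>e\<le>M. zn a b M e * cf P I (l - int (M - e)) (m - int (M - e)) (n - 2 * int e))"
  unfolding cf_def smul_def ce_DD_power_mult by (simp add: diff_add_eq)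

lemma cf_zmul_DD_core:
  "zmul (\<beta> * int i) (DD a b ^ (\<alpha> * i) \<odot> core w) = chain a b \<alpha> \<beta> i (\<alpha> * i) (\<lambda>_. w)"
proof (rule pvf_eqI)
  fix I l m n
  have "zn a b (\<alpha> * i) e * cf (core w) I (l - int (\<alpha> * i - e)) (m - int (\<alpha> * i - e)) (n - \<beta> * int i - 2 * int e)
    = (if l = int (\<alpha> * i - e) \<and> m = int (\<alpha> * i - e) \<and> n = \<beta> * int i + 2 * int e
     then zn a b (\<alpha> * i) e * wcoef w I else 0)" for e
    by (simp add: cf_core algebra_simps)
  note * = this
  show "cf (zmul (\<beta> * int i) (DD a b ^ (\<alpha> * i) \<odot> core w)) I l m n
      = cf (chain a b \<alpha> \<beta> i (\<alpha> * i) (\<lambda>_. w)) I l m n"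
  proof (cases "0 \<le> n + of_bool (X3 \<in> I)")
    case True
    then show ?thesis unfolding chain_def cf_sum cf_Zterm cf_zmul cf_DD_power by (simp only: * if_True simp_thms)
  next
    case False
    then show ?thesis unfolding chain_def cf_sum cf_Zterm cf_zmul by (simp only: if_False simp_thms sum.neutral_const)
  qed
qed

text \<open>For c = 0, 1 the coefficients are constant in k and the chain is the binomial expansion
  of a power of \<open>D' + z^2/(2 a + b)\<close>; for c = 2 only its first term is nonzero.\<close>

lemma closed_form_eq_chain:
  "closed_form a b \<alpha> \<beta> i w = chain a b \<alpha> \<beta> i (\<alpha> * i) (closed_seq w)"
proof (cases w)
  case (Co0 A)
  moreover have "closed_seq (Co0 A) = (\<lambda>_. Co0 A)" by auto
  ultimately show ?thesis
    using cf_zmul_DD_core[of \<beta> i a b \<alpha> "Co0 A"] by (simp add: smul_smul)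
next
  case (Co1 B C D)
  have "cst B \<odot> (Y1 + cst (1/2) \<odot> Y3) + cst C \<odot> (Y2 + cst (1/2) \<odot> Y3) = core (Co1 B C ((B + C) / 2))"
    by (rule pvf_eqI) (simp add: algebra_simps add_divide_distrib)
  moreover have "closed_seq (Co1 B C D) = (\<lambda>_. Co1 B C ((B + C) / 2))" by auto
  ultimately show ?thesis
    using cf_zmul_DD_core[of \<beta> i a b \<alpha> "Co1 B C ((B + C) / 2)"] Co1 by simp
next
  case (Co2 E F)
  have core: "cst E \<odot> (Y23 + Y31) = core (Co2 E E)"
    by (rule pvf_eqI) (simp add: algebra_simps)
  have "Zterm a b \<alpha> \<beta> i k (if k = 0 then Co2 E E else Co2 0 0) = (if k = 0 then Zterm a b \<alpha> \<beta> i 0 (Co2 E E) else 0)" for k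
    by (rule pvf_eqI) (simp add: cf_Zterm wcoef_eval)
  then have "chain a b \<alpha> \<beta> i (\<alpha> * i) (closed_seq w) = Zterm a b \<alpha> \<beta> i 0 (Co2 E E)"
    by (simp only: chain_def Co2 closed_seq.simps) (simp add: sum.delta)
  also have "\<dots> = zmul (\<beta> * int i) (Dp ^ (\<alpha> * i) \<odot> core (Co2 E E))"
    by (rule pvf_eqI) (auto simp add: cf_Zterm cf_zmul cf_core zn_def simp del: core.simps)
  finally show ?thesis using Co2 core by (simp add: smul_smul[symmetric])
qed

section \<open>Resonant exponents\<close>

locale quadratic =
  fixes a b :: real and \<alpha> :: nat and \<beta> :: int
  assumes a0: "a \<noteq> 0" and b0: "b \<noteq> 0" and ex: "exponents a b \<alpha> \<beta>"
begin

lemma alpha_pos: "0 < \<alpha>"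
  using ex by (auto simp: exponents_def split: if_splits)

lemma ratio_special_neg: "ratio_special a b \<Longrightarrow> \<not> ratio_pos a b"
proof
  assume "ratio_special a b" "ratio_pos a b"
  then obtain m :: nat where "0 < m" "0 < - 1 / real m" by (auto simp: ratio_special_def ratio_pos_def)
  then show False by (simp add: zero_less_divide_iff)
qed

lemma ratio_posD:
  assumes "ratio_pos a b"
  shows "0 < \<beta>" "coprime (int \<alpha>) \<beta>" "b * real \<alpha> = a * of_int \<beta>"
  using ex assms a0 by (auto simp: exponents_def field_simps)

lemma ratio_specialD:
  assumes "ratio_special a b"
  shows "\<beta> = -1" "b * real \<alpha> = - a"
  using ex assms a0 ratio_special_neg by (auto simp: exponents_def field_simps)

lemma admissible_cases:
  assumes "admissible a b i"
  obtains "ratio_pos a b" | "i = 0" | "i = 1" "ratio_special a b"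
  using assms by (auto simp: admissible_def)

lemma admissible_rel:
  assumes "admissible a b i"
  shows "b * real (\<alpha> * i) = a * of_int (\<beta> * int i)"
  using assms
proof (cases rule: admissible_cases)
  case 1
  then have "b * real \<alpha> * real i = a * of_int \<beta> * real i" using ratio_posD by simp
  then show ?thesis by (simp add: mult.assoc)
next
  case 3
  then show ?thesis using ratio_specialD by simp
qed simp

lemma admissible_ge: "admissible a b i \<Longrightarrow> -1 \<le> \<beta> * int i"
  by (erule admissible_cases) (use ratio_posD ratio_specialD in \<open>auto intro: order_trans[of _ 0]\<close>)

lemma admissible_neg:
  assumes "admissible a b i" and "\<beta> * int i < 0"
  shows "i = 1" "ratio_special a b" "\<beta> = -1"
  using assms by (auto elim!: admissible_cases dest: ratio_posD ratio_specialD simp: mult_less_0_iff)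

text \<open>\<open>2 a + b = 0\<close> means \<open>b/a = -2\<close>, which is neither positive nor
  of the form \<open>-1/m\<close>.\<close>

lemma admissible_nz:
  assumes "admissible a b i" and "0 < i"
  shows "2 * a + b \<noteq> 0"
proof
  assume "2 * a + b = 0"
  then have b: "b = - 2 * a" by simp
  show False
    using assms(1)
  proof (cases rule: admissible_cases)
    case 1
    then show False using a0 by (simp add: ratio_pos_def b)
  next
    case 3
    then have "a * (2 * real \<alpha>) = a * 1" using ratio_specialD b by simp
    then have "2 * \<alpha> = 1" using a0 by (metis mult_left_cancel of_nat_1 of_nat_eq_iff of_nat_mult of_nat_numeral)
    then show False by presburger
  qed (use assms(2) in simp)
qed

text \<open>Hence the filtration degree p determines i, and at most one chain starts in it.\<close>

lemma admissible_beta_inj: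
  assumes "admissible a b i" and "admissible a b i'" and "\<beta> * int i = \<beta> * int i'"
  shows "i = i'"
  using assms(1)
proof (cases rule: admissible_cases)
  case 1
  then show ?thesis using ratio_posD assms(3) by simp
next
  case 2
  show ?thesis
    using assms(2)
    by (cases rule: admissible_cases) (use 2 ratio_posD ratio_specialD assms(3) in auto)
next
  case 3
  show ?thesis
    using assms(2)
    by (cases rule: admissible_cases) (use 3 ratio_special_neg ratio_specialD assms(3) in auto)
qed

text \<open>For \<open>j > 0\<close>, a positive n makes \<open>b/a\<close> a positive rational and
  coprimality gives the common factor i; \<open>n = 0\<close> would force \<open>b = 0\<close>;
  \<open>n = -1\<close> gives \<open>b/a = -1/j\<close>, the special ratio with
  \<open>i = 1\<close>.\<close>

lemma resonant_diagonal:
  fixes j n :: int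
  assumes "0 \<le> j" and "-1 \<le> n" and rel: "b * of_int j = a * of_int n"
  shows "\<exists>i. admissible a b i \<and> j = int (\<alpha> * i) \<and> n = \<beta> * int i"
proof (cases "j = 0")
  case True
  then have "n = 0" using rel a0 by simp
  then show ?thesis using True by (intro exI[of _ 0]) (simp add: admissible_def)
next
  case False
  then have j: "0 < j" using assms by simp
  have ba: "b / a = of_int n / of_int j" using rel a0 j by (simp add: field_simps)
  have n0: "n \<noteq> 0" using rel b0 j by auto
  show ?thesis
  proof (cases "0 < n")
    case True
    then have pos: "ratio_pos a b" using j by (simp add: ratio_pos_def ba)
    have "a * (of_int \<beta> * of_int j) = a * (real \<alpha> * of_int n)"
      using rel ratio_posD(3)[OF pos] by (metis mult.assoc mult.commute)
    then have "real_of_int (\<beta> * j) = real_of_int (int \<alpha> * n)" using a0 by simp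
    then have eq: "\<beta> * j = int \<alpha> * n" by (simp only: of_int_eq_iff)
    then have "int \<alpha> dvd \<beta> * j" by simp
    then have "int \<alpha> dvd j" using ratio_posD(2)[OF pos] by (simp add: coprime_dvd_mult_right_iff)
    then obtain c where c: "j = int \<alpha> * c" by auto
    then have "0 \<le> c" using j alpha_pos by (metis assms(1) of_nat_0_less_iff zero_le_mult_iff not_le)
    moreover have "n = \<beta> * c" using eq c alpha_pos by simp
    ultimately show ?thesis using c pos
      by (intro exI[of _ "nat c"]) (simp add: admissible_def)
  next
    case False
    then have n: "n = -1" using n0 assms by simp
    then have "b / a = - 1 / real (nat j)" using ba j by simp
    then have sp: "ratio_special a b" unfolding ratio_special_def using j by (intro exI[of _ "nat j"]) simp
    have "b * of_int j = b * real \<alpha>" using rel n ratio_specialD[OF sp] by simp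
    then have "real_of_int j = real_of_int (int \<alpha>)" using b0 by simp
    then have "j = int \<alpha>" by (simp only: of_int_eq_iff)
    then show ?thesis using sp n ratio_specialD[OF sp] by (intro exI[of _ 1]) (simp add: admissible_def)
  qed
qed

text \<open>The exponents at which \<open>[\<Lambda>\<^sub>4\<^sub>,\<^sub>I, \<cdot>]\<close> vanishes on all cochains.\<close>

definition resonant :: "int \<Rightarrow> int \<Rightarrow> int \<Rightarrow> bool"
  where "resonant l m n \<longleftrightarrow> (0 \<le> l \<longrightarrow> b * of_int m = a * of_int n)
    \<and> (0 \<le> m \<longrightarrow> b * of_int l = a * of_int n) \<and> (0 \<le> n \<longrightarrow> l = m)"

text \<open>If an exponent is -1, every allowed I contains that coordinate and wedging with its
  \<open>Y_i\<close> gives 0, so the corresponding component imposes no condition. The three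
  families belong to the chains and Casimirs, to the series in z, and to the extra series in x and y
  for \<open>a = b\<close>.\<close>

lemma resonant_iff:
  assumes "-1 \<le> l" "-1 \<le> m" "-1 \<le> n"
  shows "resonant l m n \<longleftrightarrow>
    (\<exists>i. admissible a b i \<and> l = int (\<alpha> * i) \<and> m = int (\<alpha> * i) \<and> n = \<beta> * int i)
    \<or> (l = -1 \<and> m = -1)
    \<or> (a = b \<and> n = -1 \<and> (l = -1 \<and> 0 \<le> m \<or> 0 \<le> l \<and> m = -1))" (is "_ \<longleftrightarrow> ?R")
proof
  assume r: "resonant l m n"
  consider "0 \<le> l" "0 \<le> m" | "l = -1" "m = -1" | "l = -1" "0 \<le> m" | "0 \<le> l" "m = -1"
    using assms by linarith
  then show ?R
  proof cases
    case 1
    then have "b * of_int m = a * of_int n" "b * of_int l = a * of_int n" using r by (auto simp: resonant_def)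
    then have lm: "l = m" using b0 by (metis mult_left_cancel of_int_eq_iff)
    then show ?thesis using resonant_diagonal[of m n] r 1 assms by (auto simp: resonant_def)
  next
    case 2
    then show ?thesis by simp
  next
    case 3
    then have "n = -1" using r assms by (force simp: resonant_def)
    then show ?thesis using 3 r by (simp add: resonant_def)
  next
    case 4
    then have "n = -1" using r assms by (force simp: resonant_def)
    then show ?thesis using 4 r by (simp add: resonant_def)
  qed
next
  assume ?R
  then show "resonant l m n"
    using admissible_rel by (auto simp: resonant_def)
qed

lemma resonant_admissible:
  "admissible a b i \<Longrightarrow> resonant (int (\<alpha> * i)) (int (\<alpha> * i)) (\<beta> * int i)"
  using admissible_rel by (simp add: resonant_def)

text \<open>The exponents of \<open>z\<close> in the images of \<open>d\<^sub>2\<^sub>\<alpha>\<^sub>i\<^sub>+\<^sub>2\<close>, \<open>i < N\<close>. As \<open>z^n Y\<^sub>1\<^sub>2 / (x y) = z^n \<partial>\<^sub>1\<^sub>2\<close> and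
  \<open>z^n Y\<^sub>1\<^sub>2\<^sub>3 / (x y) = z^(n+1) \<partial>\<^sub>1\<^sub>2\<^sub>3\<close>, one value of \<open>n\<close> accounts for both removed representatives.\<close>

definition killed :: "nat \<Rightarrow> int \<Rightarrow> bool"
  where "killed N n \<longleftrightarrow> (\<exists>i<N. admissible a b i \<and> n = \<beta> * int i + 2 * int (\<alpha> * i) + 2)"

definition surv :: "nat \<Rightarrow> coord set \<Rightarrow> int \<Rightarrow> int \<Rightarrow> int \<Rightarrow> bool"
  where "surv N I l m n \<longleftrightarrow>
    allowed I l m n \<and> resonant l m n \<and> \<not> (l = -1 \<and> m = -1 \<and> killed N n)"

text \<open>\<open>surv\<close> lists the terms \<open>x^l y^m z^n Y\<^sub>I\<close> that contribute to the package; those of type 2 are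
  distinguished by the shape of the exponents.\<close>

definition slot2 :: "nat \<Rightarrow> coord set \<Rightarrow> int \<Rightarrow> int \<Rightarrow> int \<Rightarrow> bool"
  where "slot2 N I l m n \<longleftrightarrow> surv N I l m n \<and> (0 \<le> l \<and> 0 \<le> m \<longrightarrow> {X1, X2} \<subseteq> I)"

lemma allowed_ge: "allowed I l m n \<Longrightarrow> -1 \<le> l \<and> -1 \<le> m \<and> -1 \<le> n"
  by (auto simp: allowed_def of_bool_def split: if_splits)

section \<open>Type 2 representatives in terms of exponents\<close>

lemma killed_nonneg:
  assumes "killed N n"
  shows "1 \<le> n"
proof -
  obtain i where i: "admissible a b i" "n = \<beta> * int i + 2 * int (\<alpha> * i) + 2"
    using assms by (auto simp: killed_def)
  then show ?thesis using admissible_ge[OF i(1)] by linarith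
qed

text \<open>One description serves all ratios: for the special ratio, \<open>i = 1\<close> would
  need the exponent -1 of z, which no power series has.\<close>

lemma Cas_iff:
  "f \<in> Cas a b \<alpha> \<beta> \<longleftrightarrow> (\<forall>l m n. ce f l m n \<noteq> 0 \<longrightarrow>
     (\<exists>i. admissible a b i \<and> l = int (\<alpha> * i) \<and> m = int (\<alpha> * i) \<and> n = \<beta> * int i))" (is "_ \<longleftrightarrow> ?R")
proof (cases "ratio_pos a b")
  case True
  show ?thesis
  proof
    assume f: "f \<in> Cas a b \<alpha> \<beta>"
    show ?R
    proof (intro allI impI)
      fix l m n assume nz: "ce f l m n \<noteq> 0"
      then have ge: "0 \<le> l" "0 \<le> m" "0 \<le> n" by (auto simp: ce_def split: if_splits)
      then have "f $ nat l $ nat m $ nat n \<noteq> 0" using nz by (simp add: ce_def)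
      then obtain i where "nat l = \<alpha> * i \<and> nat m = \<alpha> * i \<and> int (nat n) = \<beta> * int i"
        using f[unfolded Cas_def] unfolding if_P[OF True] by blast
      then show "\<exists>i. admissible a b i \<and> l = int (\<alpha> * i) \<and> m = int (\<alpha> * i) \<and> n = \<beta> * int i"
        using ge True by (intro exI[of _ i]) (simp add: admissible_def nat_eq_iff)
    qed
  next
    assume R: ?R
    have "\<exists>i::nat. l = \<alpha> * i \<and> m = \<alpha> * i \<and> int n = \<beta> * int i" if "f $ l $ m $ n \<noteq> 0" for l m n
      using R that unfolding ce_nth by (metis of_nat_eq_iff)
    then show "f \<in> Cas a b \<alpha> \<beta>" using True by (simp add: Cas_def)
  qed
next
  case False
  show ?thesis
  proof
    assume "f \<in> Cas a b \<alpha> \<beta>"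
    then obtain c where "f = cst c" using False by (auto simp: Cas_def)
    then show ?R by (auto simp: ce_cst admissible_def intro: exI[of _ 0])
  next
    assume R: ?R
    have "f = cst (ce f 0 0 0)"
    proof (rule ce_eqI)
      fix i j k :: int assume ge: "0 \<le> i" "0 \<le> j" "0 \<le> k"
      show "ce f i j k = ce (cst (ce f 0 0 0)) i j k"
      proof (cases "ce f i j k = 0")
        case z: False
        then obtain e where e: "admissible a b e" "i = int (\<alpha> * e)" "j = int (\<alpha> * e)" "k = \<beta> * int e"
          using R by blast
        then have "e = 0" using False ge
          by (auto elim!: admissible_cases dest: ratio_specialD)
        then show ?thesis using e by (simp add: ce_cst)
      qed (auto simp: ce_cst)
    qed
    then show "f \<in> Cas a b \<alpha> \<beta>" using False by (auto simp: Cas_def)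
  qed
qed

end

lemma Rx_iff: "f \<in> Rx \<longleftrightarrow> (\<forall>i j k. ce f i j k \<noteq> 0 \<longrightarrow> j = 0 \<and> k = 0)"
  unfolding Rx_def ce_nth
  by (auto, (metis ce_neg not_le_imp_less of_nat_eq_0_iff zero_le_imp_eq_int)+)

lemma Ry_iff: "f \<in> Ry \<longleftrightarrow> (\<forall>i j k. ce f i j k \<noteq> 0 \<longrightarrow> i = 0 \<and> k = 0)"
  unfolding Ry_def ce_nth
  by (auto, (metis ce_neg not_le_imp_less of_nat_eq_0_iff zero_le_imp_eq_int)+)

lemma Rz_iff: "f \<in> Rz \<longleftrightarrow> (\<forall>i j k. ce f i j k \<noteq> 0 \<longrightarrow> i = 0 \<and> j = 0)"
  unfolding Rz_def ce_nth
  by (auto, (metis ce_neg not_le_imp_less of_nat_eq_0_iff zero_le_imp_eq_int)+)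

context quadratic
begin

text \<open>In the frame of the \<open>Y_i\<close>, \<open>z^k\<close> has exponent k as coefficient
  of \<open>\<partial>\<^sub>1\<^sub>2\<close> and \<open>k - 1\<close> as coefficient of
  \<open>\<partial>\<^sub>1\<^sub>2\<^sub>3\<close>; this is \<open>k + 2 - e\<close> for
  \<open>e = 2, 3\<close>.\<close>

lemma Rz_except_iff:
  "f \<in> Rz_except a b \<alpha> \<beta> N e \<longleftrightarrow>
    (\<forall>i j k. ce f i j k \<noteq> 0 \<longrightarrow> i = 0 \<and> j = 0 \<and> \<not> killed N (k + 2 - int e))"
  (is "_ \<longleftrightarrow> ?R")
proof
  assume f: "f \<in> Rz_except a b \<alpha> \<beta> N e"
  show ?R
  proof (intro allI impI)
    fix i j k assume nz: "ce f i j k \<noteq> 0"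
    have ij: "i = 0 \<and> j = 0" using f nz by (auto simp: Rz_except_def Rz_iff)
    moreover have "0 \<le> k" using nz by (auto simp: ce_def split: if_splits)
    moreover have "\<not> killed N (k + 2 - int e)"
    proof
      assume "killed N (k + 2 - int e)"
      then obtain i' where i': "i' < N" "admissible a b i'" "k + 2 - int e = \<beta> * int i' + 2 * int (\<alpha> * i') + 2"
        by (auto simp: killed_def)
      then have "int (nat k) = int i' * (2 * int \<alpha> + \<beta>) + int e"
        using \<open>0 \<le> k\<close> by (simp add: algebra_simps)
      then have "f $ 0 $ 0 $ nat k = 0" using f i' by (auto simp: Rz_except_def)
      then show False using nz ij \<open>0 \<le> k\<close> by (simp add: ce_def)
    qed
    ultimately show "i = 0 \<and> j = 0 \<and> \<not> killed N (k + 2 - int e)" by simp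
  qed
next
  assume R: ?R
  have "f $ 0 $ 0 $ k = 0"
    if "i < N" "admissible a b i" "int k = int i * (2 * int \<alpha> + \<beta>) + int e" for i k
  proof -
    have "killed N (int k + 2 - int e)"
      unfolding killed_def using that by (intro exI[of _ i]) (simp add: algebra_simps)
    then show ?thesis using R unfolding ce_nth by auto
  qed
  moreover have "f \<in> Rz" using R by (simp add: Rz_iff)
  ultimately show "f \<in> Rz_except a b \<alpha> \<beta> N e" by (simp add: Rz_except_def)
qed

lemma cf_type2_sum:
  fixes u v g h f1 f2 g1 g2 :: ps3 and t :: real
  defines "T \<equiv> u \<odot> Y12 + v \<odot> Y123 + g \<odot> del12 + h \<odot> del123
       + f1 \<odot> del23 + f2 \<odot> del31 + (g1 + g2) \<odot> del123
       + zmul (-1) ((cst t * Dp ^ \<alpha>) \<odot> Y123)"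
  shows "cf T {X1, X2} l m n = ce u l m n + ce g (l + 1) (m + 1) n"
    "cf T {X1, X3} l m n = - ce f2 (l + 1) m (n + 1)"
    "cf T {X2, X3} l m n = ce f1 l (m + 1) (n + 1)"
    "cf T {X1, X2, X3} l m n = ce v l m n + ce h (l + 1) (m + 1) (n + 1)
       + ce g1 (l + 1) (m + 1) (n + 1) + ce g2 (l + 1) (m + 1) (n + 1)
       + t * of_bool (l = int \<alpha> \<and> m = int \<alpha> \<and> n = -1)"
    "cf T {} l m n = 0" "cf T {X1} l m n = 0" "cf T {X2} l m n = 0" "cf T {X3} l m n = 0"
  unfolding T_def
  by (auto simp: cf_smul_fields cf_zmul coord_set_eq_iff ce_Dp_power)

lemma type2_imp_slot2:
  assumes "T \<in> type2 a b \<alpha> \<beta> N" and nz: "cf T I l m n \<noteq> 0"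
  shows "slot2 N I l m n"
proof -
  obtain u v g h f1 f2 g1 g2 t where T: "T = u \<odot> Y12 + v \<odot> Y123 + g \<odot> del12 + h \<odot> del123
       + f1 \<odot> del23 + f2 \<odot> del31 + (g1 + g2) \<odot> del123
       + zmul (-1) ((cst t * Dp ^ \<alpha>) \<odot> Y123)"
    and u: "u \<in> Cas a b \<alpha> \<beta>" and v: "v \<in> Cas a b \<alpha> \<beta>"
    and g: "g \<in> Rz_except a b \<alpha> \<beta> N 2" and h: "h \<in> Rz_except a b \<alpha> \<beta> N 3"
    and f: "f1 \<in> Rx" "f2 \<in> Ry" and gg: "g1 \<in> Rx" "g2 \<in> Ry"
    and ab: "a \<noteq> b \<longrightarrow> f1 = 0 \<and> f2 = 0 \<and> g1 = 0 \<and> g2 = 0"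
    and t: "\<not> ratio_special a b \<longrightarrow> t = 0"
    using assms(1) unfolding type2_def by blast
  note cfT = cf_type2_sum[of u v g h f1 f2 g1 g2 t, folded T]
  have al: "allowed I l m n" using nz cf_not_allowed by blast
  then have ge: "-1 \<le> l" "-1 \<le> m" "-1 \<le> n" using allowed_ge by auto
  have cas: "resonant l m n" "0 \<le> l" "0 \<le> m" if w: "w \<in> Cas a b \<alpha> \<beta>" "ce w l m n \<noteq> 0" for w
  proof -
    obtain i where i: "admissible a b i" "l = int (\<alpha> * i)" "m = int (\<alpha> * i)" "n = \<beta> * int i"
      using w unfolding Cas_iff by blast
    then show "resonant l m n" "0 \<le> l" "0 \<le> m" using resonant_admissible[OF i(1)] by auto
  qed
  have edge: "resonant (-1) (-1) n" for n by (simp add: resonant_def)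
  have edges: "resonant l (-1) (-1)" "resonant (-1) m (-1)" if "a = b" for l m :: int
    unfolding resonant_def using that by simp_all
  have nk: "\<not> killed N (-1)" using killed_nonneg[of N "-1"] by auto
  show ?thesis
  proof (cases I rule: coord_set_cases)
    case 5
    then consider "ce u l m n \<noteq> 0" | "ce g (l + 1) (m + 1) n \<noteq> 0" using nz cfT by fastforce
    then show ?thesis
    proof cases
      case 1
      then show ?thesis unfolding slot2_def surv_def using cas[OF u] al 5 by auto
    next
      case 2
      then have "l + 1 = 0 \<and> m + 1 = 0 \<and> \<not> killed N n" using g unfolding Rz_except_iff by force
      then have "l = -1" "m = -1" "\<not> killed N n" by auto
      then show ?thesis unfolding slot2_def surv_def using al 5 edge by auto
    qed
  next
    case 6
    then have "ce f2 (l + 1) m (n + 1) \<noteq> 0" using nz cfT by simp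
    then have "a = b" "l + 1 = 0" "n + 1 = 0" using f ab by (auto simp: Ry_iff)
    moreover have "0 \<le> m" using al 6 by (simp add: allowed_def)
    ultimately have "a = b" "l = -1" "n = -1" "0 \<le> m" by auto
    then show ?thesis unfolding slot2_def surv_def using al 6 edges by auto
  next
    case 7
    then have "ce f1 l (m + 1) (n + 1) \<noteq> 0" using nz cfT by simp
    then have "a = b" "m + 1 = 0" "n + 1 = 0" using f ab by (auto simp: Rx_iff)
    moreover have "0 \<le> l" using al 7 by (simp add: allowed_def)
    ultimately have "a = b" "m = -1" "n = -1" "0 \<le> l" by auto
    then show ?thesis unfolding slot2_def surv_def using al 7 edges by auto
  next
    case 8
    then consider "ce v l m n \<noteq> 0" | "ce h (l + 1) (m + 1) (n + 1) \<noteq> 0"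
      | "ce g1 (l + 1) (m + 1) (n + 1) \<noteq> 0" | "ce g2 (l + 1) (m + 1) (n + 1) \<noteq> 0"
      | "t \<noteq> 0" "l = int \<alpha> \<and> m = int \<alpha> \<and> n = -1" using nz cfT by fastforce
    then show ?thesis
    proof cases
      case 1
      then show ?thesis unfolding slot2_def surv_def using cas[OF v] al 8 by auto
    next
      case 2
      then have "l + 1 = 0 \<and> m + 1 = 0 \<and> \<not> killed N (n + 1 + 2 - int 3)" using h unfolding Rz_except_iff by blast
      then have "l = -1" "m = -1" "\<not> killed N n" by auto
      then show ?thesis unfolding slot2_def surv_def using al 8 edge by auto
    next
      case 3
      then have "a = b" "m + 1 = 0" "n + 1 = 0" using gg ab by (auto simp: Rx_iff)
      then have "a = b" "m = -1" "n = -1" by auto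
      then show ?thesis unfolding slot2_def surv_def using al 8 edges nk by auto
    next
      case 4
      then have "a = b" "l + 1 = 0" "n + 1 = 0" using gg ab by (auto simp: Ry_iff)
      then have "a = b" "l = -1" "n = -1" by auto
      then show ?thesis unfolding slot2_def surv_def using al 8 edges nk by auto
    next
      case 5
      then have sp: "ratio_special a b" using t by auto
      then have "admissible a b 1" "\<beta> = -1" using ratio_specialD by (auto simp: admissible_def)
      then have "resonant l m n" using resonant_admissible[of 1] 5 by simp
      then show ?thesis unfolding slot2_def surv_def using al 8 5 by auto
    qed
  qed (use nz cfT in auto)
qed

lemma slot2_imp_type2:
  assumes T: "\<And>I l m n. cf T I l m n \<noteq> 0 \<Longrightarrow> slot2 N I l m n"
  shows "T \<in> type2 a b \<alpha> \<beta> N"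
proof -
  define u where "u = mkps (cf T {X1, X2})"
  define v where "v = mkps (cf T {X1, X2, X3})"
  define g where "g = mkps (\<lambda>i j k. if i = 0 \<and> j = 0 then cf T {X1, X2} (-1) (-1) k else 0)"
  define h where "h = mkps (\<lambda>i j k. if i = 0 \<and> j = 0 then cf T {X1, X2, X3} (-1) (-1) (k - 1) else 0)"
  define f1 where "f1 = mkps (\<lambda>i j k. if j = 0 \<and> k = 0 then cf T {X2, X3} i (-1) (-1) else 0)"
  define f2 where "f2 = mkps (\<lambda>i j k. if i = 0 \<and> k = 0 then - cf T {X1, X3} (-1) j (-1) else 0)"
  \<comment> \<open>The constant term of the coefficient of
    \<open>\<partial>\<^sub>1\<^sub>2\<^sub>3\<close> is given to h, so \<open>g1\<close> and
    \<open>g2\<close> begin with the first power.\<close>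
  define g1 where "g1 = mkps (\<lambda>i j k. if 1 \<le> i \<and> j = 0 \<and> k = 0 then cf T {X1, X2, X3} (i - 1) (-1) (-1) else 0)"
  define g2 where "g2 = mkps (\<lambda>i j k. if i = 0 \<and> 1 \<le> j \<and> k = 0 then cf T {X1, X2, X3} (-1) (j - 1) (-1) else 0)"
  define t where "t = cf T {X1, X2, X3} (int \<alpha>) (int \<alpha>) (-1)"
  have res: "allowed I l m n" "resonant l m n" "-1 \<le> l" "-1 \<le> m" "-1 \<le> n"
    "\<not> (l = -1 \<and> m = -1 \<and> killed N n)" "0 \<le> l \<and> 0 \<le> m \<longrightarrow> {X1, X2} \<subseteq> I"
    if "cf T I l m n \<noteq> 0" for I l m n
    using T[OF that] allowed_ge by (auto simp: slot2_def surv_def)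
  have cas: "mkps (cf T I) \<in> Cas a b \<alpha> \<beta>" for I
    unfolding Cas_iff
  proof (intro allI impI)
    fix l m n assume "ce (mkps (cf T I)) l m n \<noteq> 0"
    then have "0 \<le> l" "0 \<le> m" "cf T I l m n \<noteq> 0" by (auto simp: ce_mkps split: if_splits)
    then show "\<exists>i. admissible a b i \<and> l = int (\<alpha> * i) \<and> m = int (\<alpha> * i) \<and> n = \<beta> * int i"
      using res[of I l m n] resonant_iff[of l m n] by auto
  qed
  have nab: "cf T I l (-1) (-1) = 0" "cf T I (-1) l (-1) = 0" if "a \<noteq> b" "0 \<le> l" for l I
    using res(2)[of I l "-1" "-1"] res(2)[of I "-1" l "-1"] that by (auto simp: resonant_def)
  have mem: "u \<in> Cas a b \<alpha> \<beta>" "v \<in> Cas a b \<alpha> \<beta>"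
    "g \<in> Rz_except a b \<alpha> \<beta> N 2" "h \<in> Rz_except a b \<alpha> \<beta> N 3" "f1 \<in> Rx" "f2 \<in> Ry" "g1 \<in> Rx" "g2 \<in> Ry"
    using cas res(6) unfolding u_def v_def g_def h_def f1_def f2_def g1_def g2_def Rz_except_iff Rx_iff Ry_iff
    by (auto simp: ce_mkps split: if_splits)
  have ab: "f1 = 0 \<and> f2 = 0 \<and> g1 = 0 \<and> g2 = 0" if "a \<noteq> b"
    unfolding f1_def f2_def g1_def g2_def
    by (intro conjI; rule ce_eqI; use nab[OF that] in \<open>simp add: ce_mkps\<close>)
  have t: "t = 0" if "\<not> ratio_special a b"
  proof (rule ccontr)
    assume "t \<noteq> 0"
    then have "resonant (int \<alpha>) (int \<alpha>) (-1)" using res unfolding t_def by blast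
    then have "b * real \<alpha> = - a" by (simp add: resonant_def)
    then have "b / a = - 1 / real \<alpha>" using a0 alpha_pos by (simp add: field_simps)
    then show False using that alpha_pos unfolding ratio_special_def by blast
  qed
  define S where "S = u \<odot> Y12 + v \<odot> Y123 + g \<odot> del12 + h \<odot> del123
       + f1 \<odot> del23 + f2 \<odot> del31 + (g1 + g2) \<odot> del123
       + zmul (-1) ((cst t * Dp ^ \<alpha>) \<odot> Y123)"
  note cfS = cf_type2_sum[of u v g h f1 f2 g1 g2 t, folded S_def]
  have "T = S"
  proof (rule pvf_eqI)
    fix I l m n
    show "cf T I l m n = cf S I l m n"
    proof (cases "allowed I l m n")
      case True
      then have ge: "-1 \<le> l" "-1 \<le> m" "-1 \<le> n" using allowed_ge by auto
      have z: "cf T I l m n = 0" if "\<not> resonant l m n" for I using res(2) that by blast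
      have z2: "cf T I l m n = 0" if "\<not> (0 \<le> l \<and> 0 \<le> m \<longrightarrow> {X1, X2} \<subseteq> I)" using res(7) that by blast
      have *: "cf T I (-1) m n = 0" "cf T I m (-1) n = 0" if "0 \<le> m" "0 \<le> n" for I m n
        using res(2)[of I "-1" m n] res(2)[of I m "-1" n] that by (auto simp: resonant_def)
      \<comment> \<open>\<open>\<beta> i = -1\<close> forces \<open>i = 1\<close>; with nonnegative
        exponents of x and y, \<open>z^(-1)\<close> therefore occurs only in the summand with
        t.\<close>
      have tz: "cf T I l m (-1) = 0" if lm: "0 \<le> l" "0 \<le> m" "\<not> (l = int \<alpha> \<and> m = int \<alpha>)" for I l m
      proof (rule ccontr)
        assume "cf T I l m (-1) \<noteq> 0"
        then obtain i where i: "admissible a b i" "l = int (\<alpha> * i)" "m = int (\<alpha> * i)" "-1 = \<beta> * int i"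
          using res[of I l m "-1"] resonant_iff[of l m "-1"] lm by auto
        then have "i = 1" using admissible_neg[of i] by simp
        then show False using i lm by simp
      qed
      show ?thesis
        using True ge
      proof (cases I rule: coord_set_cases)
        case 5
        then have "0 \<le> n" using True by (simp add: allowed_def)
        then show ?thesis using 5 ge *[of m n] *[of l n]
          by (cases "l = -1"; cases "m = -1") (auto simp: cfS u_def g_def ce_mkps)
      next
        case 6
        then have "0 \<le> m" using True by (simp add: allowed_def)
        then show ?thesis using 6 ge *[of m n] z2
          by (cases "l = -1"; cases "n = -1") (auto simp: cfS f2_def ce_mkps)
      next
        case 7
        then have "0 \<le> l" using True by (simp add: allowed_def)
        then show ?thesis using 7 ge *[of l n] z2
          by (cases "m = -1"; cases "n = -1") (auto simp: cfS f1_def ce_mkps)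
      next
        case 8
        then show ?thesis using ge *[of m n] *[of l n] tz[of l m I]
          by (cases "l = -1"; cases "m = -1"; cases "n = -1")
            (auto simp: cfS v_def h_def g1_def g2_def t_def ce_mkps)
      next
        case 1
        then show ?thesis using True z2 by (auto simp: cfS allowed_def)
      next
        case 2
        then have "0 \<le> m" "0 \<le> n" using True by (auto simp: allowed_def)
        then show ?thesis using 2 ge z2 *[of m n] by (cases "l = -1") (auto simp: cfS)
      next
        case 3
        then have "0 \<le> l" "0 \<le> n" using True by (auto simp: allowed_def)
        then show ?thesis using 3 ge z2 *[of l n] by (cases "m = -1") (auto simp: cfS)
      next
        case 4
        then show ?thesis using True z2 by (auto simp: cfS allowed_def)
      qed
    qed (simp add: cf_not_allowed)
  qed
  then show ?thesis
    unfolding type2_def S_def using mem ab t by blast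
qed

end

section \<open>Boundaries and the relation on cycles\<close>

text \<open>Coordinates of \<open>i_k (x \<and> u) + x \<and> i_k u = u\<close> for a vector x and a
  covector k with pairing 1, in the case \<open>x \<and> u = 0\<close>. E, F, G are the coefficients
  at \<open>{X2, X3}\<close>, \<open>{X1, X3}\<close>, \<open>{X1, X2}\<close>; H is the one in top
  degree.\<close>

lemma contraction_identities:
  fixes x1 x2 x3 k1 k2 k3 :: real
  assumes "x1 * k1 + x2 * k2 + x3 * k3 = 1"
  shows "x1 * A = 0 \<Longrightarrow> x2 * A = 0 \<Longrightarrow> x3 * A = 0 \<Longrightarrow> A = 0"
    and "x1 * C - x2 * B = 0 \<Longrightarrow> x1 * D - x3 * B = 0 \<Longrightarrow> x1 * (k1 * B + k2 * C + k3 * D) = B"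
    and "x1 * C - x2 * B = 0 \<Longrightarrow> x2 * D - x3 * C = 0 \<Longrightarrow> x2 * (k1 * B + k2 * C + k3 * D) = C"
    and "x1 * D - x3 * B = 0 \<Longrightarrow> x2 * D - x3 * C = 0 \<Longrightarrow> x3 * (k1 * B + k2 * C + k3 * D) = D"
    and "x1 * E - x2 * F + x3 * G = 0 \<Longrightarrow> x1 * (k1 * G - k3 * E) - x2 * (- k2 * G - k3 * F) = G"
    and "x1 * E - x2 * F + x3 * G = 0 \<Longrightarrow> x1 * (k2 * E + k1 * F) - x3 * (- k2 * G - k3 * F) = F"
    and "x1 * E - x2 * F + x3 * G = 0 \<Longrightarrow> x2 * (k2 * E + k1 * F) - x3 * (k1 * G - k3 * E) = E"
    and "x1 * (k1 * H) - x2 * (- k2 * H) + x3 * (k3 * H) = H"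
  using assms by algebra+

lemma wcoef_tc_Suc:
  assumes "coef_cond M k w w'" and "k < M"
  shows "(real M - real k) * (wcoef w' {X1} + wcoef w' {X2} - 2 * wcoef w' {X3}) =
    (real M - real k + 1) * (wcoef w {X1} + wcoef w {X2} - 2 * wcoef w {X3})"
  using coef_cond_wcoef[OF assms] by (simp add: algebra_simps)

text \<open>Both combinations satisfy \<open>(M - k) t_(k+1) = (M - k + 1) t_k\<close>, so the value
  at the end is \<open>M + 1\<close> times the value at the start.\<close>

lemma wcoef_end_nonzero:
  assumes "\<And>k. k < M \<Longrightarrow> coef_cond M k (\<sigma> k) (\<sigma> (k + 1))"
  shows "wcoef (\<sigma> 0) {X1} + wcoef (\<sigma> 0) {X2} - 2 * wcoef (\<sigma> 0) {X3} \<noteq> 0 \<Longrightarrow>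
      wcoef (\<sigma> M) {X1} + wcoef (\<sigma> M) {X2} - 2 * wcoef (\<sigma> M) {X3} \<noteq> 0"
    and "wcoef (\<sigma> 0) {X2, X3} + wcoef (\<sigma> 0) {X1, X3} \<noteq> 0 \<Longrightarrow>
      wcoef (\<sigma> M) {X2, X3} + wcoef (\<sigma> M) {X1, X3} \<noteq> 0"
    and "cdeg (\<sigma> M) = cdeg (\<sigma> 0)"
proof -
  define t where "t k = wcoef (\<sigma> k) {X1} + wcoef (\<sigma> k) {X2} - 2 * wcoef (\<sigma> k) {X3}" for k
  define g where "g k = wcoef (\<sigma> k) {X2, X3} + wcoef (\<sigma> k) {X1, X3}" for k
  have "k \<le> M \<Longrightarrow> (t 0 \<noteq> 0 \<longrightarrow> t k \<noteq> 0) \<and> (g 0 \<noteq> 0 \<longrightarrow> g k \<noteq> 0) \<and> cdeg (\<sigma> k) = cdeg (\<sigma> 0)" for k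
  proof (induction k)
    case (Suc k)
    then have k: "k < M" by simp
    note c = assms[OF k]
    have nz: "real M - real k + 1 \<noteq> 0" using k by simp
    have "(real M - real k) * t (Suc k) = (real M - real k + 1) * t k"
      using wcoef_tc_Suc[OF c k] by (simp add: t_def)
    moreover have "(real M - real k) * g (Suc k) = (real M - real k + 1) * g k"
      using coef_cond_wcoef(4)[OF c k] by (simp add: g_def)
    moreover have "cdeg (\<sigma> (Suc k)) = cdeg (\<sigma> k)" using coef_cond_wcoef(5)[OF c k] by simp
    ultimately show ?case using Suc nz by auto
  qed simp
  from this[of M] show "wcoef (\<sigma> 0) {X1} + wcoef (\<sigma> 0) {X2} - 2 * wcoef (\<sigma> 0) {X3} \<noteq> 0 \<Longrightarrow>
      wcoef (\<sigma> M) {X1} + wcoef (\<sigma> M) {X2} - 2 * wcoef (\<sigma> M) {X3} \<noteq> 0"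
    "wcoef (\<sigma> 0) {X2, X3} + wcoef (\<sigma> 0) {X1, X3} \<noteq> 0 \<Longrightarrow>
      wcoef (\<sigma> M) {X2, X3} + wcoef (\<sigma> M) {X1, X3} \<noteq> 0"
    "cdeg (\<sigma> M) = cdeg (\<sigma> 0)"
    by (auto simp: t_def g_def)
qed

context quadratic
begin

text \<open>The bounds on r as they are applied: chains with \<open>i < N\<close> have already
  cancelled their corner terms, those with \<open>i \<ge> N\<close> have not.\<close>

definition in_package :: "nat \<Rightarrow> int \<Rightarrow> bool"
  where "in_package N r \<longleftrightarrow> 2 \<le> r \<and> r \<le> 2 * int (\<alpha> * N) + 2 \<and> (\<forall>i<N. 2 * int (\<alpha> * i) + 4 \<le> r)"

lemma package_in_package:
  assumes "r \<in> package \<alpha> N"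
  shows "in_package N r"
proof (cases "N = 0")
  case False
  then have r: "2 * (int N - 1) * int \<alpha> + 4 \<le> r" "r \<le> 2 * int N * int \<alpha> + 2"
    using assms by (auto simp: package_def)
  have "int \<alpha> * int i \<le> int \<alpha> * (int N - 1)" if "i < N" for i
    using that by (intro mult_left_mono) auto
  moreover have "0 \<le> int \<alpha> * (int N - 1)" using False by simp
  moreover have "2 * (int N - 1) * int \<alpha> = 2 * (int \<alpha> * (int N - 1))"
    "2 * int N * int \<alpha> = 2 * int (\<alpha> * N)" "int (\<alpha> * i) = int \<alpha> * int i" for i by simp_all
  ultimately show ?thesis using r unfolding in_package_def by (smt (verit))
qed (use assms in \<open>simp add: package_def in_package_def\<close>)

text \<open>This turns out to be the equivalence relation on cycles that defines \<open>E\<^sub>r\<close>.\<close>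

definition agree :: "nat \<Rightarrow> int \<Rightarrow> pvf \<Rightarrow> pvf \<Rightarrow> bool"
  where "agree N p U V \<longleftrightarrow>
    (\<forall>I l m. surv N I l m (p - 1) \<longrightarrow> cf U I l m (p - 1) = cf V I l m (p - 1))"

text \<open>The corner of the chain has filtration degree
  \<open>\<beta> i + 2 \<alpha> i + 3 < p + r\<close>, so \<open>dif a b U\<close> vanishes on the
  chain down to its end.\<close>

lemma cycle_chain:
  assumes U: "U \<in> ssZ (dif a b) r p q" and i: "admissible a b i" and r: "2 * int (\<alpha> * i) + 4 \<le> r"
    and p: "p = \<beta> * int i + 1"
  shows "tc U (int (\<alpha> * i)) (\<beta> * int i) = 0" "gc U (int (\<alpha> * i)) (\<beta> * int i) = 0"
proof -
  have dU: "dif a b U \<in> Kfil (p + r)" using U by (auto simp: ssZ_def)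
  define n0 where "n0 = \<beta> * int i + 2 * int (\<alpha> * i)"
  have "cf (dif a b U) I j j (n0 - 2 * j) = 0" if "-1 \<le> j" for j I
    using r p that by (intro Kfil_cf[OF dU]) (simp add: n0_def)
  moreover have "-1 \<le> int (\<alpha> * i)" by linarith
  ultimately have "tc U (int (\<alpha> * i)) (n0 - 2 * int (\<alpha> * i)) = 0" "gc U (int (\<alpha> * i)) (n0 - 2 * int (\<alpha> * i)) = 0"
    by (rule_tac chain_down; blast)+
  then
  show "tc U (int (\<alpha> * i)) (\<beta> * int i) = 0" "gc U (int (\<alpha> * i)) (\<beta> * int i) = 0"
    by (simp_all add: n0_def)
qed

text \<open>At the resonant start \<open>d'\<close> is 0, so only the part of W one step before the
  start contributes. From there on \<open>dif a b W\<close> vanishes for filtration reasons while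
  the factor of \<open>d'\<close> does not, and the exponent of z eventually drops below -1; so the
  relevant combinations of W are 0.\<close>

lemma boundary_diagonal:
  assumes dW: "dif a b W \<in> Kfil p" and i: "admissible a b i" and p: "p = \<beta> * int i + 1"
  shows "cf (dif a b W) I (int (\<alpha> * i)) (int (\<alpha> * i)) (\<beta> * int i) = 0"
proof -
  define M where "M = int (\<alpha> * i)"
  define n0 where "n0 = \<beta> * int i + 2 * M"
  have M: "0 \<le> M" by (simp add: M_def)
  have rel: "b * of_int M = a * of_int (\<beta> * int i)" using admissible_rel[OF i] by (simp add: M_def)
  have d0: "cf (dif a b W) I j j (n0 - 2 * j) = 0" if "M < j" for j I
    using p that by (intro Kfil_cf[OF dW]) (simp add: n0_def)
  have out: "cf W I j j (n0 - 2 * j) = 0" if "n0 - 2 * j < -1" for j I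
    using that by (intro cf_not_allowed) (auto simp: allowed_def of_bool_def)
  \<comment> \<open>The factor is \<open>(j - M) (2 a + b)\<close>. For \<open>i = 0\<close> the
    exponent of z is below -1 as soon as \<open>j > M\<close>, so only \<open>i > 0\<close>
    remains.\<close>
  have e: "b * of_int j - a * of_int (n0 - 2 * j) \<noteq> 0" if "M < j" "-1 \<le> n0 - 2 * j" for j
  proof -
    have "0 < i" using that by (cases "i = 0") (auto simp: n0_def M_def)
    then have nz: "2 * a + b \<noteq> 0" using admissible_nz[OF i] by simp
    have "b * of_int j - a * of_int (n0 - 2 * j) = (of_int j - of_int M) * (2 * a + b)"
      using rel by (simp add: n0_def algebra_simps)
    then show ?thesis using nz that by simp
  qed
  have eq: "n0 - 2 * j - 2 = n0 - 2 * (j + 1)" for j by simp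
  have up: "f j = 0"
    if "\<And>j. M < j \<Longrightarrow> (b * of_int j - a * of_int (n0 - 2 * j)) * f j = c j * f (j + 1)"
      "\<And>j. n0 - 2 * j < -1 \<Longrightarrow> f j = 0" "M < j" for f c :: "int \<Rightarrow> real" and j
  proof (rule chain_up[of M f "\<bar>n0\<bar> + 1"])
    show "f j = 0" if "M < j" "f (j + 1) = 0" for j
      using \<open>\<And>j. M < j \<Longrightarrow> (b * of_int j - a * of_int (n0 - 2 * j)) * f j = c j * f (j + 1)\<close>[of j]
        \<open>\<And>j. n0 - 2 * j < -1 \<Longrightarrow> f j = 0\<close>[of j] e[of j] that
      by (cases "n0 - 2 * j < -1") auto
    show "f j = 0" if "\<bar>n0\<bar> + 1 < j" for j
      using \<open>\<And>j. n0 - 2 * j < -1 \<Longrightarrow> f j = 0\<close>[of j] that by linarith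
  qed fact
  have A: "cf W {} j j (n0 - 2 * j) = 0" if "M < j" for j
  proof (rule up[where c = "\<lambda>j. - of_int (j + 1)" and f = "\<lambda>j. cf W {} j j (n0 - 2 * j)", OF _ _ that])
    show "(b * of_int j - a * of_int (n0 - 2 * j)) * cf W {} j j (n0 - 2 * j)
      = - of_int (j + 1) * cf W {} (j + 1) (j + 1) (n0 - 2 * (j + 1))" if "M < j" for j
      using d0[OF that, of "{X1}"] unfolding cf_dif eq mult_minus_left of_int_add of_int_1 by linarith
  qed (rule out)
  have D: "cf W {X3} j j (n0 - 2 * j) = 0" if "M < j" for j
  proof (rule up[where c = "\<lambda>j. - of_int (j + 1)" and f = "\<lambda>j. cf W {X3} j j (n0 - 2 * j)", OF _ _ that])
    show "(b * of_int j - a * of_int (n0 - 2 * j)) * cf W {X3} j j (n0 - 2 * j)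
      = - of_int (j + 1) * cf W {X3} (j + 1) (j + 1) (n0 - 2 * (j + 1))" if "M < j" for j
      using d0[OF that, of "{X1, X3}"]
      unfolding cf_dif eq mult_minus_left of_int_add of_int_1 by simp
  qed (rule out)
  have T: "tc W j (n0 - 2 * j) = 0" if "M < j" for j
  proof (rule up[where c = "\<lambda>j. - of_int (j + 2)" and f = "\<lambda>j. tc W j (n0 - 2 * j)", OF _ _ that])
    show "(b * of_int j - a * of_int (n0 - 2 * j)) * tc W j (n0 - 2 * j)
      = - of_int (j + 2) * tc W (j + 1) (n0 - 2 * (j + 1))" if "M < j" for j
      using tc_dif[of a b W j "n0 - 2 * j"] d0[OF that, of "{X1, X2}"] d0[OF that, of "{X2, X3}"]
      unfolding eq mult_minus_left by linarith
  qed (simp add: tc_def out)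
  have G: "gc W j (n0 - 2 * j) = 0" if "M < j" for j
  proof (rule up[where c = "\<lambda>j. - of_int (j + 2)" and f = "\<lambda>j. gc W j (n0 - 2 * j)", OF _ _ that])
    show "(b * of_int j - a * of_int (n0 - 2 * j)) * gc W j (n0 - 2 * j)
      = - of_int (j + 2) * gc W (j + 1) (n0 - 2 * (j + 1))" if "M < j" for j
      using gc_dif[of a b W j "n0 - 2 * j"] d0[OF that, of "{X1, X2, X3}"]
      unfolding eq mult_minus_left by linarith
  qed (simp add: gc_def out)
  have n: "n0 - 2 * (M + 1) = \<beta> * int i - 2" by (simp add: n0_def)
  have A: "cf W {} (M + 1) (M + 1) (\<beta> * int i - 2) = 0"
    and D: "cf W {X3} (M + 1) (M + 1) (\<beta> * int i - 2) = 0"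
    and T: "tc W (M + 1) (\<beta> * int i - 2) = 0" and G: "gc W (M + 1) (\<beta> * int i - 2) = 0"
    using A[of "M + 1"] D[of "M + 1"] T[of "M + 1"] G[of "M + 1"] unfolding n by simp_all
  have T': "cf W {X2} (M + 1) (M + 1) (\<beta> * int i - 2) = - cf W {X1} (M + 1) (M + 1) (\<beta> * int i - 2)"
    using T D by (simp add: tc_def)
  have G': "cf W {X2, X3} (M + 1) (M + 1) (\<beta> * int i - 2) = - cf W {X1, X3} (M + 1) (M + 1) (\<beta> * int i - 2)"
    using G by (simp add: gc_def)
  show ?thesis
    unfolding M_def[symmetric]
    by (cases I rule: coord_set_cases) (simp_all only: cf_dif A D T' G' rel, simp_all add: algebra_simps)
qed

text \<open>The corner value is that of \<open>tc\<close> or \<open>gc\<close> for W at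
  \<open>j = 0\<close>. Vanishing is transported along the chain except across a resonant exponent;
  as nothing is killed here, such an exponent has \<open>i \<ge> N\<close> and lies in a layer too
  low for \<open>W \<in> Kfil (p - r + 1)\<close>.\<close>

lemma boundary_corner:
  assumes W: "W \<in> Kfil (p - r + 1)" and dW: "dif a b W \<in> Kfil p" and r: "in_package N r"
    and nk: "\<not> killed N (p - 1)"
  shows "cf (dif a b W) I (-1) (-1) (p - 1) = 0"
proof -
  \<comment> \<open>Chosen so that \<open>j = -1\<close> is the corner with exponent
    \<open>p - 1\<close> of z.\<close>
  define n0 where "n0 = p - 3"
  have d0: "cf (dif a b W) I j j (n0 - 2 * j) = 0" if "-1 < j" for j I
    using that by (intro Kfil_cf[OF dW]) (simp add: n0_def)
  have out: "cf W I j j (n0 - 2 * j) = 0" if "n0 - 2 * j < -1" for j I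
    using that by (intro cf_not_allowed) (auto simp: allowed_def of_bool_def)
  have e: "cf W I j j (n0 - 2 * j) = 0"
    if j: "-1 < j" and z: "b * of_int j - a * of_int (n0 - 2 * j) = 0" for j I
  proof (cases "n0 - 2 * j < -1")
    case False
    then obtain i where i: "admissible a b i" "j = int (\<alpha> * i)" "n0 - 2 * j = \<beta> * int i"
      using resonant_diagonal[of j "n0 - 2 * j"] z j by auto
    then have "N \<le> i" using nk unfolding killed_def n0_def by (force simp: not_less[symmetric])
    then have "int (\<alpha> * N) \<le> j" unfolding i by (simp only: of_nat_le_iff mult_le_mono2)
    then show ?thesis using r by (intro Kfil_cf[OF W]) (simp add: n0_def in_package_def)
  qed (rule out)
  have eq: "n0 - 2 * j - 2 = n0 - 2 * (j + 1)" for j by simp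
  have T: "tc W 0 (n0 - 2 * 0) = 0"
  proof (rule chain_up[of "-1" "\<lambda>j. tc W j (n0 - 2 * j)" "\<bar>n0\<bar> + 1"])
    show "tc W j (n0 - 2 * j) = 0" if "-1 < j" "tc W (j + 1) (n0 - 2 * (j + 1)) = 0" for j
    proof (cases "b * of_int j - a * of_int (n0 - 2 * j) = 0")
      case True
      then show ?thesis using e[OF that(1)] by (simp add: tc_def)
    next
      case False
      then show ?thesis using tc_dif[of a b W j "n0 - 2 * j"] d0[OF that(1)] that(2) unfolding eq by simp
    qed
    show "tc W j (n0 - 2 * j) = 0" if "\<bar>n0\<bar> + 1 < j" for j
      unfolding tc_def using that by (subst out, linarith)+ simp
  qed simp
  have G: "gc W 0 (n0 - 2 * 0) = 0"
  proof (rule chain_up[of "-1" "\<lambda>j. gc W j (n0 - 2 * j)" "\<bar>n0\<bar> + 1"])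
    show "gc W j (n0 - 2 * j) = 0" if "-1 < j" "gc W (j + 1) (n0 - 2 * (j + 1)) = 0" for j
    proof (cases "b * of_int j - a * of_int (n0 - 2 * j) = 0")
      case True
      then show ?thesis using e[OF that(1)] by (simp add: gc_def)
    next
      case False
      then show ?thesis using gc_dif[of a b W j "n0 - 2 * j"] d0[OF that(1)] that(2) unfolding eq by simp
    qed
    show "gc W j (n0 - 2 * j) = 0" if "\<bar>n0\<bar> + 1 < j" for j
      unfolding gc_def using that by (subst out, linarith)+ simp
  qed simp
  show ?thesis
  proof (cases "{X1, X2} \<subseteq> I")
    case True
    then consider "I = {X1, X2}" | "I = {X1, X2, X3}" by (cases I rule: coord_set_cases) auto
    then show ?thesis
    proof cases
      case 1
      have "cf (dif a b W) {X2, X3} (-1) (-1) (p - 1) = 0"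
        by (rule cf_not_allowed) (simp add: allowed_def)
      then show ?thesis using tc_dif[of a b W "-1" "p - 1"] T 1 by (simp add: tc_edge n0_def)
    next
      case 2
      then show ?thesis using gc_dif[of a b W "-1" "p - 1"] G by (simp add: gc_edge n0_def)
    qed
  next
    case False
    then show ?thesis by (intro cf_not_allowed) (auto simp: allowed_def of_bool_def)
  qed
qed

lemma boundary_surv:
  assumes W: "W \<in> Kfil (p - r + 1)" and dW: "dif a b W \<in> Kfil p" and r: "in_package N r"
    and s: "surv N I l m (p - 1)"
  shows "cf (dif a b W) I l m (p - 1) = 0"
proof -
  have al: "allowed I l m (p - 1)" and res: "resonant l m (p - 1)"
    and nk: "\<not> (l = -1 \<and> m = -1 \<and> killed N (p - 1))" using s by (auto simp: surv_def)
  from al have ge: "-1 \<le> l" "-1 \<le> m" "-1 \<le> p - 1" using allowed_ge by blast+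
  consider i where "admissible a b i" "l = int (\<alpha> * i)" "m = int (\<alpha> * i)" "p - 1 = \<beta> * int i"
    | "l = -1" "m = -1" | "a = b" "p - 1 = -1" "l = -1" "0 \<le> m" | "a = b" "p - 1 = -1" "0 \<le> l" "m = -1"
    using res resonant_iff[OF ge] by auto
  then show ?thesis
  proof cases
    case (1 i)
    then show ?thesis using boundary_diagonal[OF dW 1(1)] by simp
  next
    case 2
    then show ?thesis using boundary_corner[OF W dW r] nk by simp
  next
    case 3
    then show ?thesis unfolding \<open>p - 1 = -1\<close> using al
      by (cases I rule: coord_set_cases) (simp_all add: cf_dif allowed_def cf_not_allowed)
  next
    case 4
    then show ?thesis unfolding \<open>p - 1 = -1\<close> using al
      by (cases I rule: coord_set_cases) (simp_all add: cf_dif allowed_def cf_not_allowed)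
  qed
qed

lemma ssN_imp_agree:
  assumes "U \<in> ssN (dif a b) r p q" and r: "in_package N r"
  shows "agree N p U 0"
proof -
  obtain Z W where U: "U = Z + dif a b W" and Z: "Z \<in> Kfil (p + 1)"
    and W: "W \<in> Kfil (p - (r - 1))" and dW: "dif a b W \<in> Kfil p"
    using assms(1) by (auto simp: ssN_def ssZ_def ssB_def)
  have W: "W \<in> Kfil (p - r + 1)" using W by (simp add: algebra_simps)
  show ?thesis
    unfolding agree_def U using boundary_surv[OF W dW r] Kfil_cf[OF Z] by simp
qed

section \<open>Cochains that realise the cancellations at the corner\<close>

lemma permitted_wcoef:
  assumes "admissible a b i" "permitted a b i w" "\<beta> * int i = -1" "X3 \<notin> I"
  shows "wcoef w I = 0"
proof -
  have "\<beta> * int i < 0" using assms(3) by simp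
  then have "i = 1" "ratio_special a b" using admissible_neg[OF assms(1)] by blast+
  then show ?thesis using assms(2,4)
    by (cases w) (auto simp: permitted_def wcoef_eval)
qed

lemma chain_Kfil:
  assumes "K \<le> \<alpha> * i" "admissible a b i" "permitted a b i (\<sigma> 0)"
  shows "chain a b \<alpha> \<beta> i K \<sigma> \<in> Kfil (\<beta> * int i + 1)"
  unfolding Kfil_iff
proof (intro allI impI)
  fix I and l m n :: int
  assume nz: "cf (chain a b \<alpha> \<beta> i K \<sigma>) I l m n \<noteq> 0"
  have perm: "\<And>I. \<beta> * int i = -1 \<Longrightarrow> X3 \<notin> I \<Longrightarrow> wcoef (\<sigma> 0) I = 0"
    using permitted_wcoef[OF assms(2,3)] by simp
  have "n = \<beta> * int i + 2 * (int (\<alpha> * i) - l) \<and> l \<le> int (\<alpha> * i)"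
    using nz cf_chain[where \<sigma> = \<sigma> and a = a and b = b and I = I and l = l and m = m and n = n,
        OF assms(1) admissible_ge[OF assms(2)] perm]
    by (simp split: if_splits del: of_nat_mult)
  moreover have "n = B + 2 * (A - l) \<and> l \<le> A \<Longrightarrow> B + 1 \<le> n + 1" for A B by presburger
  ultimately show "\<beta> * int i + 1 \<le> n + 1" by blast
qed

lemma zn_nz:
  assumes "admissible a b i"
  shows "zn a b (\<alpha> * i) (\<alpha> * i) \<noteq> 0"
  using admissible_nz[OF assms] by (cases "i = 0") (simp_all add: zn_def)

text \<open>A full chain has its differential concentrated at the corner. The clauses on
  \<open>cdeg\<close> keep the effects of degrees 1 and 2 apart, so that both corner coefficients
  can be prescribed independently.\<close>

lemma killing_chain:
  assumes i: "admissible a b i" and w: "permitted a b i w"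
  obtains W where "W \<in> Kfil (\<beta> * int i + 1)"
    and "\<And>I l m n. cf (dif a b W) I l m n \<noteq> 0 \<Longrightarrow>
      l = -1 \<and> m = -1 \<and> n = \<beta> * int i + 2 * int (\<alpha> * i) + 2"
    and "\<And>l m n. cf (dif a b W) {X1, X2} l m n \<noteq> 0 \<Longrightarrow> cdeg w = 1"
    and "\<And>l m n. cf (dif a b W) {X1, X2, X3} l m n \<noteq> 0 \<Longrightarrow> cdeg w = 2"
    and "wcoef w {X1} + wcoef w {X2} - 2 * wcoef w {X3} \<noteq> 0 \<Longrightarrow>
      cf (dif a b W) {X1, X2} (-1) (-1) (\<beta> * int i + 2 * int (\<alpha> * i) + 2) \<noteq> 0"
    and "wcoef w {X2, X3} + wcoef w {X1, X3} \<noteq> 0 \<Longrightarrow>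
      cf (dif a b W) {X1, X2, X3} (-1) (-1) (\<beta> * int i + 2 * int (\<alpha> * i) + 2) \<noteq> 0"
proof -
  \<comment> \<open>Selecting at level i makes the coefficient conditions hold for all
    \<open>\<alpha> i\<close> steps.\<close>
  obtain sel where sel: "coef_selection a b \<alpha> i sel" using coef_selection_exists by blast
  define \<sigma> where "\<sigma> = sel i w"
  have s0: "\<sigma> 0 = w" and cond: "\<And>k. k < \<alpha> * i \<Longrightarrow> coef_cond (\<alpha> * i) k (\<sigma> k) (\<sigma> (k + 1))"
    using sel i w by (auto simp: coef_selection_def \<sigma>_def)
  have perm: "\<And>I. \<beta> * int i = -1 \<Longrightarrow> X3 \<notin> I \<Longrightarrow> wcoef (\<sigma> 0) I = 0"
    using permitted_wcoef[OF i w] s0 by simp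
  have nz: "0 < \<alpha> * i \<Longrightarrow> 2 * a + b \<noteq> 0" using admissible_nz[OF i] by simp
  define W where "W = chain a b \<alpha> \<beta> i (\<alpha> * i) \<sigma>"
  note dW = cf_dif_chain[where \<sigma> = \<sigma> and a = a and b = b, OF order_refl admissible_ge[OF i] perm admissible_rel[OF i] nz cond,
      folded W_def, simplified]
  have deg: "cdeg (\<sigma> (\<alpha> * i)) = cdeg w" using wcoef_end_nonzero(3)[of "\<alpha> * i" \<sigma>, OF cond] s0 by simp
  have "cdeg w = 1" if "wcoef (\<sigma> (\<alpha> * i)) {X1} + wcoef (\<sigma> (\<alpha> * i)) {X2} - 2 * wcoef (\<sigma> (\<alpha> * i)) {X3} \<noteq> 0"
    using that unfolding deg[symmetric] by (cases "\<sigma> (\<alpha> * i)") (auto simp: wcoef_eval coord_set_eq_iff)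
  moreover have "cdeg w = 2" if "wcoef (\<sigma> (\<alpha> * i)) {X2, X3} + wcoef (\<sigma> (\<alpha> * i)) {X1, X3} \<noteq> 0"
    using that unfolding deg[symmetric] by (cases "\<sigma> (\<alpha> * i)") (auto simp: wcoef_eval coord_set_eq_iff)
  ultimately show ?thesis
    using wcoef_end_nonzero[of "\<alpha> * i" \<sigma>, OF cond] s0 zn_nz[OF i]
    by (intro that[of W])
      (use chain_Kfil[OF order_refl i, of \<sigma>] s0 w in \<open>simp add: W_def\<close>,
        auto simp: dW coord_set_eq_iff split: if_splits)
qed

lemma killing_cochain:
  assumes k: "killed N (p - 1)" and r: "in_package N r" and U: "U \<in> Ktot (p + q)"
  obtains W where "W \<in> Kfil (p - r + 1)" and "dif a b W \<in> Ktot (p + q)"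
    and "\<And>I l m n. cf (dif a b W) I l m n = (if l = -1 \<and> m = -1 \<and> n = p - 1 then cf U I l m n else 0)"
proof -
  obtain i where i: "i < N" "admissible a b i" and p: "p - 1 = \<beta> * int i + 2 * int (\<alpha> * i) + 2"
    using k by (auto simp: killed_def)
  \<comment> \<open>With \<open>D = 1\<close> and \<open>E = 1\<close> the two combinations are -2
    and 1; both data are permitted even if \<open>i = 1\<close> and B, C have to vanish.\<close>
  have perm: "permitted a b i (Co1 0 0 1)" "permitted a b i (Co2 1 0)" by (auto simp: permitted_def)
  have ri: "2 * int (\<alpha> * i) + 4 \<le> r" using r i by (auto simp: in_package_def)
  have n: "\<beta> * int i + 2 * int (\<alpha> * i) + 2 = p - 1" using p by simp
  obtain V where V: "V \<in> Kfil (\<beta> * int i + 1)"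
    "\<And>I l m n. cf (dif a b V) I l m n \<noteq> 0 \<Longrightarrow> l = -1 \<and> m = -1 \<and> n = p - 1"
    "\<And>l m n. cf (dif a b V) {X1, X2, X3} l m n = 0"
    "cf (dif a b V) {X1, X2} (-1) (-1) (p - 1) \<noteq> 0"
  proof (rule killing_chain[OF i(2) perm(1)], unfold n)
    fix V
    assume V: "V \<in> Kfil (\<beta> * int i + 1)"
      "\<And>I l m n. cf (dif a b V) I l m n \<noteq> 0 \<Longrightarrow> l = -1 \<and> m = -1 \<and> n = p - 1"
      "\<And>l m n. cf (dif a b V) {X1, X2, X3} l m n \<noteq> 0 \<Longrightarrow> cdeg (Co1 0 0 1) = 2"
      "wcoef (Co1 0 0 1) {X1} + wcoef (Co1 0 0 1) {X2} - 2 * wcoef (Co1 0 0 1) {X3} \<noteq> 0 \<Longrightarrow>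
        cf (dif a b V) {X1, X2} (-1) (-1) (p - 1) \<noteq> 0"
    have "cf (dif a b V) {X1, X2, X3} l m n = 0" for l m n using V(3)[of l m n] by auto
    moreover have "cf (dif a b V) {X1, X2} (-1) (-1) (p - 1) \<noteq> 0"
      using V(4) by (simp add: wcoef_eval coord_set_eq_iff)
    ultimately show thesis using that V(1,2) by blast
  qed
  obtain V' where V': "V' \<in> Kfil (\<beta> * int i + 1)"
    "\<And>I l m n. cf (dif a b V') I l m n \<noteq> 0 \<Longrightarrow> l = -1 \<and> m = -1 \<and> n = p - 1"
    "\<And>l m n. cf (dif a b V') {X1, X2} l m n = 0"
    "cf (dif a b V') {X1, X2, X3} (-1) (-1) (p - 1) \<noteq> 0"
  proof (rule killing_chain[OF i(2) perm(2)], unfold n)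
    fix V
    assume V: "V \<in> Kfil (\<beta> * int i + 1)"
      "\<And>I l m n. cf (dif a b V) I l m n \<noteq> 0 \<Longrightarrow> l = -1 \<and> m = -1 \<and> n = p - 1"
      "\<And>l m n. cf (dif a b V) {X1, X2} l m n \<noteq> 0 \<Longrightarrow> cdeg (Co2 1 0) = 1"
      "wcoef (Co2 1 0) {X2, X3} + wcoef (Co2 1 0) {X1, X3} \<noteq> 0 \<Longrightarrow>
        cf (dif a b V) {X1, X2, X3} (-1) (-1) (p - 1) \<noteq> 0"
    have "cf (dif a b V) {X1, X2} l m n = 0" for l m n using V(3)[of l m n] by auto
    moreover have "cf (dif a b V) {X1, X2, X3} (-1) (-1) (p - 1) \<noteq> 0"
      using V(4) by (simp add: wcoef_eval coord_set_eq_iff)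
    ultimately show thesis using that V(1,2) by blast
  qed
  define W where "W = cst (cf U {X1, X2} (-1) (-1) (p - 1) / cf (dif a b V) {X1, X2} (-1) (-1) (p - 1)) \<odot> V
    + cst (cf U {X1, X2, X3} (-1) (-1) (p - 1) / cf (dif a b V') {X1, X2, X3} (-1) (-1) (p - 1)) \<odot> V'"
  have cW: "cf (dif a b W) I l m n = (if l = -1 \<and> m = -1 \<and> n = p - 1 then cf U I l m n else 0)" for I l m n
  proof (cases "l = -1 \<and> m = -1 \<and> n = p - 1")
    case True
    show ?thesis
    proof (cases "{X1, X2} \<subseteq> I")
      case I: True
      then have "I = {X1, X2} \<or> I = {X1, X2, X3}" by (cases I rule: coord_set_cases) auto
      then show ?thesis using True V(3,4) V'(3,4) by (auto simp: W_def dif_add dif_cst)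
    next
      case False
      then have "\<not> allowed I l m n" using True by (auto simp: allowed_def of_bool_def)
      then have "cf (dif a b W) I l m n = 0" "cf U I l m n = 0" by (rule cf_not_allowed)+
      then show ?thesis by metis
    qed
  next
    case False
    then have "cf (dif a b V) I l m n = 0" "cf (dif a b V') I l m n = 0" using V(2) V'(2) by blast+
    then show ?thesis unfolding W_def dif_add dif_cst cf_add cf_cst using False by auto
  qed
  show ?thesis
  proof (rule that[OF _ _ cW])
    have "\<beta> * int i + 1 \<ge> p - r + 1" using ri p by simp
    then show "W \<in> Kfil (p - r + 1)" unfolding W_def
      by (intro Kfil_add Kfil_cst Kfil_mono[OF V(1)] Kfil_mono[OF V'(1)])
    show "dif a b W \<in> Ktot (p + q)"
      unfolding Ktot_iff
    proof (intro allI impI)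
      fix I and l m n :: int
      assume "cf (dif a b W) I l m n \<noteq> 0"
      then have "cf U I l m n \<noteq> 0" unfolding cW by metis
      then show "l + m + n + 3 + int (card I) = p + q" using U unfolding Ktot_iff by blast
    qed
  qed
qed

section \<open>Contraction homotopy away from the resonant exponents\<close>

definition contr :: "pvf \<Rightarrow> coord set \<Rightarrow> int \<Rightarrow> int \<Rightarrow> int \<Rightarrow> real \<Rightarrow> real \<Rightarrow> real \<Rightarrow> real"
  where "contr U I l m n k1 k2 k3 =
    (if I = {} then k1 * cf U {X1} l m n + k2 * cf U {X2} l m n + k3 * cf U {X3} l m n
     else if I = {X1} then - k2 * cf U {X1, X2} l m n - k3 * cf U {X1, X3} l m n
     else if I = {X2} then k1 * cf U {X1, X2} l m n - k3 * cf U {X2, X3} l m n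
     else if I = {X3} then k2 * cf U {X2, X3} l m n + k1 * cf U {X1, X3} l m n
     else if I = {X1, X2} then k3 * cf U {X1, X2, X3} l m n
     else if I = {X1, X3} then - k2 * cf U {X1, X2, X3} l m n
     else if I = {X2, X3} then k1 * cf U {X1, X2, X3} l m n else 0)"

lemma contr_eval:
  "contr U {} l m n k1 k2 k3 = k1 * cf U {X1} l m n + k2 * cf U {X2} l m n + k3 * cf U {X3} l m n"
  "contr U {X1} l m n k1 k2 k3 = - k2 * cf U {X1, X2} l m n - k3 * cf U {X1, X3} l m n"
  "contr U {X2} l m n k1 k2 k3 = k1 * cf U {X1, X2} l m n - k3 * cf U {X2, X3} l m n"
  "contr U {X3} l m n k1 k2 k3 = k2 * cf U {X2, X3} l m n + k1 * cf U {X1, X3} l m n"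
  "contr U {X1, X2} l m n k1 k2 k3 = k3 * cf U {X1, X2, X3} l m n"
  "contr U {X1, X3} l m n k1 k2 k3 = - k2 * cf U {X1, X2, X3} l m n"
  "contr U {X2, X3} l m n k1 k2 k3 = k1 * cf U {X1, X2, X3} l m n"
  "contr U {X1, X2, X3} l m n k1 k2 k3 = 0"
  by (simp_all add: contr_def coord_set_eq_iff)

lemma contr_not_allowed:
  assumes "\<not> allowed I l m n" "l < 0 \<Longrightarrow> k1 = 0" "m < 0 \<Longrightarrow> k2 = 0" "n < 0 \<Longrightarrow> k3 = 0"
  shows "contr U I l m n k1 k2 k3 = 0"
  using assms
  by (cases I rule: coord_set_cases)
    (auto simp: contr_eval cf_not_allowed allowed_def not_le)

lemma contr_degree:
  assumes "U \<in> Ktot N" "contr U I l m n k1 k2 k3 \<noteq> 0"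
  shows "l + m + n + 3 + int (card I) = N - 1"
proof (rule ccontr)
  assume neq: "l + m + n + 3 + int (card I) \<noteq> N - 1"
  have z: "cf U J l m n = 0" if "l + m + n + 3 + int (card J) \<noteq> N" for J
    using assms(1) that unfolding Ktot_iff_zero by blast
  have "contr U I l m n k1 k2 k3 = 0"
    using neq by (cases I rule: coord_set_cases) (simp_all add: contr_eval z)
  then show False using assms(2) by simp
qed

text \<open>Wedging with a nonzero vector of constants is exact, with contraction by a dual covector as
  homotopy. The covector below is supported on the coordinates whose exponent is not \<open>-1\<close>, so that
  contraction preserves the condition on the allowed exponents.\<close>

lemma homotopy:
  assumes U: "U \<in> Kfil p" "U \<in> Ktot (p + q)" and dU: "dif a b U \<in> Kfil (p + 1)"
    and res: "\<And>I l m. allowed I l m (p - 1) \<Longrightarrow> resonant l m (p - 1) \<Longrightarrow> cf U I l m (p - 1) = 0"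
  obtains W where "W \<in> Kfil p" "W \<in> Ktot (p + q - 1)" "U - dif a b W \<in> Kfil (p + 1)"
proof -
  define n where "n = p - 1"
  define x1 where "x1 m = b * of_int m - a * of_int n" for m :: int
  define x2 where "x2 l = a * of_int n - b * of_int l" for l :: int
  define x3 where "x3 l m = a * of_int (l - m)" for l m :: int
  \<comment> \<open>The covector is \<open>x / |x|^2\<close>, with the square norm S taken over the
    coordinates of exponent at least 0; it is nonzero off resonance.\<close>
  define S where "S l m = of_bool (0 \<le> l) * (x1 m)\<^sup>2 + of_bool (0 \<le> m) * (x2 l)\<^sup>2 + of_bool (0 \<le> n) * (x3 l m)\<^sup>2" for l m
  define k1 where "k1 l m = of_bool (0 \<le> l) * x1 m / S l m" for l m
  define k2 where "k2 l m = of_bool (0 \<le> m) * x2 l / S l m" for l m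
  define k3 where "k3 l m = of_bool (0 \<le> n) * x3 l m / S l m" for l m
  have S: "S l m \<noteq> 0" if "\<not> resonant l m n" for l m
  proof -
    have "0 \<le> of_bool (0 \<le> l) * (x1 m)\<^sup>2" "0 \<le> of_bool (0 \<le> m) * (x2 l)\<^sup>2" "0 \<le> of_bool (0 \<le> n) * (x3 l m)\<^sup>2"
      by simp_all
    moreover have "0 \<le> l \<and> x1 m \<noteq> 0 \<or> 0 \<le> m \<and> x2 l \<noteq> 0 \<or> 0 \<le> n \<and> x3 l m \<noteq> 0"
      using that a0 by (auto simp: resonant_def x1_def x2_def x3_def)
    then have "0 < of_bool (0 \<le> l) * (x1 m)\<^sup>2 \<or> 0 < of_bool (0 \<le> m) * (x2 l)\<^sup>2 \<or> 0 < of_bool (0 \<le> n) * (x3 l m)\<^sup>2"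
      by auto
    ultimately show ?thesis unfolding S_def by linarith
  qed
  have one: "x1 m * k1 l m + x2 l * k2 l m + x3 l m * k3 l m = 1" if "\<not> resonant l m n" for l m
  proof -
    have "x1 m * k1 l m + x2 l * k2 l m + x3 l m * k3 l m = S l m / S l m"
      unfolding k1_def k2_def k3_def
      by (simp add: add_divide_distrib[symmetric]) (simp add: S_def power2_eq_square algebra_simps)
    then show ?thesis using S[OF that] by simp
  qed
  define W where "W = mkpv (\<lambda>I l m k. if k = n \<and> \<not> resonant l m n then contr U I l m n (k1 l m) (k2 l m) (k3 l m) else 0)"
  have cW: "cf W I l m k = (if k = n \<and> \<not> resonant l m n then contr U I l m n (k1 l m) (k2 l m) (k3 l m) else 0)" for I l m k
    unfolding W_def cf_mkpv
    using contr_not_allowed[of I l m n "k1 l m" "k2 l m" "k3 l m" U]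
    by (auto simp: k1_def k2_def k3_def)
  have WK: "W \<in> Kfil p" unfolding Kfil_iff cW by (auto simp: n_def)
  have WT: "W \<in> Ktot (p + q - 1)"
    unfolding Ktot_iff cW using contr_degree[OF U(2)] by (auto split: if_splits)
  \<comment> \<open>\<open>d''\<close> maps the layer \<open>n - 2\<close> into the layer n. As that
    layer is empty for U and W, only \<open>d'\<close> is seen in the layer n.\<close>
  have U': "cf U I l m (n - 2) = 0" and W': "cf W I l m (n - 2) = 0" for I l m
    using Kfil_cf[OF U(1)] by (simp_all add: cW n_def)
  have dU': "cf (dif a b U) I l m n = 0" for I l m
    by (rule Kfil_cf[OF dU]) (simp add: n_def)
  have "cf U I l m n = cf (dif a b W) I l m n" for I l m
  proof (cases "resonant l m n")
    case True
    then have "cf U I l m n = 0" using res cf_not_allowed unfolding n_def by blast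
    moreover have "cf (dif a b W) I l m n = 0"
      using True by (cases I rule: coord_set_cases) (simp_all add: cf_dif W' cW)
    ultimately show ?thesis by simp
  next
    case False
    note id = contraction_identities[OF one[OF False]]
    have x: "b * of_int m - a * of_int n = x1 m" "a * of_int n - b * of_int l = x2 l"
      "a * of_int (l - m) = x3 l m" by (simp_all add: x1_def x2_def x3_def)
    have x3: "a * (of_int l - of_int m) = x3 l m" by (simp add: x3_def)
    have cW: "cf W I l m n = contr U I l m n (k1 l m) (k2 l m) (k3 l m)" for I
      using False by (simp add: cW)
    note cd = cf_dif[where l = l and m = m and n = n, unfolded of_int_diff]
    have e: "x1 m * cf U {} l m n = 0" "x2 l * cf U {} l m n = 0" "x3 l m * cf U {} l m n = 0"
      "x1 m * cf U {X2} l m n - x2 l * cf U {X1} l m n = 0"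
      "x1 m * cf U {X3} l m n - x3 l m * cf U {X1} l m n = 0"
      "x2 l * cf U {X3} l m n - x3 l m * cf U {X2} l m n = 0"
      "x1 m * cf U {X2, X3} l m n - x2 l * cf U {X1, X3} l m n + x3 l m * cf U {X1, X2} l m n = 0"
      using dU'[of "{X1}" l m] dU'[of "{X2}" l m] dU'[of "{X3}" l m] dU'[of "{X1, X2}" l m]
        dU'[of "{X1, X3}" l m] dU'[of "{X2, X3}" l m] dU'[of "{X1, X2, X3}" l m]
      unfolding cd x x3 U' by simp_all
    have "cf (dif a b W) I l m n = cf U I l m n"
    proof (cases I rule: coord_set_cases)
      case 1
      show ?thesis unfolding 1 cd using id(1)[OF e(1-3)] by simp
    next
      case 2
      show ?thesis unfolding 2 cd x x3 W' cW contr_eval using id(2)[OF e(4,5)] by simp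
    next
      case 3
      show ?thesis unfolding 3 cd x x3 W' cW contr_eval using id(3)[OF e(4,6)] by simp
    next
      case 4
      show ?thesis unfolding 4 cd x x3 W' cW contr_eval using id(4)[OF e(5,6)] by simp
    next
      case 5
      show ?thesis unfolding 5 cd x x3 W' cW contr_eval using id(5)[OF e(7)] by simp
    next
      case 6
      show ?thesis unfolding 6 cd x x3 W' cW contr_eval using id(6)[OF e(7)] by simp
    next
      case 7
      show ?thesis unfolding 7 cd x x3 W' cW contr_eval using id(7)[OF e(7)] by simp
    next
      case 8
      show ?thesis unfolding 8 cd x x3 W' cW contr_eval using id(8)[of "cf U {X1, X2, X3} l m n"] by simp
    qed
    then show ?thesis by simp
  qed
  moreover have "U - dif a b W \<in> Kfil p" using Kfil_diff[OF U(1) dif_Kfil[OF WK]] .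
  ultimately have "U - dif a b W \<in> Kfil (p + 1)"
    unfolding Kfil_iff by (auto simp: n_def) (smt (verit, best))
  then show ?thesis using that WK WT by blast
qed

text \<open>A boundary from \<open>K_(p-r+1)\<close> removes the killed corner terms; the other
  resonant coefficients of the leading layer are 0 by assumption, so the homotopy removes the rest
  of it by a boundary from \<open>K_p\<close>. The remainder is a cycle in
  \<open>K_(p+1)\<close>.\<close>

lemma agree_imp_ssN:
  assumes U: "U \<in> ssZ (dif a b) r p q" and r: "in_package N r" and ag: "agree N p U 0"
  shows "U \<in> ssN (dif a b) r p q"
proof -
  have UK: "U \<in> Kfil p" and dU: "dif a b U \<in> Kfil (p + r)" and UT: "U \<in> Ktot (p + q)"
    using U by (auto simp: ssZ_def)
  have r2: "2 \<le> r" using r by (simp add: in_package_def)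
  obtain W where W: "W \<in> Kfil (p - r + 1)" "dif a b W \<in> Ktot (p + q)"
    and cW: "\<And>I l m n. cf (dif a b W) I l m n =
      (if l = -1 \<and> m = -1 \<and> n = p - 1 \<and> killed N (p - 1) then cf U I l m n else 0)"
  proof (cases "killed N (p - 1)")
    case True
    then show ?thesis using killing_cochain[OF True r UT] that by auto
  next
    case False
    then show ?thesis using that[of 0] by (simp add: Kfil_0 Ktot_0 dif_0)
  qed
  define U1 where "U1 = U - dif a b W"
  have WK: "dif a b W \<in> Kfil p" unfolding Kfil_iff cW by auto
  have dU1: "dif a b U1 = dif a b U" by (simp add: U1_def dif_diff dif_dif)
  have U1: "U1 \<in> Kfil p" "U1 \<in> Ktot (p + q)"
    using Kfil_diff[OF UK WK] Ktot_diff[OF UT W(2)] by (auto simp: U1_def)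
  have "cf U1 I l m (p - 1) = 0" if "allowed I l m (p - 1)" "resonant l m (p - 1)" for I l m
    using ag that unfolding agree_def surv_def by (auto simp: U1_def cW)
  moreover have "dif a b U1 \<in> Kfil (p + 1)" unfolding dU1 by (rule Kfil_mono[OF dU]) (use r2 in simp)
  ultimately obtain V where V: "V \<in> Kfil p" "V \<in> Ktot (p + q - 1)" "U1 - dif a b V \<in> Kfil (p + 1)"
    using homotopy[OF U1] by blast
  have "dif a b V \<in> Ktot (p + q)" using dif_Ktot[OF V(2)] by simp
  then have "U1 - dif a b V \<in> ssZ (dif a b) (r - 1) (p + 1) (q - 1)"
    unfolding ssZ_def using V(3) Ktot_diff[OF U1(2)] dU by (simp add: dif_diff dif_dif dU1)
  moreover have "dif a b (W + V) \<in> ssB (dif a b) (r - 1) p q"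
  proof -
    have "W + V \<in> Kfil (p - (r - 1))" using W(1) V(1) r2
      by (intro Kfil_add) (auto intro: Kfil_mono simp: algebra_simps)
    moreover have "dif a b (W + V) \<in> Kfil p \<inter> Ktot (p + q)"
      using WK W(2) dif_Kfil[OF V(1)] \<open>dif a b V \<in> Ktot (p + q)\<close>
      by (auto simp: dif_add intro: Kfil_add Ktot_add)
    ultimately show ?thesis by (auto simp: ssB_def)
  qed
  moreover have "U = (U1 - dif a b V) + dif a b (W + V)" by (simp add: U1_def dif_add)
  ultimately show ?thesis unfolding ssN_def by blast
qed

end

section \<open>The listed representatives\<close>

lemma wcoef_table:
  "wcoef (Co0 A) {} = A" "wcoef (Co0 A) {X1} = 0" "wcoef (Co0 A) {X2} = 0"
  "wcoef (Co0 A) {X3} = 0" "wcoef (Co0 A) {X1, X3} = 0" "wcoef (Co0 A) {X2, X3} = 0"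
  "wcoef (Co1 B C D) {} = 0" "wcoef (Co1 B C D) {X1} = B" "wcoef (Co1 B C D) {X2} = C"
  "wcoef (Co1 B C D) {X3} = D" "wcoef (Co1 B C D) {X1, X3} = 0" "wcoef (Co1 B C D) {X2, X3} = 0"
  "wcoef (Co2 E F) {} = 0" "wcoef (Co2 E F) {X1} = 0" "wcoef (Co2 E F) {X2} = 0"
  "wcoef (Co2 E F) {X3} = 0" "wcoef (Co2 E F) {X1, X3} = - F" "wcoef (Co2 E F) {X2, X3} = E"
  by (simp_all add: wcoef_eval coord_set_eq_iff)

lemma wcoef_card: "wcoef w I \<noteq> 0 \<Longrightarrow> card I = cdeg w"
  by (cases w) (auto simp: wcoef_eval split: if_splits)

lemma wcoef_inj:
  assumes "cdeg w = cdeg w'" and "\<And>I. wcoef w I = wcoef w' I"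
  shows "w = w'"
  using assms(1) assms(2)[of "{}"] assms(2)[of "{X1}"] assms(2)[of "{X2}"] assms(2)[of "{X3}"]
    assms(2)[of "{X2, X3}"] assms(2)[of "{X1, X3}"]
  by (cases w; cases w') (simp_all add: wcoef_eval coord_set_eq_iff)

lemma wcoef_12: "{X1, X2} \<subseteq> I \<Longrightarrow> wcoef w I = 0"
  by (cases I rule: coord_set_cases) (auto simp: wcoef_cases)

lemma cdeg_closed_seq: "cdeg (closed_seq w k) = cdeg w"
  by (cases w) auto

lemma closed_seq_cong: "closed_seq w 0 = closed_seq w' 0 \<Longrightarrow> closed_seq w = closed_seq w'"
  by (rule ext) (cases w; cases w'; simp)

context quadratic
begin

definition rseq :: "nat \<Rightarrow> (nat \<Rightarrow> coef \<Rightarrow> nat \<Rightarrow> coef) \<Rightarrow> nat \<Rightarrow> coef \<Rightarrow> nat \<Rightarrow> coef"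
  where "rseq N sel i w = (if N \<le> i then sel i w else closed_seq w)"

definition rlen :: "nat \<Rightarrow> nat \<Rightarrow> nat"
  where "rlen N i = (if N \<le> i then \<alpha> * N else \<alpha> * i)"

lemma rep1_eq_chain: "rep1 a b \<alpha> \<beta> N sel i w = chain a b \<alpha> \<beta> i (rlen N i) (rseq N sel i w)"
  by (simp add: rep1_def rseq_def rlen_def closed_form_eq_chain) (simp add: chain_def)

lemma rlen_le: "rlen N i \<le> \<alpha> * i"
  by (simp add: rlen_def)

context
  fixes N :: nat and sel and i :: nat and w :: coef
  assumes sel: "coef_selection a b \<alpha> N sel" and i: "admissible a b i" and w: "permitted a b i w"
begin

lemma rseq_cond: "k < rlen N i \<Longrightarrow> coef_cond (\<alpha> * i) k (rseq N sel i w k) (rseq N sel i w (k + 1))"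
  using sel i w coef_cond_closed_seq
  by (auto simp: rlen_def rseq_def coef_selection_def split: if_splits)

lemma rseq_0: "rseq N sel i w 0 = (if N \<le> i then w else closed_seq w 0)"
  using sel i w by (auto simp: rseq_def coef_selection_def)

lemma rseq_permitted: "permitted a b i (rseq N sel i w 0)"
  unfolding rseq_0 using w by (cases w) (auto simp: permitted_def)

lemma rseq_perm: "\<beta> * int i = -1 \<Longrightarrow> X3 \<notin> I \<Longrightarrow> wcoef (rseq N sel i w 0) I = 0"
  by (rule permitted_wcoef[OF i rseq_permitted])

lemma rseq_cdeg: "k \<le> rlen N i \<Longrightarrow> cdeg (rseq N sel i w k) = cdeg w"
proof (induction k)
  case 0
  then show ?case by (simp add: rseq_0 cdeg_closed_seq)
next
  case (Suc k)
  then show ?case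
    using coef_cond_wcoef(5)[OF rseq_cond[of k]] rlen_le[of N i] by simp
qed

lemma cf_rep1:
  "cf (rep1 a b \<alpha> \<beta> N sel i w) I l m n =
    (if m = l \<and> n = \<beta> * int i + 2 * (int (\<alpha> * i) - l) \<and> l \<le> int (\<alpha> * i)
        \<and> int (\<alpha> * i) - int (rlen N i) \<le> l
     then zn a b (\<alpha> * i) (nat (int (\<alpha> * i) - l)) * wcoef (rseq N sel i w (nat (int (\<alpha> * i) - l))) I else 0)"
  unfolding rep1_eq_chain by (rule cf_chain[OF rlen_le admissible_ge[OF i]]) (rule rseq_perm)

lemma cf_rep1_leading:
  "cf (rep1 a b \<alpha> \<beta> N sel i w) I l m (\<beta> * int i) =
    (if l = int (\<alpha> * i) \<and> m = int (\<alpha> * i) then wcoef (rseq N sel i w 0) I else 0)"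
  by (auto simp: cf_rep1 zn_def simp del: of_nat_mult)

lemma rep1_Kfil: "rep1 a b \<alpha> \<beta> N sel i w \<in> Kfil (\<beta> * int i + 1)"
  unfolding rep1_eq_chain by (rule chain_Kfil[where \<sigma> = "rseq N sel i w", OF rlen_le i rseq_permitted])

lemma rep1_Ktot: "rep1 a b \<alpha> \<beta> N sel i w \<in> Ktot (\<beta> * int i + 1 + int (2 * \<alpha> * i + 2 + cdeg w))"
  unfolding Ktot_iff
proof (intro allI impI)
  fix I and l m n :: int
  assume nz: "cf (rep1 a b \<alpha> \<beta> N sel i w) I l m n \<noteq> 0"
  define M where "M = int (\<alpha> * i)"
  have 1: "m = l" "n = \<beta> * int i + 2 * (M - l)" "l \<le> M" "M - int (rlen N i) \<le> l"
    "wcoef (rseq N sel i w (nat (M - l))) I \<noteq> 0"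
    using nz unfolding cf_rep1 M_def[symmetric] by (auto split: if_splits)
  then have "nat (M - l) \<le> rlen N i" by linarith
  then have "card I = cdeg w" using wcoef_card[OF 1(5)] rseq_cdeg by simp
  then show "l + m + n + 3 + int (card I) = \<beta> * int i + 1 + int (2 * \<alpha> * i + 2 + cdeg w)"
    using 1(1,2) by (simp add: M_def)
qed

text \<open>For \<open>i < N\<close> the closed form is a cocycle; for \<open>i \<ge> N\<close> the
  sum breaks off after \<open>\<alpha> N\<close> steps, and its differential lies
  \<open>2 \<alpha> N + 2 \<ge> r\<close> levels higher.\<close>

lemma dif_rep1_Kfil:
  assumes r: "in_package N r"
  shows "dif a b (rep1 a b \<alpha> \<beta> N sel i w) \<in> Kfil (\<beta> * int i + 1 + r)"
proof -
  have nz: "0 < rlen N i \<Longrightarrow> 2 * a + b \<noteq> 0"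
    using admissible_nz[OF i] rlen_le[of N i] by (cases "i = 0") auto
  have d: "cf (dif a b (rep1 a b \<alpha> \<beta> N sel i w)) I l m n =
    (if m = l \<and> l = int (\<alpha> * i) - int (rlen N i) - 1 \<and> n = \<beta> * int i + 2 * int (rlen N i) + 2
     then zn a b (\<alpha> * i) (rlen N i) *
       end_coef (real (\<alpha> * i) - real (rlen N i)) (rseq N sel i w (rlen N i)) I else 0)" for I l m n
    unfolding rep1_eq_chain
    by (rule cf_dif_chain[OF rlen_le admissible_ge[OF i] rseq_perm admissible_rel[OF i] nz rseq_cond])
  show ?thesis
    unfolding Kfil_iff
  proof (intro allI impI)
    fix I and l m n :: int
    assume nz: "cf (dif a b (rep1 a b \<alpha> \<beta> N sel i w)) I l m n \<noteq> 0"
    then have n: "n = \<beta> * int i + 2 * int (rlen N i) + 2"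
      and e: "end_coef (real (\<alpha> * i) - real (rlen N i)) (rseq N sel i w (rlen N i)) I \<noteq> 0"
      unfolding d by (auto split: if_splits simp del: end_coef.simps)
    have "N \<le> i"
      using e end_coef_closed_seq[of w "\<alpha> * i" I]
      by (cases "N \<le> i") (simp_all add: rseq_def rlen_def del: end_coef.simps)
    then have "rlen N i = \<alpha> * N" by (simp add: rlen_def)
    then show "\<beta> * int i + 1 + r \<le> n + 1" using r n by (simp add: in_package_def)
  qed
qed

end

lemma type1_index_unique:
  assumes "(i, c) \<in> type1_index a b \<alpha> \<beta> p q"
  shows "type1_index a b \<alpha> \<beta> p q = {(i, c)}"
proof -
  have "i' = i \<and> c' = c" if "(i', c') \<in> type1_index a b \<alpha> \<beta> p q" for i' c'
  proof -
    have i': "admissible a b i'" "p = \<beta> * int i' + 1" "q = int (2 * \<alpha> * i' + 2 + c')"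
      and i: "admissible a b i" "p = \<beta> * int i + 1" "q = int (2 * \<alpha> * i + 2 + c)"
      using that assms by (simp_all add: type1_index_def)
    have "\<beta> * int i' = \<beta> * int i" using i'(2) i(2) by linarith
    then have "i' = i" by (rule admissible_beta_inj[OF i'(1) i(1)])
    then show ?thesis using i(3) i'(3) by (simp only: of_nat_eq_iff add_left_cancel simp_thms)
  qed
  then have "type1_index a b \<alpha> \<beta> p q \<subseteq> {(i, c)}" by (metis insertI1 subrelI)
  then show ?thesis using assms by blast
qed

lemma type1_cases:
  assumes "U \<in> type1 a b \<alpha> \<beta> N sel p q"
  obtains "type1_index a b \<alpha> \<beta> p q = {}" "U = 0"
  | i w where "type1_index a b \<alpha> \<beta> p q = {(i, cdeg w)}" "permitted a b i w"
    "U = rep1 a b \<alpha> \<beta> N sel i w"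
proof (cases "type1_index a b \<alpha> \<beta> p q = {}")
  case True
  then show ?thesis using assms that(1) by (auto simp: type1_def)
next
  case False
  then obtain i c where "(i, c) \<in> type1_index a b \<alpha> \<beta> p q" by auto
  then have ix: "type1_index a b \<alpha> \<beta> p q = {(i, c)}" by (rule type1_index_unique)
  then obtain w where "U = rep1 a b \<alpha> \<beta> N sel i (w i c)" "cdeg (w i c) = c" "permitted a b i (w i c)"
    using assms by (auto simp: type1_def)
  then show ?thesis using that(2) ix by metis
qed

lemma type1_memI:
  assumes "type1_index a b \<alpha> \<beta> p q = {(i, cdeg w)}" "permitted a b i w"
  shows "rep1 a b \<alpha> \<beta> N sel i w \<in> type1 a b \<alpha> \<beta> N sel p q"
  unfolding type1_def assms(1) using assms(2)
  by (auto intro!: exI[of _ "\<lambda>_ _. w"])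

lemma type1_memI_0: "type1_index a b \<alpha> \<beta> p q = {} \<Longrightarrow> 0 \<in> type1 a b \<alpha> \<beta> N sel p q"
  by (auto simp: type1_def)

text \<open>\<open>d'\<close> vanishes by resonance. \<open>d''\<close> gives 0 on multiples of
  \<open>Y12\<close> and \<open>Y123\<close>, and on the edge terms its factor \<open>m + 2\<close>
  or \<open>l + 2\<close> is 0 where the shifted exponent is -1.\<close>

lemma type2_cocycle:
  assumes "T \<in> type2 a b \<alpha> \<beta> N"
  shows "dif a b T = 0"
proof -
  have sl: "cf T I l m n \<noteq> 0 \<Longrightarrow> allowed I l m n \<and> resonant l m n \<and> (0 \<le> l \<and> 0 \<le> m \<longrightarrow> {X1, X2} \<subseteq> I)" for I l m n
    using type2_imp_slot2[OF assms] by (simp add: slot2_def surv_def)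
  have z: "cf T {} l m n = 0" "cf T {X1} l m n = 0" "cf T {X2} l m n = 0" "cf T {X3} l m n = 0" for l m n
    using sl[of "{}" l m n] sl[of "{X1}" l m n] sl[of "{X2}" l m n] sl[of "{X3}" l m n]
    by (auto simp: allowed_def resonant_def)
  have G: "(of_int l - of_int m) * cf T {X1, X2} l m n = 0" for l m n
    using sl[of "{X1, X2}" l m n] by (auto simp: allowed_def resonant_def)
  have E: "(b * of_int m - a * of_int n) * cf T {X2, X3} l m n = 0" "(of_int m + 2) * cf T {X2, X3} l (m + 1) n = 0" for l m n
    using sl[of "{X2, X3}" l m n] sl[of "{X2, X3}" l "m + 1" n] by (auto simp: allowed_def resonant_def)
  have F: "(a * of_int n - b * of_int l) * cf T {X1, X3} l m n = 0" "(of_int l + 2) * cf T {X1, X3} (l + 1) m n = 0" for l m n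
    using sl[of "{X1, X3}" l m n] sl[of "{X1, X3}" "l + 1" m n] by (auto simp: allowed_def resonant_def)
  show ?thesis
  proof (rule pvf_eqI)
    fix I l m n
    show "cf (dif a b T) I l m n = cf 0 I l m n"
    proof (cases I rule: coord_set_cases)
      case 8
      show ?thesis
        unfolding 8 cf_dif by (simp only: mult.assoc of_int_diff of_int_add of_int_numeral E F G) simp
    qed (simp_all add: cf_dif z)
  qed
qed

lemma resonant_slot:
  assumes "surv N I l m n" "\<not> slot2 N I l m n"
  obtains i where "admissible a b i" "l = int (\<alpha> * i)" "m = int (\<alpha> * i)" "n = \<beta> * int i"
    "\<not> {X1, X2} \<subseteq> I"
proof -
  have "0 \<le> l" "0 \<le> m" and I: "\<not> {X1, X2} \<subseteq> I" using assms by (auto simp: slot2_def)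
  then show ?thesis
    using assms(1) resonant_iff[of l m n] allowed_ge[of I l m n] that by (auto simp: surv_def)
qed

text \<open>Leading terms of type 1 lie on the diagonal and contain no \<open>Y12\<close>, so they
  miss all positions of type 2.\<close>

lemma type1_slot2:
  assumes sel: "coef_selection a b \<alpha> N sel" and U: "U \<in> type1 a b \<alpha> \<beta> N sel p q"
    and s: "slot2 N I l m (p - 1)"
  shows "cf U I l m (p - 1) = 0"
  using U
proof (cases rule: type1_cases)
  case (2 i w)
  then have "(i, cdeg w) \<in> type1_index a b \<alpha> \<beta> p q" by simp
  then have i: "admissible a b i" and p: "p - 1 = \<beta> * int i" by (auto simp: type1_index_def)
  show ?thesis
    using s wcoef_12[of I] unfolding p 2(3) cf_rep1_leading[OF sel i 2(2)] slot2_def by auto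
qed simp

lemma reps_subset:
  assumes sel: "coef_selection a b \<alpha> N sel" and r: "in_package N r"
  shows "reps a b \<alpha> \<beta> N sel p q \<subseteq> ssZ (dif a b) r p q"
proof
  fix V assume "V \<in> reps a b \<alpha> \<beta> N sel p q"
  then obtain T U where V: "V = T + U" and T: "T \<in> type2 a b \<alpha> \<beta> N" "T \<in> PP q p"
    and U: "U \<in> type1 a b \<alpha> \<beta> N sel p q" by (auto simp: reps_def)
  have "U \<in> Kfil p \<and> U \<in> Ktot (p + q) \<and> dif a b U \<in> Kfil (p + r)"
    using U
  proof (cases rule: type1_cases)
    case 1
    then show ?thesis by (simp add: Kfil_0 Ktot_0 dif_0)
  next
    case (2 i w)
    then have "(i, cdeg w) \<in> type1_index a b \<alpha> \<beta> p q" by simp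
    then have i: "admissible a b i" and p: "p = \<beta> * int i + 1" and q: "q = int (2 * \<alpha> * i + 2 + cdeg w)"
      by (auto simp: type1_index_def)
    show ?thesis
      unfolding 2(3) p q using rep1_Kfil[OF sel i 2(2)] rep1_Ktot[OF sel i 2(2)] dif_rep1_Kfil[OF sel i 2(2) r] by simp
  qed
  then show "V \<in> ssZ (dif a b) r p q"
    unfolding V ssZ_def using PP_subset_Kfil[OF T(2)] PP_subset_Ktot[OF T(2)] type2_cocycle[OF T(1)]
    by (simp add: dif_add Kfil_add Ktot_add)
qed

text \<open>The surviving positions of type 2 recover T, the other ones the coefficients at
  \<open>k = 0\<close>; the selection makes the later coefficients a function of these.\<close>

lemma reps_agree_imp_eq:
  assumes sel: "coef_selection a b \<alpha> N sel"
    and V: "V \<in> reps a b \<alpha> \<beta> N sel p q" and V': "V' \<in> reps a b \<alpha> \<beta> N sel p q"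
    and ag: "agree N p V V'"
  shows "V = V'"
proof -
  obtain T U where VE: "V = T + U" and T: "T \<in> type2 a b \<alpha> \<beta> N" "T \<in> PP q p"
    and U: "U \<in> type1 a b \<alpha> \<beta> N sel p q" using V by (auto simp: reps_def)
  obtain T' U' where VE': "V' = T' + U'" and T': "T' \<in> type2 a b \<alpha> \<beta> N" "T' \<in> PP q p"
    and U': "U' \<in> type1 a b \<alpha> \<beta> N sel p q" using V' by (auto simp: reps_def)
  have "T = T'"
  proof (rule pvf_eqI)
    fix I l m n
    show "cf T I l m n = cf T' I l m n"
    proof (cases "n = p - 1 \<and> slot2 N I l m n")
      case True
      then have n: "n = p - 1" and s: "slot2 N I l m (p - 1)" by auto
      have "cf V I l m (p - 1) = cf V' I l m (p - 1)" using ag s unfolding agree_def slot2_def by blast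
      then show ?thesis
        using type1_slot2[OF sel U s] type1_slot2[OF sel U' s] unfolding VE VE' n cf_add by simp
    next
      case False
      have "cf S I l m n = 0" if S: "S \<in> type2 a b \<alpha> \<beta> N" "S \<in> PP q p" for S
      proof (rule ccontr)
        assume nz: "cf S I l m n \<noteq> 0"
        then have "n + 1 = p" using S(2) unfolding PP_iff by blast
        then have "n = p - 1" by simp
        then show False using False type2_imp_slot2[OF S(1) nz] by blast
      qed
      then show ?thesis using T T' by simp
    qed
  qed
  moreover have "U = U'"
    using U
  proof (cases rule: type1_cases)
    case 1
    from U' show ?thesis by (cases rule: type1_cases) (use 1 in auto)
  next
    case (2 i w)
    from U' obtain w' where w': "cdeg w' = cdeg w" "permitted a b i w'" "U' = rep1 a b \<alpha> \<beta> N sel i w'"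
      by (cases rule: type1_cases) (use 2 in auto)
    have "(i, cdeg w) \<in> type1_index a b \<alpha> \<beta> p q" using 2 by simp
    then have i: "admissible a b i" and p: "p - 1 = \<beta> * int i" by (auto simp: type1_index_def)
    have "wcoef (rseq N sel i w 0) I = wcoef (rseq N sel i w' 0) I" for I
    proof (cases "{X1, X2} \<subseteq> I")
      case False
      show ?thesis
      proof (cases "allowed I (int (\<alpha> * i)) (int (\<alpha> * i)) (\<beta> * int i)")
        case True
        then have sv: "surv N I (int (\<alpha> * i)) (int (\<alpha> * i)) (p - 1)"
          using resonant_admissible[OF i] int_zle_neg[of "\<alpha> * i" 1] unfolding surv_def p by force
        have "cf V I (int (\<alpha> * i)) (int (\<alpha> * i)) (p - 1) = cf V' I (int (\<alpha> * i)) (int (\<alpha> * i)) (p - 1)"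
          using ag sv by (simp add: agree_def)
        then show ?thesis
          using \<open>T = T'\<close> unfolding VE VE' 2(3) w'(3) p
          by (simp add: cf_rep1_leading[OF sel i 2(2)] cf_rep1_leading[OF sel i w'(2)] del: of_nat_mult)
      next
        case False
        then show ?thesis
          using cf_rep1_leading[OF sel i 2(2), of I "int (\<alpha> * i)" "int (\<alpha> * i)"]
            cf_rep1_leading[OF sel i w'(2), of I "int (\<alpha> * i)" "int (\<alpha> * i)"]
          by (simp add: cf_not_allowed del: of_nat_mult)
      qed
    qed (simp add: wcoef_12)
    then have "rseq N sel i w 0 = rseq N sel i w' 0"
      using rseq_cdeg[OF sel i 2(2), of 0] rseq_cdeg[OF sel i w'(2), of 0] w'(1) by (intro wcoef_inj) simp_all
    \<comment> \<open>For \<open>i < N\<close> the data themselves may differ, since closed forms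
      ignore D and F; equality of the sequences suffices.\<close>
    then have "rseq N sel i w = rseq N sel i w'"
      using rseq_0[OF sel i 2(2)] rseq_0[OF sel i w'(2)] closed_seq_cong[of w w']
      by (cases "N \<le> i") (auto simp: rseq_def)
    then show ?thesis using 2(3) w'(3) by (simp add: rep1_eq_chain)
  qed
  ultimately show ?thesis by (simp add: VE VE')
qed

text \<open>The datum is read off the leading coefficients. For \<open>i < N\<close> the cycle
  condition already gives \<open>D = (B + C)/2\<close> and \<open>E = F\<close>, so the smaller
  family of closed forms is enough.\<close>

lemma cycle_datum:
  assumes V: "V \<in> ssZ (dif a b) r p q" and r: "in_package N r" and ic: "(i, c) \<in> type1_index a b \<alpha> \<beta> p q"
  obtains w where "cdeg w = c" "permitted a b i w"
    "\<And>I. \<not> {X1, X2} \<subseteq> I \<Longrightarrow> wcoef (if N \<le> i then w else closed_seq w 0) I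
       = cf V I (int (\<alpha> * i)) (int (\<alpha> * i)) (\<beta> * int i)"
proof -
  define M where "M = int (\<alpha> * i)"
  define n where "n = \<beta> * int i"
  have i: "admissible a b i" and c: "c \<le> 2" and q: "q = int (2 * \<alpha> * i + 2 + c)" and p: "p = \<beta> * int i + 1"
    using ic by (auto simp: type1_index_def)
  define w where "w = (if c = 0 then Co0 (cf V {} M M n)
    else if c = 1 then Co1 (cf V {X1} M M n) (cf V {X2} M M n) (cf V {X3} M M n)
    else Co2 (cf V {X2, X3} M M n) (- cf V {X1, X3} M M n))"
  have VT: "V \<in> Ktot (p + q)" using V by (simp add: ssZ_def)
  have deg: "cf V I M M n = 0" if "card I \<noteq> c" for I
    using VT that unfolding Ktot_iff_zero p q M_def n_def by simp
  have tg: "cf V {X3} M M n = (cf V {X1} M M n + cf V {X2} M M n) / 2" "cf V {X1, X3} M M n = - cf V {X2, X3} M M n"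
    if "i < N"
  proof -
    have "2 * int (\<alpha> * i) + 4 \<le> r" using r that by (simp add: in_package_def)
    from cycle_chain[OF V i this p]
    show "cf V {X3} M M n = (cf V {X1} M M n + cf V {X2} M M n) / 2" "cf V {X1, X3} M M n = - cf V {X2, X3} M M n"
      by (simp_all add: tc_def gc_def M_def n_def)
  qed
  have "c = 0 \<or> c = 1 \<or> c = 2" using c by auto
  then have "cdeg w = c" by (auto simp: w_def)
  moreover have "permitted a b i w"
  proof (cases "i = 1 \<and> ratio_special a b")
    case True
    then have "n = -1" using ratio_specialD by (simp add: n_def)
    then have "cf V {} M M n = 0" "cf V {X1} M M n = 0" "cf V {X2} M M n = 0"
      by (auto intro!: cf_not_allowed simp: allowed_def)
    then show ?thesis by (simp add: permitted_def w_def)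
  qed (auto simp: permitted_def)
  moreover have "wcoef (if N \<le> i then w else closed_seq w 0) I = cf V I M M n" if "\<not> {X1, X2} \<subseteq> I" for I
    using \<open>c = 0 \<or> c = 1 \<or> c = 2\<close> that tg deg[of I]
    by (cases I rule: coord_set_cases) (auto simp: w_def wcoef_table)
  ultimately show ?thesis using that by (simp add: M_def n_def)
qed

text \<open>Only the layer \<open>n = p - 1\<close> of V is reproduced, T taking the positions of
  type 2 and U the remaining diagonal ones; the higher layers of U are dictated by
  \<open>rep1\<close>.\<close>

lemma reps_exhaust:
  assumes sel: "coef_selection a b \<alpha> N sel" and r: "in_package N r" and V: "V \<in> ssZ (dif a b) r p q"
  obtains R where "R \<in> reps a b \<alpha> \<beta> N sel p q" "agree N p V R"
proof -
  define T where "T = mkpv (\<lambda>I l m n. if n = p - 1 \<and> slot2 N I l m n then cf V I l m n else 0)"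
  have cT: "cf T I l m n = (if n = p - 1 \<and> slot2 N I l m n then cf V I l m n else 0)" for I l m n
  proof (cases "allowed I l m n")
    case False
    then have "\<not> slot2 N I l m n" by (simp add: slot2_def surv_def)
    then show ?thesis using False by (simp add: T_def cf_mkpv)
  qed (simp add: T_def cf_mkpv)
  have VT: "V \<in> Ktot (p + q)" using V by (simp add: ssZ_def)
  have T2: "T \<in> type2 a b \<alpha> \<beta> N"
  proof (rule slot2_imp_type2)
    show "slot2 N I l m n" if "cf T I l m n \<noteq> 0" for I l m n
      using that unfolding cT by metis
  qed
  have "l + m + 2 + int (card I) = q" if "cf V I l m (p - 1) \<noteq> 0" for I l m
  proof -
    have "l + m + (p - 1) + 3 + int (card I) = p + q" using VT that unfolding Ktot_iff by blast
    then show ?thesis by simp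
  qed
  note deg = this
  have TP: "T \<in> PP q p"
    unfolding PP_iff
  proof (intro allI impI)
    fix I and l m n :: int
    assume "cf T I l m n \<noteq> 0"
    then have "n = p - 1" "cf V I l m n \<noteq> 0" unfolding cT by metis+
    then show "l + m + 2 + int (card I) = q \<and> n + 1 = p" using deg[of I l m] by simp
  qed
  obtain U where U: "U \<in> type1 a b \<alpha> \<beta> N sel p q"
    and cU: "\<And>I i. admissible a b i \<Longrightarrow> p - 1 = \<beta> * int i \<Longrightarrow> \<not> {X1, X2} \<subseteq> I \<Longrightarrow>
      cf U I (int (\<alpha> * i)) (int (\<alpha> * i)) (\<beta> * int i) = cf V I (int (\<alpha> * i)) (int (\<alpha> * i)) (\<beta> * int i)"
  proof (cases "type1_index a b \<alpha> \<beta> p q = {}")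
    case True
    have "cf V I (int (\<alpha> * i)) (int (\<alpha> * i)) (\<beta> * int i) = 0"
      if i: "admissible a b i" "p - 1 = \<beta> * int i" "\<not> {X1, X2} \<subseteq> I" for I i
    proof (rule ccontr)
      assume "cf V I (int (\<alpha> * i)) (int (\<alpha> * i)) (\<beta> * int i) \<noteq> 0"
      then have "int (\<alpha> * i) + int (\<alpha> * i) + \<beta> * int i + 3 + int (card I) = p + q"
        using VT unfolding Ktot_iff by blast
      then have "q = int (2 * \<alpha> * i + 2 + card I)" unfolding i(2)[symmetric] by simp
      moreover have "card I \<le> 2" using i(3) by (cases I rule: coord_set_cases) auto
      moreover have "p = \<beta> * int i + 1" using i(2) by linarith
      ultimately have "(i, card I) \<in> type1_index a b \<alpha> \<beta> p q" using i(1) unfolding type1_index_def by blast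
      then show False using True by simp
    qed
    then show ?thesis using that[OF type1_memI_0[OF True]] by simp
  next
    case False
    then obtain i c where ic: "(i, c) \<in> type1_index a b \<alpha> \<beta> p q" by auto
    obtain w where w: "cdeg w = c" "permitted a b i w"
      "\<And>I. \<not> {X1, X2} \<subseteq> I \<Longrightarrow> wcoef (if N \<le> i then w else closed_seq w 0) I
       = cf V I (int (\<alpha> * i)) (int (\<alpha> * i)) (\<beta> * int i)"
      using cycle_datum[OF V r ic] by blast
    have i: "admissible a b i" "p - 1 = \<beta> * int i" using ic by (auto simp: type1_index_def)
    have "rep1 a b \<alpha> \<beta> N sel i w \<in> type1 a b \<alpha> \<beta> N sel p q"
      using type1_memI[OF _ w(2)] type1_index_unique[OF ic] w(1) by simp
    moreover have "cf (rep1 a b \<alpha> \<beta> N sel i w) I (int (\<alpha> * i')) (int (\<alpha> * i')) (\<beta> * int i') =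
        cf V I (int (\<alpha> * i')) (int (\<alpha> * i')) (\<beta> * int i')"
      if i': "admissible a b i'" "p - 1 = \<beta> * int i'" "\<not> {X1, X2} \<subseteq> I" for I i'
    proof -
      have "\<beta> * int i' = \<beta> * int i" using i(2) i'(2) by linarith
      then have "i' = i" by (rule admissible_beta_inj[OF i'(1) i(1)])
      then show ?thesis
        using cf_rep1_leading[OF sel i(1) w(2)] w(3)[OF i'(3)] rseq_0[OF sel i(1) w(2)] by (simp del: of_nat_mult)
    qed
    ultimately show ?thesis by (rule that)
  qed
  have "agree N p V (T + U)"
    unfolding agree_def
  proof (intro allI impI)
    fix I l m assume s: "surv N I l m (p - 1)"
    show "cf V I l m (p - 1) = cf (T + U) I l m (p - 1)"
    proof (cases "slot2 N I l m (p - 1)")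
      case True
      then show ?thesis using type1_slot2[OF sel U True] by (simp add: cT)
    next
      case False
      then obtain i where i: "admissible a b i" "l = int (\<alpha> * i)" "m = int (\<alpha> * i)" "p - 1 = \<beta> * int i"
        "\<not> {X1, X2} \<subseteq> I" using resonant_slot[OF s] by blast
      have "cf T I l m (p - 1) = 0" using False by (simp add: cT)
      moreover have "cf U I l m (p - 1) = cf V I l m (p - 1)" using cU[OF i(1,4,5)] i by simp
      ultimately show ?thesis by simp
    qed
  qed
  moreover have "T + U \<in> reps a b \<alpha> \<beta> N sel p q" unfolding reps_def using T2 TP U by blast
  ultimately show ?thesis using that by blast
qed

section \<open>The packages\<close>

lemma ssZ_mono: "r \<le> r' \<Longrightarrow> ssZ d r' p q \<subseteq> ssZ d r p q"
  by (rule subsetI) (simp add: ssZ_def, metis Kfil_mono add_left_mono)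

lemma ssZ_diff:
  assumes "U \<in> ssZ (dif a b) r p q" "V \<in> ssZ (dif a b) r p q"
  shows "U - V \<in> ssZ (dif a b) r p q"
  using assms by (simp add: ssZ_def dif_diff Kfil_diff Ktot_diff)

lemma agree_diff: "agree N p (U - V) 0 \<longleftrightarrow> agree N p U V"
  by (simp add: agree_def)

text \<open>On the right r enters only through the cycles, not through the relation; this makes the
  comparison within a package canonical.\<close>

lemma ssrel_iff:
  assumes r: "in_package N r"
  shows "(U, V) \<in> ssrel (dif a b) r p q \<longleftrightarrow>
    U \<in> ssZ (dif a b) r p q \<and> V \<in> ssZ (dif a b) r p q \<and> agree N p U V"
  unfolding ssrel_def
  using ssN_imp_agree[OF _ r, of "U - V" p q] agree_imp_ssN[OF ssZ_diff r, of U p q V] agree_diff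
  by blast

lemma ssclass_eq_iff:
  assumes r: "in_package N r" and U: "U \<in> ssZ (dif a b) r p q" and V: "V \<in> ssZ (dif a b) r p q"
  shows "ssclass (dif a b) r p q U = ssclass (dif a b) r p q V \<longleftrightarrow> agree N p U V"
proof -
  have mem: "W \<in> ssclass (dif a b) r p q X \<longleftrightarrow> W \<in> ssZ (dif a b) r p q \<and> agree N p X W"
    if "X \<in> ssZ (dif a b) r p q" for X W
    using that by (simp add: ssclass_def ssrel_iff[OF r])
  have "V \<in> ssclass (dif a b) r p q V" using V by (simp add: mem) (simp add: agree_def)
  then show ?thesis
    using U V by (auto simp: set_eq_iff mem) (auto simp: agree_def)
qed

lemma ssE_eq: "ssE d r p q = ssclass d r p q ` ssZ d r p q"
  by (auto simp: ssE_def quotient_def ssclass_def)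

lemma system_of_reps_reps:
  assumes sel: "coef_selection a b \<alpha> N sel" and r: "in_package N r"
  shows "system_of_reps (dif a b) r p q (reps a b \<alpha> \<beta> N sel p q)"
proof -
  note sub = reps_subset[OF sel r, of p q]
  have "inj_on (ssclass (dif a b) r p q) (reps a b \<alpha> \<beta> N sel p q)"
    using sub ssclass_eq_iff[OF r] reps_agree_imp_eq[OF sel] by (meson inj_onI subsetD)
  moreover have "ssclass (dif a b) r p q V \<in> ssclass (dif a b) r p q ` reps a b \<alpha> \<beta> N sel p q"
    if V: "V \<in> ssZ (dif a b) r p q" for V
  proof -
    obtain R where R: "R \<in> reps a b \<alpha> \<beta> N sel p q" "agree N p V R"
      using reps_exhaust[OF sel r V] .
    then have "ssclass (dif a b) r p q V = ssclass (dif a b) r p q R"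
      using ssclass_eq_iff[OF r V] sub by blast
    then show ?thesis using R by blast
  qed
  ultimately show ?thesis
    unfolding system_of_reps_def bij_betw_def ssE_eq using sub by blast
qed

text \<open>Injectivity holds because \<open>agree\<close> is the same relation at both levels,
  surjectivity because each class of level r contains a listed representative, which is also a cycle
  of level \<open>r'\<close>.\<close>

lemma ss_canon_iso_package:
  assumes r: "in_package N r" and r': "in_package N r'" and le: "r \<le> r'"
  shows "ss_canon_iso (dif a b) r r'"
  unfolding ss_canon_iso_def
proof (intro allI)
  fix p q
  obtain sel where sel: "coef_selection a b \<alpha> N sel" using coef_selection_exists by blast
  let ?c = "ssclass (dif a b) r p q" and ?c' = "ssclass (dif a b) r' p q"
    and ?Z = "ssZ (dif a b) r p q" and ?Z' = "ssZ (dif a b) r' p q"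
  have sub: "?Z' \<subseteq> ?Z" by (rule ssZ_mono[OF le])
  have iff: "?c U = ?c V \<longleftrightarrow> ?c' U = ?c' V" if "U \<in> ?Z'" "V \<in> ?Z'" for U V
    using that sub ssclass_eq_iff[OF r] ssclass_eq_iff[OF r'] by blast
  define f where "f C = ?c (SOME U. U \<in> ?Z' \<and> ?c' U = C)" for C
  have f: "f (?c' U) = ?c U" if "U \<in> ?Z'" for U
  proof -
    have "(SOME V. V \<in> ?Z' \<and> ?c' V = ?c' U) \<in> ?Z' \<and> ?c' (SOME V. V \<in> ?Z' \<and> ?c' V = ?c' U) = ?c' U"
      by (rule someI[of _ U]) (use that in simp)
    then show ?thesis unfolding f_def using iff that by blast
  qed
  have "inj_on f (?c' ` ?Z')"
    by (rule inj_onI) (use f iff in auto)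
  moreover have "?c V \<in> f ` ?c' ` ?Z'" if V: "V \<in> ?Z" for V
  proof -
    obtain R where R: "R \<in> reps a b \<alpha> \<beta> N sel p q" "agree N p V R"
      using reps_exhaust[OF sel r V] .
    have R': "R \<in> ?Z'" using R(1) reps_subset[OF sel r'] by blast
    then have "?c V = ?c R" using ssclass_eq_iff[OF r V] sub R(2) by blast
    then have "?c V = f (?c' R)" using f[OF R'] by simp
    then show ?thesis using R' by blast
  qed
  moreover have "f ` ?c' ` ?Z' \<subseteq> ?c ` ?Z" using f sub by auto
  ultimately have "bij_betw f (ssE (dif a b) r' p q) (ssE (dif a b) r p q)"
    unfolding bij_betw_def ssE_eq by blast
  then show "\<exists>f. bij_betw f (ssE (dif a b) r' p q) (ssE (dif a b) r p q) \<and> (\<forall>U\<in>?Z'. f (?c' U) = ?c U)"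
    using f by blast
qed

text \<open>Modulo \<open>ssN\<close> a cycle of level \<open>r\<close> is a listed representative, which is a cycle of level \<open>r + 2\<close>.\<close>

lemma dif_in_ssN:
  assumes r: "in_package N r" and r2: "in_package N (r + 2)" and U: "U \<in> ssZ (dif a b) r p q"
  shows "dif a b U \<in> ssN (dif a b) r (p + r) (q + 1 - r)"
proof -
  obtain sel where sel: "coef_selection a b \<alpha> N sel" using coef_selection_exists by blast
  obtain R where R: "R \<in> reps a b \<alpha> \<beta> N sel p q" "agree N p U R"
    using reps_exhaust[OF sel r U] .
  have R2: "R \<in> ssZ (dif a b) (r + 2) p q" using R(1) reps_subset[OF sel r2] by blast
  have "r \<le> r + 2" by simp
  have Rr: "R \<in> ssZ (dif a b) r p q" using R2 ssZ_mono[OF \<open>r \<le> r + 2\<close>] by blast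
  have "U - R \<in> ssN (dif a b) r p q"
    using agree_imp_ssN[OF ssZ_diff[OF U Rr] r] R(2) agree_diff by blast
  then obtain Z W where UR: "U - R = Z + dif a b W" and Z: "Z \<in> Kfil (p + 1)"
    by (auto simp: ssN_def ssZ_def ssB_def)
  have dZ: "dif a b Z = dif a b U - dif a b R"
    using arg_cong[OF UR, of "dif a b"] by (simp add: dif_diff dif_add dif_dif)
  have dU: "dif a b U \<in> Kfil (p + r)" "dif a b U \<in> Ktot (p + q + 1)"
    using U dif_Ktot by (auto simp: ssZ_def)
  have dR: "dif a b R \<in> Kfil (p + r + 2)" "dif a b R \<in> Ktot (p + q + 1)"
    using R2 dif_Ktot[of R "p + q" a b] by (auto simp: ssZ_def add.assoc)
  have "dif a b R \<in> ssZ (dif a b) (r - 1) (p + r + 1) (q + 1 - r - 1)"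
    using Kfil_mono[OF dR(1), of "p + r + 1"] dR(2) by (simp add: ssZ_def dif_dif Kfil_0 algebra_simps)
  \<comment> \<open>Z lies in \<open>K_(p+1)\<close>, and \<open>p + 1 = (p + r) - (r - 1)\<close>
    is the filtration degree required of a primitive.\<close>
  moreover have "dif a b Z \<in> ssB (dif a b) (r - 1) (p + r) (q + 1 - r)"
  proof -
    have "dif a b Z \<in> Kfil (p + r)"
      unfolding dZ by (rule Kfil_diff[OF dU(1) Kfil_mono[OF dR(1)]]) simp
    moreover have "dif a b Z \<in> Ktot (p + q + 1)" unfolding dZ by (rule Ktot_diff[OF dU(2) dR(2)])
    ultimately show ?thesis using Z by (simp add: ssB_def algebra_simps)
  qed
  moreover have "dif a b U = dif a b R + dif a b Z" by (simp add: dZ)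
  ultimately show ?thesis unfolding ssN_def by blast
qed

lemma ssd_zero_package:
  assumes r: "in_package N r" and r2: "in_package N (r + 2)"
  shows "ssd_zero (dif a b) r"
  unfolding ssd_zero_def
proof (intro allI ballI)
  fix p q C assume "C \<in> ssE (dif a b) r p q"
  then obtain V where V: "V \<in> ssZ (dif a b) r p q" and C: "C = ssclass (dif a b) r p q V"
    by (auto simp: ssE_eq)
  have "V \<in> C" using V by (simp add: C ssclass_def ssrel_iff[OF r]) (simp add: agree_def)
  have "ssclass (dif a b) r (p + r) (q + 1 - r) (dif a b U) = ssclass (dif a b) r (p + r) (q + 1 - r) 0"
    if "U \<in> C" for U
  proof -
    have U: "U \<in> ssZ (dif a b) r p q" using that by (simp add: C ssclass_def ssrel_iff[OF r])
    have "dif a b U \<in> ssZ (dif a b) r (p + r) (q + 1 - r)"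
      using U dif_Ktot[of U "p + q"] by (simp add: ssZ_def dif_dif Kfil_0 algebra_simps)
    moreover have "0 \<in> ssZ (dif a b) r (p + r) (q + 1 - r)"
      by (simp add: ssZ_def dif_0 Kfil_0 Ktot_0)
    ultimately show ?thesis
      using ssclass_eq_iff[OF r] ssN_imp_agree[OF dif_in_ssN[OF r r2 U] r] by blast
  qed
  note const = this
  have "ssd (dif a b) r p q C = (\<Union>U\<in>C. ssclass (dif a b) r (p + r) (q + 1 - r) 0)"
    unfolding ssd_def by (rule SUP_cong[OF refl const])
  also have "\<dots> = ssclass (dif a b) r (p + r) (q + 1 - r) 0" using \<open>V \<in> C\<close> by blast
  finally show "ssd (dif a b) r p q C = ssclass (dif a b) r (p + r) (q + 1 - r) 0" .
qed

end

theorem theorem1: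
  fixes a b :: real and \<alpha> n :: nat and \<beta> :: int
  assumes "a \<noteq> 0" and "b \<noteq> 0" and "exponents a b \<alpha> \<beta>"
  shows "(\<forall>r\<in>package \<alpha> n. r \<le> 2 * int n * int \<alpha> \<longrightarrow> ssd_zero (dif a b) r)
    \<and> (\<forall>r\<in>package \<alpha> n. \<forall>r'\<in>package \<alpha> n. r \<le> r' \<longrightarrow> ss_canon_iso (dif a b) r r')
    \<and> (\<forall>sel. coef_selection a b \<alpha> n sel \<longrightarrow>
         (\<forall>r\<in>package \<alpha> n. \<forall>p q.
            system_of_reps (dif a b) r p q (reps a b \<alpha> \<beta> n sel p q)))"
proof -
  interpret quadratic a b \<alpha> \<beta> using assms by unfold_locales
  \<comment> \<open>Below the last term of a package the next even level still belongs to it; for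
    \<open>n = 0\<close> there is no such r.\<close>
  have "in_package n (r + 2)" if "in_package n r" "r \<le> 2 * int n * int \<alpha>" for r
    using that by (auto simp: in_package_def mult.commute)
  then show ?thesis
    using package_in_package ssd_zero_package ss_canon_iso_package system_of_reps_reps by meson
qed

end
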